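(* Let $p$ be a prime, let $Q=p^s$ with $s\ge1$, let $u\ge 1$ be an integer, and let $f(x)\in\mathbb F_Q[x]$ have degree $d\ge 2$ with $\gcd(d,p)=1$. Let $X/\mathbb F_Q$ be the generalized Artin-Schreier curve $X:y^{p^u}-y=f(x)$, and let $\tau=(p-1)\lceil\log_p(d)\rceil$. Then $$NP_1(X/\mathbb F_Q)\ \ge\ \frac1\tau .$$
   Context: The curve $X$ means the smooth projective absolutely irreducible curve over $\mathbb F_Q$ with the given affine equation; its genus is $g=(p^u-1)(d-1)/2$. The $L$-polynomial of $X/\mathbb F_Q$ is $L_X(T)=\exp\left(\sum_{i\ge1}(\#X(\mathbb F_{Q^i})-Q^i-1)\frac{T^i}{i}\right)=\sum_{i=0}^{2g}c_iT^i\in\mathbb Z[T]$. The Newton polygon $NP(X/\mathbb F_Q)$ is the lower convex hull of the points $(i,\mathrm{ord}_p(c_i)/s)$, $0\le i\le 2g$, where $\mathrm{ord}_p$ is the $p$-adic valuation and $\mathrm{ord}_p(0)=\infty$. $NP_1(X/\mathbb F_Q)$ denotes its first slope (the slope of its leftmost segment). *)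

theory Defs
  imports "HOL-Analysis.Analysis" "HOL-Algebra.Algebraic_Closure_Type"
    "HOL-Algebra.Generated_Fields"
begin

section \<open>Places of a function field\<close>

text \<open>
  All function fields are subfields of one ambient type-class field \<open>'b\<close>.
  The closed points of the smooth projective curve with function field \<open>F\<close> over the finite
  field \<open>K\<close> are the places of \<open>F\<close> over \<open>K\<close>. A place is represented by its valuation ring.
\<close>

definition valuation_rings :: "'b::field set \<Rightarrow> 'b set \<Rightarrow> 'b set set" where
  "valuation_rings K F =
     {R. subring R ring_of_type_algebra \<and> K \<subset> R \<and> R \<subset> F \<and> (\<forall>z\<in>F. z \<in> R \<or> inverse z \<in> R)}"

definition maximal_ideal_of :: "'b::field set \<Rightarrow> 'b set" where
  "maximal_ideal_of R = {z \<in> R. z = 0 \<or> inverse z \<notin> R}"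

text \<open>Places of degree one: the residue field of the valuation ring is \<open>K\<close> itself.\<close>

definition rational_places :: "'b::field set \<Rightarrow> 'b set \<Rightarrow> 'b set set" where
  "rational_places K F =
     {R \<in> valuation_rings K F. \<forall>z\<in>R. \<exists>c\<in>K. z - c \<in> maximal_ideal_of R}"

section \<open>The curve $y^q - y = f(x)$\<close>

text \<open>
  The base field is the finite type \<open>'a\<close>, so that \<open>Q = CARD('a)\<close>. Everything takes place inside
  an algebraic closure of the rational function field \<open>'a(x)\<close>, which also contains the extension
  of degree \<open>i\<close> of \<open>'a\<close>, as the set of roots of \<open>Z ^ (Q ^ i) - Z\<close>.
\<close>

type_synonym 'a ambient = "'a poly fract alg_closure"

definition of_poly :: "'a::field poly \<Rightarrow> 'a ambient" where
  "of_poly g = to_ac (Fraction_Field.Fract g 1)"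

definition coord_x :: "'a::field ambient" where
  "coord_x = of_poly [:0, 1:]"

text \<open>
  \<open>of_poly f\<close> is \<open>f(x)\<close>. In the absolutely irreducible case another choice of the root yields an
  isomorphic function field over each constant field, hence the same numbers of points.
\<close>

definition coord_y :: "nat \<Rightarrow> 'a::field poly \<Rightarrow> 'a ambient" where
  "coord_y q f = (SOME y. y ^ q - y = of_poly f)"

lemma coord_y_equation:
  fixes f :: "'a::field poly"
  assumes "q \<ge> 2"
  shows "coord_y q f ^ q - coord_y q f = of_poly f"
proof -
  define P :: "'a ambient poly" where
    "P = Polynomial.monom 1 q + [:- of_poly f, - 1:]"
  have "Polynomial.degree [:- of_poly f, - 1 :: 'a ambient:] < q"
    using assms by simp
  then have "Polynomial.degree P = q"
    unfolding P_def by (subst degree_add_eq_left) (simp_all add: Polynomial.degree_monom_eq)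
  with assms obtain y where "poly P y = 0"
    using alg_closed_imp_poly_has_root[of P] by auto
  then have "y ^ q - y = of_poly f"
    by (simp add: P_def poly_monom algebra_simps)
  then show ?thesis
    unfolding coord_y_def by (rule someI)
qed

definition const_ext :: "nat \<Rightarrow> 'a::{field,finite} ambient set" where
  "const_ext i = {z. z ^ (CARD('a) ^ i) = z}"

definition curve_field :: "nat \<Rightarrow> 'a::{field,finite} poly \<Rightarrow> nat \<Rightarrow> 'a ambient set" where
  "curve_field q f i =
     generate_field ring_of_type_algebra (const_ext i \<union> {coord_x, coord_y q f})"

text \<open>
  The points over the extension of degree \<open>i\<close> of the smooth projective curve are the places of
  degree one of its function field after extending the constants.
\<close>

definition curve_points :: "nat \<Rightarrow> 'a::{field,finite} poly \<Rightarrow> nat \<Rightarrow> 'a ambient set set" where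
  "curve_points q f i = rational_places (const_ext i) (curve_field q f i)"

definition curve_genus :: "nat \<Rightarrow> 'a::{field,finite} poly \<Rightarrow> nat" where
  "curve_genus q f = ((q - 1) * (Polynomial.degree f - 1)) div 2"

definition L_series :: "nat \<Rightarrow> 'a::{field,finite} poly \<Rightarrow> rat fps" where
  "L_series q f =
     fps_compose (fps_exp 1)
       (Abs_fps (\<lambda>i. if i = 0 then 0
          else (of_nat (card (curve_points q f i)) - of_nat (CARD('a) ^ i) - 1) / of_nat i))"

section \<open>Newton polygons\<close>

definition rat_ord :: "nat \<Rightarrow> rat \<Rightarrow> int" where
  "rat_ord p c = int (multiplicity (int p) (fst (quotient_of c)))
               - int (multiplicity (int p) (snd (quotient_of c)))"

text \<open>
  The polygon is the function whose graph is the lower boundary of the convex hull. A coefficient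
  zero has order \<open>\<infinity>\<close> and contributes no point; the value is \<open>\<infinity>\<close> where the hull is empty.
\<close>

definition newton_polygon :: "nat \<Rightarrow> nat \<Rightarrow> nat \<Rightarrow> (nat \<Rightarrow> rat) \<Rightarrow> real \<Rightarrow> ereal" where
  "newton_polygon p s n c t =
     (INF y \<in> {y. (t, y) \<in> convex hull
          {(real i, real_of_int (rat_ord p (c i)) / real s) | i. i \<le> n \<and> c i \<noteq> 0}}. ereal y)"

text \<open>
  The slope of the leftmost segment, for a polygon with finite value at \<open>0\<close>. If the polygon
  is \<open>\<infinity>\<close> to the right of \<open>0\<close>, the slope is \<open>\<infinity>\<close>; this does not occur for a curve of
  positive genus, as its \<open>L\<close>-polynomial has a nonzero coefficient in degree \<open>2g\<close>.
\<close>

definition first_slope :: "(real \<Rightarrow> ereal) \<Rightarrow> ereal" where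
  "first_slope \<phi> = (THE m. \<exists>\<epsilon>>0. \<forall>t. 0 < t \<and> t < \<epsilon> \<longrightarrow> \<phi> t = \<phi> 0 + ereal t * m)"

text \<open>
  \<open>s\<close> is meant to be the degree of the base field over its prime field of characteristic \<open>p\<close>.
\<close>

definition NP :: "nat \<Rightarrow> nat \<Rightarrow> nat \<Rightarrow> 'a::{field,finite} poly \<Rightarrow> real \<Rightarrow> ereal" where
  "NP p s q f = newton_polygon p s (2 * curve_genus q f) (fps_nth (L_series q f))"

definition NP1 :: "nat \<Rightarrow> nat \<Rightarrow> nat \<Rightarrow> 'a::{field,finite} poly \<Rightarrow> ereal" where
  "NP1 p s q f = first_slope (NP p s q f)"

end

theory Submission
  imports Defs "HOL-Number_Theory.Residues"
begin

text \<open>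
  Counting solutions of \<open>y\<^sup>q - y = f(x)\<close> with additive characters turns \<open>#X - Q\<^sup>i - 1\<close>
  over the field with \<open>Q\<^sup>i\<close> elements into an exponential sum \<open>S\<^sub>i\<close>, once the places of degree
  one are identified with the affine points and one
  point at infinity. Written in the digits of \<open>x\<close> with respect to a basis over the prime field, the
  phase \<open>Tr(b f(x))\<close> has degree at most \<open>\<tau>\<close>, so that Ax's argument (by Fleck's congruence) gives
  \<open>ord\<^sub>p(S\<^sub>i) \<ge> s i / \<tau>\<close>.

  The series \<open>L = exp(\<Sum> S\<^sub>i T\<^sup>i / i)\<close> is the generating function of a multiplicative weight on
  Frobenius-invariant cycles of pairs \<open>(b, x)\<close>. In high degree, adding a monomial to the polynomials
  encoding a cycle permutes the cycles and multiplies the weight by a nontrivial character value, so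
  \<open>L\<close> is a polynomial. This is essential: \<open>T L' = (\<Sum> S\<^sub>i T\<^sup>i) L\<close> and the bound on \<open>S\<^sub>i\<close> do not bound
  the coefficients of an arbitrary series because of the denominators \<open>n\<close>. For an irreducible factor
  \<open>\<pi>\<close> of a polynomial \<open>L\<close>, however, a Bezout identity gives \<open>1 = \<pi> W\<close> with the terms of \<open>W\<close> bounded
  below in the Gauss valuation, and this forces nonnegative valuation on every term of \<open>\<pi>\<close>.
\<close>

subsection \<open>Finite differences and sums over boxes\<close>

text \<open>The valuation lives on the rationals, whereas the sum attached to a single character
  lies in the p-th cyclotomic field. Two devices avoid extending it. Grouping the characters
  \<open>b\<close> by their multiples under the units of the prime field turns the sums into counts
  of zeros of traces, at the price of a factor p - 1, which is prime to p. The cycle weights are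
  plain complex numbers and serve only to show that coefficients vanish, which descends to the
  rational coefficients because \<open>of_rat\<close> is injective. The constant
  \<open>\<tau>\<close> comes from digits in base p: Frobenius is linear in the coordinates of
  \<open>x\<close>, so \<open>x ^ n\<close> costs p - 1 for each digit of n, and gcd(d, p) = 1 makes
  d strictly smaller than p^ceil(log_p d). The same coprimality makes d invertible in the field, as
  Newton's identities require, and makes monomials of equal pole order at infinity proportional up
  to lower order. That last fact organises the geometry: it gives the evaluation at points of the
  curve and the uniqueness of the place above the pole of x.\<close>

definition fdiff :: "(int \<Rightarrow> int) \<Rightarrow> int \<Rightarrow> int" where
  "fdiff g t = g (t + 1) - g t"

text \<open>The shift by one is 1 + \<open>fdiff\<close>; this is the binomial expansion of its t-th
  power.\<close>

lemma newton_forward: "g (a + int t) = (\<Sum>k\<le>t. int (t choose k) * (fdiff ^^ k) g a)"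
proof (induction t arbitrary: g)
  case 0
  show ?case by simp
next
  case (Suc t)
  have "g (a + int (Suc t)) = g (a + int t) + fdiff g (a + int t)"
    by (simp add: fdiff_def algebra_simps)
  also have "\<dots> = (\<Sum>k\<le>t. int (t choose k) * (fdiff ^^ k) g a)
      + (\<Sum>k\<le>t. int (t choose k) * (fdiff ^^ Suc k) g a)"
    using Suc[of g] Suc[of "fdiff g"] by (simp add: funpow_swap1)
  also have "(\<Sum>k\<le>t. int (t choose k) * (fdiff ^^ k) g a) =
      (\<Sum>k\<le>Suc t. int (t choose k) * (fdiff ^^ k) g a)"
    by simp
  also have "\<dots> = g a + (\<Sum>k\<le>t. int (t choose Suc k) * (fdiff ^^ Suc k) g a)"
    by (subst sum.atMost_Suc_shift) simp
  also have "g a + (\<Sum>k\<le>t. int (t choose Suc k) * (fdiff ^^ Suc k) g a)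
      + (\<Sum>k\<le>t. int (t choose k) * (fdiff ^^ Suc k) g a)
      = g a + (\<Sum>k\<le>t. int (Suc t choose Suc k) * (fdiff ^^ Suc k) g a)"
    by (simp add: sum.distrib distrib_right del: funpow.simps)
  also have "\<dots> = (\<Sum>k\<le>Suc t. int (Suc t choose k) * (fdiff ^^ k) g a)"
    by (subst sum.atMost_Suc_shift) simp
  finally show ?case .
qed

text \<open>Fleck's congruence: periodicity turns \<open>(1 + \<Delta>)\<^sup>p = 1\<close> into a formula for \<open>\<Delta>\<^sup>p\<close> whose
  coefficients are divisible by \<open>p\<close>.\<close>

lemma fdiff_periodic:
  assumes "\<And>t. F (t + int p) = F t"
  shows "(fdiff ^^ m) F (t + int p) = (fdiff ^^ m) F t"
proof (induction m arbitrary: t)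
  case (Suc m)
  have "(fdiff ^^ m) F (t + int p + 1) = (fdiff ^^ m) F (t + 1)"
    using Suc[of "t+1"] by (simp add: algebra_simps)
  with Suc[of t] show ?case by (simp add: fdiff_def[of "(fdiff ^^ m) F"])
qed (simp add: assms)

lemma fdiff_funpow_scale: "(fdiff ^^ m) ((fdiff ^^ k) g) = (fdiff ^^ (m + k)) g"
  by (simp add: funpow_add)

text \<open>Replacing p differences by k < p of them and one factor p costs at most p - 1
  differences, namely for k = 1. So j differences yield ceil(j / (p - 1)) - 1 factors p; the extra p
  in the conclusion absorbs the - 1.\<close>

lemma fleck:
  assumes p: "Factorial_Ring.prime (p::nat)" and per: "\<And>t. F (t + int p) = F t"
  shows "m * (p - 1) < j + (p - 1) \<Longrightarrow> int p ^ m dvd int p * (fdiff ^^ j) F t"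
proof (induction j arbitrary: m t rule: less_induct)
  case (less j)
  have p1: "p > 1" using p prime_gt_1_nat by blast
  show ?case
  \<comment> \<open>With fewer than p differences the hypothesis leaves only
    \<open>m \<le> 1\<close>, which the extra factor p pays for.\<close>
  proof (cases "j < p")
    case True
    have "m \<le> 1"
    proof (rule ccontr)
      assume "\<not> m \<le> 1"
      then have "2 * (p - 1) \<le> m * (p - 1)" by (intro mult_right_mono) auto
      with less.prems True show False by linarith
    qed
    then have "m = 0 \<or> m = 1" by auto
    then show ?thesis by auto
  next
    case False
    define g where "g = (fdiff ^^ (j - p)) F"
    show ?thesis
    proof (cases m)
      case (Suc n)
      have "g (t + int p) = g t" unfolding g_def by (rule fdiff_periodic[where F = F, OF per])
      then have "0 = (\<Sum>k\<le>p. int (p choose k) * (fdiff ^^ k) g t) - g t"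
        using newton_forward[of g t p] by simp
      also have "(\<Sum>k\<le>p. int (p choose k) * (fdiff ^^ k) g t) =
          g t + (\<Sum>k\<in>{0<..<p}. int (p choose k) * (fdiff ^^ k) g t) + (fdiff ^^ p) g t"
      proof -
        have "{..p} = insert 0 (insert p {0<..<p})" using p1 by auto
        then show ?thesis using p1 by simp
      qed
      finally have eq: "(fdiff ^^ p) g t = - (\<Sum>k\<in>{0<..<p}. int (p choose k) * (fdiff ^^ k) g t)"
        by simp
      have "int p ^ n dvd (\<Sum>k\<in>{0<..<p}. int (p choose k) * (fdiff ^^ k) g t)"
      proof (rule dvd_sum)
        fix k assume k: "k \<in> {0<..<p}"
        have "p dvd (p choose k)" using k p by (intro dvd_choose_prime) auto
        then obtain c where c: "p choose k = p * c" by blast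
        have "int p ^ n dvd int p * (fdiff ^^ (k + (j - p))) F t"
        proof (rule less.IH)
          show "k + (j - p) < j" using k False by auto
          have "n * (p - 1) + (p - 1) < j + (p - 1)" using less.prems Suc by simp
          then show "n * (p - 1) < k + (j - p) + (p - 1)" using k False by auto
        qed
        then have "int p ^ n dvd int c * (int p * (fdiff ^^ (k + (j - p))) F t)" by simp
        then show "int p ^ n dvd int (p choose k) * (fdiff ^^ k) g t"
          by (simp add: g_def fdiff_funpow_scale c mult_ac del: funpow.simps)
      qed
      then have "int p ^ n dvd (fdiff ^^ p) g t" unfolding eq by simp
      then have "int p ^ n dvd (fdiff ^^ j) F t"
        using False by (simp add: g_def fdiff_funpow_scale)
      then show ?thesis by (simp add: Suc mult_dvd_mono)
    qed simp
  qed
qed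

text \<open>The functions with \<open>deg_less n\<close> are the integer-valued polynomials of total degree less than \<open>n\<close>.\<close>

definition pdiff :: "nat \<Rightarrow> ((nat \<Rightarrow> nat) \<Rightarrow> int) \<Rightarrow> (nat \<Rightarrow> nat) \<Rightarrow> int" where
  "pdiff i h x = h (x(i := x i + 1)) - h x"

primrec deg_less :: "nat \<Rightarrow> ((nat \<Rightarrow> nat) \<Rightarrow> int) \<Rightarrow> bool" where
  "deg_less 0 h \<longleftrightarrow> (\<forall>x. h x = 0)"
| "deg_less (Suc n) h \<longleftrightarrow> (\<forall>i. deg_less n (pdiff i h))"

lemma pdiff_const: "pdiff i (\<lambda>x. c) = (\<lambda>x. 0)"
  by (simp add: pdiff_def fun_eq_iff)

lemma deg_less_0: "deg_less n (\<lambda>x. 0)"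
  by (induction n) (auto simp: pdiff_const)

lemma deg_less_const: "deg_less (Suc n) (\<lambda>x. c)"
  by (auto simp: pdiff_const deg_less_0)

lemma deg_less_add: "deg_less n g \<Longrightarrow> deg_less n h \<Longrightarrow> deg_less n (\<lambda>x. g x + h x)"
proof (induction n arbitrary: g h)
  case (Suc n)
  have "pdiff i (\<lambda>x. g x + h x) = (\<lambda>x. pdiff i g x + pdiff i h x)" for i
    by (auto simp: pdiff_def)
  with Suc show ?case by auto
qed auto

lemma deg_less_cmult: "deg_less n h \<Longrightarrow> deg_less n (\<lambda>x. c * h x)"
proof (induction n arbitrary: h)
  case (Suc n)
  have "pdiff i (\<lambda>x. c * h x) = (\<lambda>x. c * pdiff i h x)" for i
    by (auto simp: pdiff_def algebra_simps)
  with Suc show ?case by auto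
qed auto

lemma deg_less_cancel: "deg_less n (\<lambda>x. c * h x) \<Longrightarrow> c \<noteq> 0 \<Longrightarrow> deg_less n h"
proof (induction n arbitrary: h)
  case (Suc n)
  have "pdiff i (\<lambda>x. c * h x) = (\<lambda>x. c * pdiff i h x)" for i
    by (auto simp: pdiff_def algebra_simps)
  with Suc show ?case by auto
qed auto

lemma deg_less_Suc: "deg_less n h \<Longrightarrow> deg_less (Suc n) h"
proof (induction n arbitrary: h)
  case 0
  then show ?case by (simp add: pdiff_def)
next
  case (Suc n)
  then show ?case by (metis deg_less.simps(2))
qed

lemma deg_less_mono: "deg_less n h \<Longrightarrow> n \<le> m \<Longrightarrow> deg_less m h"
proof (induction m)
  case (Suc m)
  then show ?case by (cases "n = Suc m") (auto intro!: deg_less_Suc simp del: deg_less.simps)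
qed auto

text \<open>Discrete Leibniz rule: the difference of a product consists of the two usual terms and
  the product of both differences, each of smaller total degree. The induction runs on
  \<open>m + n\<close> because either factor may be the one that is differenced.\<close>

lemma deg_less_mult:
  "deg_less (Suc m) g \<Longrightarrow> deg_less (Suc n) h \<Longrightarrow> deg_less (Suc (m + n)) (\<lambda>x. g x * h x)"
proof (induction "m + n" arbitrary: m n g h rule: less_induct)
  case less
  \<comment> \<open>A factor whose degree bound drops to 0 vanishes and does not fit the
    \<open>Suc\<close> form of the induction hypothesis; \<open>key\<close> separates that
    case.\<close>
  have key: "deg_less (m + n) (\<lambda>x. g x * h x)"
    if "m = 0 \<and> deg_less 0 g \<or> m > 0 \<and> deg_less m g" "deg_less (Suc n) h" 
      "\<And>m' n' g h. m' + n' < m + n \<Longrightarrow> deg_less (Suc m') g \<Longrightarrow> deg_less (Suc n') h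
        \<Longrightarrow> deg_less (Suc (m' + n')) (\<lambda>x. g x * h x)" for m n g h
  proof (cases m)
    case 0
    with that show ?thesis by (simp add: deg_less_0)
  next
    case (Suc m')
    with that show ?thesis by (metis add_Suc lessI not_less_zero)
  qed
  have key': "deg_less (m + n) (\<lambda>x. g x * h x)" 
    if "deg_less m g" "deg_less (Suc n) h" for g h :: "(nat \<Rightarrow> nat) \<Rightarrow> int"
    using key[of m g n h] that less.hyps by (metis gr0I)
  have key'': "deg_less (m + n) (\<lambda>x. g x * h x)" 
    if "deg_less (Suc m) g" "deg_less n h" for g h :: "(nat \<Rightarrow> nat) \<Rightarrow> int"
    using key[of n h m g] that less.hyps by (metis (no_types, lifting) add.commute gr0I mult.commute ext)
  show ?case
    unfolding deg_less.simps
  proof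
    fix i
    have g: "deg_less m (pdiff i g)" and h: "deg_less n (pdiff i h)"
      using less.prems by auto
    have "pdiff i (\<lambda>x. g x * h x) =
        (\<lambda>x. g x * pdiff i h x + (pdiff i g x * h x + pdiff i g x * pdiff i h x))"
      by (auto simp: pdiff_def algebra_simps)
    moreover have "deg_less (m + n) \<dots>"
      by (intro deg_less_add key' key'' g h less.prems deg_less_Suc)
    ultimately show "deg_less (m + n) (pdiff i (\<lambda>x. g x * h x))" by simp
  qed
qed

text \<open>The falling factorial of \<open>g x\<close> is a product of j factors of degree at most
  w and equals j! times the binomial coefficient; the nonzero constant j! can be cancelled.\<close>

lemma deg_less_binomial:
  fixes g :: "(nat \<Rightarrow> nat) \<Rightarrow> nat"
  assumes "deg_less (Suc w) (\<lambda>x. int (g x))"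
  shows "deg_less (Suc (w * j)) (\<lambda>x. int (g x choose j))"
proof -
  have A: "deg_less (Suc (w * j)) (\<lambda>x. \<Prod>i<j. (int (g x) - int i))"
  proof (induction j)
    case 0
    show ?case by (simp add: pdiff_def)
  next
    case (Suc j)
    have "deg_less (Suc w) (\<lambda>x. int (g x) + (- int j))"
      by (intro deg_less_add assms deg_less_const)
    from deg_less_mult[OF Suc this] show ?case
      by (simp add: algebra_simps del: deg_less.simps)
  qed
  have B: "(\<Prod>i<j. (int n - int i)) = fact j * int (n choose j)" for n
  proof -
    have "real_of_int (\<Prod>i<j. (int n - int i)) = fact j * (real n gchoose j)"
      by (simp add: gbinomial_prod_rev atLeast0LessThan)
    also have "\<dots> = real_of_int (fact j * int (n choose j))"
      by (simp add: binomial_gbinomial)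
    finally show ?thesis by linarith
  qed
  show ?thesis
    using A unfolding B by (rule deg_less_cancel) simp
qed

lemma deg_less_pdiff_funpow: "deg_less (n + k) h \<Longrightarrow> deg_less n ((pdiff i ^^ k) h)"
  by (induction k arbitrary: h) (auto simp: funpow_swap1)

lemma deg_less_fix_coord: "deg_less n h \<Longrightarrow> deg_less n (\<lambda>x. h (x(i := c)))"
proof (induction n arbitrary: h)
  case (Suc n)
  have "deg_less n (pdiff j (\<lambda>x. h (x(i := c))))" for j
  proof (cases "j = i")
    case True
    then have "pdiff j (\<lambda>x. h (x(i := c))) = (\<lambda>x. 0)" by (simp add: pdiff_def fun_eq_iff)
    then show ?thesis by (simp add: deg_less_0)
  next
    case False
    have "pdiff j (\<lambda>x. h (x(i := c))) = (\<lambda>x. pdiff j h (x(i := c)))"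
      using False by (auto simp: pdiff_def fun_upd_twist)
    with Suc.IH[of "pdiff j h"] Suc.prems show ?thesis by (simp del: fun_upd_apply)
  qed
  then show ?case by (simp del: fun_upd_apply)
qed auto

section \<open>Summation of integer-valued polynomials over a box\<close>

definition cube :: "nat \<Rightarrow> nat \<Rightarrow> (nat \<Rightarrow> nat) set" where
  "cube p e = {x. (\<forall>i<e. x i < p) \<and> (\<forall>i\<ge>e. x i = 0)}"

lemma cube_0: "cube p 0 = {\<lambda>_. 0}"
  by (auto simp: cube_def)

lemma cube_Suc: "bij_betw (\<lambda>(x, t). x(e := t)) (cube p e \<times> {..<p}) (cube p (Suc e))"
proof (rule bij_betw_byWitness[where f' = "\<lambda>x. (x(e := 0), x e)"])
  show "\<forall>a\<in>cube p e \<times> {..<p}. (\<lambda>x. (x(e := 0), x e)) ((\<lambda>(x, t). x(e := t)) a) = a"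
    by (auto simp: cube_def)
qed (auto simp: cube_def less_Suc_eq_le)

lemma finite_cube [simp]: "finite (cube p e)"
proof (induction e)
  case (Suc e)
  then show ?case using bij_betw_finite[OF cube_Suc, of p e] by simp
qed (simp add: cube_0)

lemma card_cube: "card (cube p e) = p ^ e"
proof (induction e)
  case (Suc e)
  then show ?case using bij_betw_same_card[OF cube_Suc, of p e] by (simp add: mult.commute)
qed (simp add: cube_0)

lemma sum_cube_Suc: "(\<Sum>x\<in>cube p (Suc e). h x) = (\<Sum>x\<in>cube p e. \<Sum>t<p. h (x(e := t)))"
  by (subst sum.reindex_bij_betw[OF cube_Suc, symmetric])
     (simp add: sum.cartesian_product case_prod_unfold)

text \<open>Newton's formula in one variable, summed over an initial segment: the binomial
  coefficients add up as in the hockey-stick identity. For n = p prime every coefficient except the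
  last one is divisible by p.\<close>

lemma sum_newton:
  fixes h :: "(nat \<Rightarrow> nat) \<Rightarrow> int"
  shows "(\<Sum>t<n. h (x(e := t))) = (\<Sum>k<n. int (n choose Suc k) * (pdiff e ^^ k) h (x(e := 0)))"
proof (induction n arbitrary: h)
  case 0
  then show ?case by simp
next
  case (Suc n)
  have "(\<Sum>t<Suc n. h (x(e := t))) = h (x(e := 0)) + (\<Sum>t<n. h (x(e := Suc t)))"
    by (rule sum.lessThan_Suc_shift)
  also have "(\<Sum>t<n. h (x(e := Suc t))) = (\<Sum>t<n. h (x(e := t))) + (\<Sum>t<n. pdiff e h (x(e := t)))"
    by (simp add: pdiff_def sum_subtractf)
  also have "(\<Sum>t<n. pdiff e h (x(e := t))) =
      (\<Sum>k<n. int (n choose Suc k) * (pdiff e ^^ Suc k) h (x(e := 0)))"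
    unfolding Suc by (simp add: funpow_swap1)
  also have "(\<Sum>t<n. h (x(e := t))) = (\<Sum>k<n. int (n choose Suc k) * (pdiff e ^^ k) h (x(e := 0)))"
    by (rule Suc)
  also have "\<dots> = (\<Sum>k<Suc n. int (n choose Suc k) * (pdiff e ^^ k) h (x(e := 0)))"
    by simp
  also have "\<dots> = int n * h (x(e := 0)) +
       (\<Sum>k<n. int (n choose Suc (Suc k)) * (pdiff e ^^ Suc k) h (x(e := 0)))"
    by (subst sum.lessThan_Suc_shift) simp
  also have "h (x(e := 0)) + (int n * h (x(e := 0)) +
       (\<Sum>k<n. int (n choose Suc (Suc k)) * (pdiff e ^^ Suc k) h (x(e := 0)))
       + (\<Sum>k<n. int (n choose Suc k) * (pdiff e ^^ Suc k) h (x(e := 0))))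
     = int (Suc n) * h (x(e := 0)) +
       (\<Sum>k<n. int (Suc n choose Suc (Suc k)) * (pdiff e ^^ Suc k) h (x(e := 0)))"
    by (simp only: binomial_Suc_Suc of_nat_add distrib_right sum.distrib) (simp add: algebra_simps)
  also have "\<dots> = (\<Sum>k<Suc n. int (Suc n choose Suc k) * (pdiff e ^^ k) h (x(e := 0)))"
    by (subst sum.lessThan_Suc_shift) simp
  finally show ?case .
qed

text \<open>Summing over one variable either gains a factor p or uses up p - 1 of the degree, since
  only the difference of order p - 1 has a coefficient prime to p. The degree can pay for the second
  alternative only a limited number of times; all other variables contribute a factor.\<close>

lemma sum_cube_dvd:
  assumes p: "Factorial_Ring.prime (p::nat)"
  shows "deg_less n h \<Longrightarrow> n + m * (p - 1) \<le> Suc e * (p - 1) \<Longrightarrow> int p ^ m dvd (\<Sum>x\<in>cube p e. h x)"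
proof (induction e arbitrary: n m h)
  case 0
  have p1: "p > 1" using p prime_gt_1_nat by blast
  have "m \<le> 1"
  proof (rule ccontr)
    assume "\<not> m \<le> 1"
    then have "2 * (p - 1) \<le> m * (p - 1)" by (intro mult_right_mono) auto
    moreover have "m * (p - 1) \<le> p - 1" by (rule order_trans[OF add_leD2[OF 0(2)]]) simp
    ultimately show False using p1 by linarith
  qed
  then consider "m = 0" | "m = 1" by linarith
  then show ?case
  proof cases
    case 2
    with 0 have "n = 0" by simp
    with 0 show ?thesis by (simp add: cube_0)
  qed simp
next
  case (Suc e)
  have p1: "p > 1" using p prime_gt_1_nat by blast
  have "(\<Sum>x\<in>cube p (Suc e). h x) =
      (\<Sum>k<p. int (p choose Suc k) * (\<Sum>x\<in>cube p e. (pdiff e ^^ k) h (x(e := 0))))"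
    unfolding sum_cube_Suc sum_newton by (subst sum.swap) (simp add: sum_distrib_left)
  moreover have "int p ^ m dvd int (p choose Suc k) * (\<Sum>x\<in>cube p e. (pdiff e ^^ k) h (x(e := 0)))"
    if "k < p" for k
  \<comment> \<open>The term with k = p - 1 has coefficient 1 and pays with the degree
    instead.\<close>
  proof (cases "k = p - 1")
    case True
    have "deg_less (n - (p - 1)) ((pdiff e ^^ k) h)"
      by (rule deg_less_pdiff_funpow, rule deg_less_mono[OF Suc.prems(1)]) (use True in auto)
    note D = deg_less_fix_coord[OF this, of e 0]
    show ?thesis
    \<comment> \<open>For n < p - 1 the truncated difference is 0, and \<open>deg_less 0\<close>
      makes the term vanish.\<close>
    proof (cases "n \<ge> p - 1")
      case True
      have "int p ^ m dvd (\<Sum>x\<in>cube p e. (pdiff e ^^ k) h (x(e := 0)))"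
      proof (rule Suc.IH[OF D])
        define r c c' where "r = p - 1" and "c = Suc e * (p - 1)" and "c' = m * (p - 1)"
        have "n + c' \<le> r + c" using Suc.prems(2) by (simp add: r_def c_def c'_def)
        with True have "n - r + c' \<le> c" unfolding r_def [symmetric] by linarith
        then show "n - (p - 1) + m * (p - 1) \<le> Suc e * (p - 1)" by (simp only: r_def c_def c'_def)
      qed
      then show ?thesis by simp
    next
      case False
      then show ?thesis using D by simp
    qed
  next
    case False
    then have "p dvd (p choose Suc k)" using that p by (intro dvd_choose_prime) auto
    then have d1: "int p dvd int (p choose Suc k)" by simp
    show ?thesis
    proof (cases m)
      case (Suc m')
      have "deg_less n ((pdiff e ^^ k) h)"
        by (rule deg_less_pdiff_funpow, rule deg_less_mono[OF Suc.prems(1)]) auto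
      from deg_less_fix_coord[OF this, of e 0]
      have "int p ^ m' dvd (\<Sum>x\<in>cube p e. (pdiff e ^^ k) h (x(e := 0)))"
        by (rule Suc.IH) (use Suc.prems(2) Suc in simp)
      then show ?thesis using d1 by (simp add: Suc mult_dvd_mono)
    qed simp
  qed
  ultimately show ?case by (simp only:) (intro dvd_sum, simp)
qed

text \<open>The indicator of divisibility by p is expanded in the binomial coefficients of
  \<open>g x\<close>. Its j-th coefficient carries factors p by \<open>fleck\<close>, about j / (p -
  1) of them; the box sum of the j-th binomial coefficient, of degree at most w j, supplies those
  still missing. Small j leaves many factors to the box, large j needs none from it. The hypothesis
  on \<open>k\<close> reads k <= ceil(e / w).\<close>

lemma ax_divisibility:
  fixes g :: "(nat \<Rightarrow> nat) \<Rightarrow> nat"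
  assumes p: "Factorial_Ring.prime (p::nat)" and w: "w \<ge> 1"
    and deg: "deg_less (Suc w) (\<lambda>x. int (g x))" and k: "w * k < e + w"
  shows "p ^ k dvd p * card {x \<in> cube p e. p dvd g x}"
proof -
  have p1: "p > 1" using p prime_gt_1_nat by blast
  define F :: "int \<Rightarrow> int" where "F t = (if int p dvd t then 1 else 0)" for t
  have per: "F (t + int p) = F t" for t by (simp add: F_def)
  \<comment> \<open>A common cutoff for all points lets the two sums be exchanged; beyond
    \<open>g x\<close> the binomial coefficients are zero.\<close>
  define M where "M = Max (g ` cube p e)"
  have M: "g x \<le> M" if "x \<in> cube p e" for x
    using that by (simp add: M_def)
  have "int (p * card {x \<in> cube p e. p dvd g x}) = (\<Sum>x\<in>cube p e. int p * F (int (g x)))"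
    by (simp add: F_def sum_distrib_left [symmetric] sum.If_cases Int_def)
  also have "\<dots> = (\<Sum>x\<in>cube p e. \<Sum>j\<le>M. int p * (fdiff ^^ j) F 0 * int (g x choose j))"
  proof (rule sum.cong[OF refl])
    fix x assume "x \<in> cube p e"
    have "F (int (g x)) = (\<Sum>j\<le>g x. int (g x choose j) * (fdiff ^^ j) F 0)"
      using newton_forward[of F 0 "g x"] by simp
    also have "\<dots> = (\<Sum>j\<le>M. int (g x choose j) * (fdiff ^^ j) F 0)"
      by (rule sum.mono_neutral_left) (use M[OF \<open>x \<in> cube p e\<close>] in auto)
    finally show "int p * F (int (g x)) = (\<Sum>j\<le>M. int p * (fdiff ^^ j) F 0 * int (g x choose j))"
      by (simp add: sum_distrib_left mult_ac)
  qed
  also have "\<dots> = (\<Sum>j\<le>M. int p * (fdiff ^^ j) F 0 * (\<Sum>x\<in>cube p e. int (g x choose j)))"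
    by (subst sum.swap) (simp add: sum_distrib_left)
  finally have eq: "int (p * card {x \<in> cube p e. p dvd g x}) = \<dots>" .
  have "int p ^ k dvd int p * (fdiff ^^ j) F 0 * (\<Sum>x\<in>cube p e. int (g x choose j))" for j
  proof -
    \<comment> \<open>This is ceil(j / (p - 1)).\<close>
    define a where "a = (j + (p - 2)) div (p - 1)"
    have a1: "a * (p - 1) < j + (p - 1)"
    proof -
      have "a * (p - 1) \<le> j + (p - 2)" unfolding a_def by (rule div_times_less_eq_dividend)
      with p1 show ?thesis by linarith
    qed
    have a2: "j \<le> a * (p - 1)"
    proof -
      have "j + (p - 2) < Suc a * (p - 1)"
        unfolding a_def using p1 by (metis dividend_less_div_times mult_Suc zero_less_diff add.commute)
      with p1 show ?thesis by simp
    qed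
    show ?thesis
    proof (cases "a < k")
      case False
      have "int p ^ k dvd int p * (fdiff ^^ j) F 0"
        by (rule fleck[where F = F, OF p per]) (use a1 False in \<open>meson le_less_trans mult_le_mono1 not_less\<close>)
      then show ?thesis by simp
    next
      case True
      have A: "int p ^ a dvd int p * (fdiff ^^ j) F 0"
        by (rule fleck[where F = F, OF p per a1])
      define m where "m = k - a"
      have ka: "k = a + m" and m: "m \<ge> 1" using True by (auto simp: m_def)
      have "a * w + m \<le> e"
      proof -
        have "w * a + w * m < e + w" using k by (simp add: ka distrib_left)
        \<comment> \<open>This is (w - 1)(m - 1) >= 0.\<close>
        moreover have "m + w \<le> w * m + 1"
        proof -
          obtain w' m' where "w = Suc w'" "m = Suc m'" using w m by (metis Suc_le_D One_nat_def)
          then show ?thesis by simp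
        qed
        ultimately show ?thesis by (simp add: mult.commute)
      qed
      have "w * j \<le> a * w * (p - 1)" using mult_left_mono[OF a2, of w] by (simp add: mult_ac)
      then have "Suc (w * j) + m * (p - 1) \<le> Suc ((a * w + m) * (p - 1))"
        by (simp add: distrib_right)
      also have "\<dots> \<le> Suc (e * (p - 1))"
        using mult_right_mono[OF \<open>a * w + m \<le> e\<close>, of "p - 1"] by simp
      also have "\<dots> \<le> Suc e * (p - 1)" using p1 by simp
      finally have "int p ^ m dvd (\<Sum>x\<in>cube p e. int (g x choose j))"
        by (rule sum_cube_dvd[OF p deg_less_binomial[OF deg]])
      with A show ?thesis by (simp add: ka power_add mult_dvd_mono)
    qed
  qed
  then have "int p ^ k dvd int (p * card {x \<in> cube p e. p dvd g x})"
    unfolding eq by (intro dvd_sum) auto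
  then show ?thesis by (metis of_nat_dvd_iff of_nat_power)
qed

subsection \<open>Additive characters of finite fields\<close>

text \<open>For \<open>N\<close> a positive power of the characteristic of an algebraically closed
  field this is the subfield with \<open>N\<close> elements; the finite fields in question are thus
  sets in one type.\<close>

definition fixed_field :: "nat \<Rightarrow> 'b::field set" where
  "fixed_field N = {z. z ^ N = z}"

definition frob_trace :: "nat \<Rightarrow> nat \<Rightarrow> 'b::field \<Rightarrow> 'b" where
  "frob_trace p e z = (\<Sum>j<e. z ^ (p ^ j))"

text \<open>The character n -> exp(2 pi i n / p) of the prime field. There the choice of n is
  immaterial by periodicity; outside the prime field the value carries no meaning.\<close>

definition add_char :: "nat \<Rightarrow> 'b::field \<Rightarrow> complex" where
  "add_char p z = cis (2 * pi * real (SOME n. of_nat n = z) / real p)"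

lemma sum_character_eq_0:
  fixes ch :: "'b::ab_group_add \<Rightarrow> complex"
  assumes "finite E" and add: "\<And>x y. x \<in> E \<Longrightarrow> y \<in> E \<Longrightarrow> x + y \<in> E"
    and hom: "\<And>x y. x \<in> E \<Longrightarrow> y \<in> E \<Longrightarrow> ch (x + y) = ch x * ch y"
    and c: "c \<in> E" "ch c \<noteq> 1"
  shows "(\<Sum>x\<in>E. ch x) = 0"
proof -
  have "(\<lambda>x. x + c) ` E = E"
    by (rule endo_inj_surj) (use assms in \<open>auto simp: inj_on_def\<close>)
  then have "bij_betw (\<lambda>x. x + c) E E"
    by (simp add: bij_betw_def inj_on_def)
  then have "(\<Sum>x\<in>E. ch x) = (\<Sum>x\<in>E. ch (x + c))"
    by (rule sum.reindex_bij_betw [symmetric])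
  also have "\<dots> = (\<Sum>x\<in>E. ch x) * ch c"
    by (simp add: hom c sum_distrib_right)
  finally have "(\<Sum>x\<in>E. ch x) * (ch c - 1) = 0" by (simp add: algebra_simps)
  with c show ?thesis by simp
qed

lemma prod_linear_nonzero: "(\<Prod>x\<in>#A. [:-x, 1:]) \<noteq> (0 :: 'b::idom poly)"
  by (subst prod_mset_zero_iff) auto

lemma proots_prod_linear: "proots (\<Prod>x\<in>#A. [:-x, 1 :: 'b::idom:]) = A"
proof (induction A)
  case (add a A)
  have "proots ([:-a, 1:] * (\<Prod>x\<in>#A. [:-x, 1 :: 'b::idom:])) = {#a#} + A"
    by (subst proots_mult) (use prod_linear_nonzero[of A] add in auto)
  then show ?case by simp
qed simp

section \<open>Finite subfields, traces and characters in characteristic p\<close>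

locale char_field =
  fixes p :: nat and ty :: "'b::alg_closed_field itself"
  assumes prime_p: "Factorial_Ring.prime p" and CHAR_p: "CHAR('b) = p"
begin

lemma p_gt_1: "p > 1"
  using prime_p prime_gt_1_nat by blast

lemma frob_add: "(x + y :: 'b) ^ (p ^ n) = x ^ (p ^ n) + y ^ (p ^ n)"
  using freshmans_dream'[where 'a = 'b, of "p ^ n" n x y] prime_p CHAR_p by simp

lemma frob_sum: "(\<Sum>x\<in>A. f x :: 'b) ^ (p ^ n) = (\<Sum>x\<in>A. f x ^ (p ^ n))"
  using freshmans_dream_sum'[where 'a = 'b, of "p ^ n" n f A] prime_p CHAR_p by simp

lemma frob_minus: "(- x :: 'b) ^ (p ^ n) = - (x ^ (p ^ n))"
proof -
  have "(x + - x) ^ (p ^ n) = x ^ (p ^ n) + (- x) ^ (p ^ n)" by (rule frob_add)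
  moreover have "(x + - x) ^ (p ^ n) = 0" using p_gt_1 by simp
  ultimately show ?thesis by (simp add: eq_neg_iff_add_eq_0 add.commute)
qed

lemma frob_diff: "(x - y :: 'b) ^ (p ^ n) = x ^ (p ^ n) - y ^ (p ^ n)"
  using frob_add[of x "- y" n] frob_minus[of y n] by simp

lemma frob_inj: "(x :: 'b) ^ (p ^ n) = y ^ (p ^ n) \<longleftrightarrow> x = y"
proof
  assume "x ^ (p ^ n) = y ^ (p ^ n)"
  then have "(x - y) ^ (p ^ n) = 0" by (simp add: frob_diff)
  then show "x = y" by simp
qed simp

lemma of_nat_eq_iff_cong: "of_nat m = (of_nat n :: 'b) \<longleftrightarrow> m mod p = n mod p"
proof (induction m n rule: linorder_wlog)
  case (le m n)
  have "of_nat n = (of_nat m :: 'b) \<longleftrightarrow> of_nat (n - m) = (0::'b)"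
    using le by (simp add: of_nat_diff)
  also have "\<dots> \<longleftrightarrow> p dvd (n - m)" by (simp add: of_nat_eq_0_iff_char_dvd CHAR_p)
  also have "\<dots> \<longleftrightarrow> n mod p = m mod p" using le by (metis mod_eq_dvd_iff_nat)
  finally show ?case by metis
qed auto

lemma fixed_field_simps [simp]:
  "(0::'b) \<in> fixed_field (p ^ n)" "(1::'b) \<in> fixed_field (p ^ n)"
  using p_gt_1 by (auto simp: fixed_field_def)

lemma fixed_field_closed:
  fixes x y :: 'b
  assumes "x \<in> fixed_field (p ^ n)"
  shows "y \<in> fixed_field (p ^ n) \<Longrightarrow> x + y \<in> fixed_field (p ^ n)"
    and "y \<in> fixed_field (p ^ n) \<Longrightarrow> x - y \<in> fixed_field (p ^ n)"
    and "y \<in> fixed_field (p ^ n) \<Longrightarrow> x * y \<in> fixed_field (p ^ n)"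
    and "- x \<in> fixed_field (p ^ n)"
    and "inverse x \<in> fixed_field (p ^ n)"
    and "x ^ m \<in> fixed_field (p ^ n)"
proof -
  have "(x ^ m) ^ (p ^ n) = (x ^ (p ^ n)) ^ m" by (simp only: power_mult [symmetric] mult.commute)
  with assms show "x ^ m \<in> fixed_field (p ^ n)" by (simp add: fixed_field_def)
qed (use assms in \<open>auto simp: fixed_field_def frob_add frob_diff frob_minus power_mult_distrib
      power_inverse\<close>)

lemma fixed_field_sum:
  "(\<And>a. a \<in> A \<Longrightarrow> f a \<in> fixed_field (p ^ n)) \<Longrightarrow> (\<Sum>a\<in>A. f a :: 'b) \<in> fixed_field (p ^ n)"
  by (induction A rule: infinite_finite_induct) (auto intro: fixed_field_closed)

lemma fixed_field_of_nat: "(of_nat m :: 'b) \<in> fixed_field (p ^ n)"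
  by (induction m) (auto intro: fixed_field_closed)

lemma fixed_field_power: "(z::'b) \<in> fixed_field N \<Longrightarrow> z \<in> fixed_field (N ^ k)"
  by (induction k) (auto simp: fixed_field_def power_mult)

text \<open>The polynomial X^N - X has derivative -1, hence only simple roots, and it splits into
  linear factors over an algebraically closed field.\<close>

lemma card_fixed_field:
  assumes "n > 0"
  shows "finite (fixed_field (p ^ n) :: 'b set)" "card (fixed_field (p ^ n) :: 'b set) = p ^ n"
proof -
  define N where "N = p ^ n"
  have N: "N > 1" unfolding N_def by (rule one_less_power[OF p_gt_1 assms])
  have N0: "of_nat N = (0::'b)" using assms by (simp add: N_def of_nat_eq_0_iff_char_dvd CHAR_p)
  define P :: "'b poly" where "P = Polynomial.monom 1 N + [:0, -1:]"
  have "Polynomial.degree [:0, -1 :: 'b:] < N" using N by simp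
  then have deg: "Polynomial.degree P = N"
    unfolding P_def by (subst degree_add_eq_left) (simp_all add: Polynomial.degree_monom_eq)
  then have P0: "P \<noteq> 0" using N by auto
  have roots: "{x. poly P x = 0} = fixed_field N"
    by (auto simp: P_def poly_monom fixed_field_def)
  have "pderiv P = [:-1:]"
    by (simp add: P_def pderiv_add pderiv_monom N0 pderiv_pCons)
  have ord: "Polynomial.order a P \<le> 1" for a
  proof (rule ccontr)
    assume "\<not> Polynomial.order a P \<le> 1"
    then have "[:- a, 1:] ^ 2 dvd [:- a, 1:] ^ Polynomial.order a P" by (intro le_imp_power_dvd) simp
    then have "[:- a, 1:] ^ 2 dvd P" using order_1[of a P] by (rule dvd_trans)
    then obtain Q where "P = [:- a, 1:] ^ 2 * Q" by blast
    then have "P = [:- a, 1:] * ([:- a, 1:] * Q)" by (simp only: power2_eq_square mult.assoc)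
    then have "pderiv P = [:- a, 1:] * pderiv ([:- a, 1:] * Q) + [:- a, 1:] * Q * pderiv [:- a, 1:]"
      by (simp only: pderiv_mult)
    then have "poly (pderiv P) a = 0" by (simp only: poly_add poly_mult) simp
    with \<open>pderiv P = [:-1:]\<close> show False by simp
  qed
  obtain A where A: "size A = Polynomial.degree P" "P = Polynomial.smult (Polynomial.lead_coeff P) (\<Prod>x\<in>#A. [:-x, 1:])"
    using alg_closed_imp_factorization[OF P0] by blast
  have "proots P = A"
  proof -
    have "proots P = proots (\<Prod>x\<in>#A. [:-x, 1:])"
      by (subst A(2), subst proots_smult) (use P0 in auto)
    also have "\<dots> = A" by (rule proots_prod_linear)
    finally show ?thesis .
  qed
  have "size A = (\<Sum>x\<in>set_mset A. count A x)" by (simp add: size_multiset_overloaded_eq)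
  also have "\<dots> = (\<Sum>x\<in>set_mset A. 1)"
  proof (rule sum.cong[OF refl])
    fix x assume "x \<in> set_mset A"
    then have "count A x \<noteq> 0" by (simp only: count_eq_zero_iff not_not)
    moreover have "count A x \<le> 1" using ord[of x] \<open>proots P = A\<close> P0 by (metis count_proots)
    ultimately show "count A x = 1" by linarith
  qed
  finally have "size A = card (set_mset A)" by simp
  moreover have "set_mset A = fixed_field N" using \<open>proots P = A\<close> P0 roots by (metis set_count_proots)
  ultimately show "finite (fixed_field (p ^ n) :: 'b set)" "card (fixed_field (p ^ n) :: 'b set) = p ^ n"
    using A(1) deg by (metis N_def finite_set_mset)+
qed

lemma prime_field_eq: "(fixed_field p :: 'b set) = of_nat ` {..<p}"
proof (rule sym, rule card_subset_eq)
  show "finite (fixed_field p :: 'b set)" using card_fixed_field[of 1] by simp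
  show "of_nat ` {..<p} \<subseteq> (fixed_field p :: 'b set)" using fixed_field_of_nat[of _ 1] by auto
  have "inj_on (of_nat :: nat \<Rightarrow> 'b) {..<p}" by (auto simp: inj_on_def of_nat_eq_iff_cong)
  then show "card (of_nat ` {..<p} :: 'b set) = card (fixed_field p :: 'b set)"
    using card_fixed_field(2)[of 1] by (simp add: card_image)
qed

lemma add_char_of_nat: "add_char p (of_nat n :: 'b) = cis (2 * pi * real n / real p)"
proof -
  define m where "m = (SOME m. of_nat m = (of_nat n :: 'b))"
  have "of_nat m = (of_nat n :: 'b)" unfolding m_def by (rule someI) (rule refl)
  then have "m mod p = n mod p" by (simp add: of_nat_eq_iff_cong)
  have *: "cis (2 * pi * real k / real p) = cis (2 * pi * real (k mod p) / real p)" for k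
  proof -
    have "real k = real (k mod p) + real p * real (k div p)"
      by (metis mod_mult_div_eq of_nat_add of_nat_mult)
    then have "2 * pi * real k / real p = 2 * pi * real (k mod p) / real p + 2 * pi * real (k div p)"
      using p_gt_1 by (simp add: field_simps)
    moreover have "cis (2 * pi * real (k div p)) = 1"
      by (metis cis_multiple_2pi Ints_of_nat)
    ultimately show ?thesis by (simp flip: cis_mult)
  qed
  show ?thesis unfolding add_char_def m_def [symmetric]
    using *[of m] *[of n] \<open>m mod p = n mod p\<close> by simp
qed

lemma add_char_0 [simp]: "add_char p (0::'b) = 1"
  using add_char_of_nat[of 0] by simp

lemma add_char_add:
  "(x::'b) \<in> fixed_field p \<Longrightarrow> y \<in> fixed_field p \<Longrightarrow> add_char p (x + y) = add_char p x * add_char p y"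
  unfolding prime_field_eq
  by (auto simp: add_char_of_nat cis_mult add_divide_distrib distrib_left simp flip: of_nat_add)
    (simp add: add_divide_distrib distrib_left)

lemma add_char_eq_1:
  assumes "(x::'b) \<in> fixed_field p" "add_char p x = 1"
  shows "x = 0"
proof -
  obtain n where n: "n < p" "x = of_nat n" using assms(1) unfolding prime_field_eq by auto
  have "cos (2 * pi * real n / real p) = 1"
    using assms(2) n add_char_of_nat[of n] by (metis cis.simps(1) one_complex.simps(1))
  then obtain k :: int where k: "2 * pi * real n / real p = real_of_int k * 2 * pi"
    by (auto simp: cos_one_2pi_int)
  then have "real n = real_of_int k * real p" using p_gt_1 by (simp add: field_simps)
  then have "int n = k * int p" by (metis of_int_mult of_int_of_nat_eq of_int_eq_iff)
  then have "p dvd n" by (metis dvd_triv_right int_dvd_int_iff)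
  with n have "n = 0" by auto
  with n show ?thesis by simp
qed

lemma sum_add_char_scale:
  assumes "(z::'b) \<in> fixed_field p"
  shows "(\<Sum>t\<in>fixed_field p. add_char p (t * z)) = (if z = 0 then of_nat p else 0)"
proof (cases "z = 0")
  case True
  then show ?thesis using card_fixed_field(2)[of 1] by simp
next
  case False
  have "(\<Sum>t\<in>fixed_field p. add_char p (t * z)) = 0"
  proof (rule sum_character_eq_0[where c = 1])
    show "finite (fixed_field p :: 'b set)" using card_fixed_field[of 1] by simp
    show "x + y \<in> fixed_field p" if "x \<in> fixed_field p" "y \<in> fixed_field p" for x y :: 'b
      using fixed_field_closed(1)[of x 1 y] that by simp
    show "add_char p ((x + y) * z) = add_char p (x * z) * add_char p (y * z)"
      if "x \<in> fixed_field p" "y \<in> fixed_field p" for x y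
      unfolding distrib_right
      by (rule add_char_add) (use fixed_field_closed(3)[of _ 1] that assms in auto)
    show "1 \<in> (fixed_field p :: 'b set)" using fixed_field_simps(2)[of 1] by simp
    show "add_char p (1 * z) \<noteq> 1" using add_char_eq_1[OF assms] False by auto
  qed
  with False show ?thesis by simp
qed

lemma frob_trace_add: "frob_trace p e (x + y :: 'b) = frob_trace p e x + frob_trace p e y"
  by (simp add: frob_trace_def frob_add sum.distrib)

lemma frob_trace_0 [simp]: "frob_trace p e (0 :: 'b) = 0"
  using prime_p by (simp add: frob_trace_def power_0_left)

lemma frob_trace_minus: "frob_trace p e (- x :: 'b) = - frob_trace p e x"
  using frob_trace_add[of e x "- x"] by (simp add: eq_neg_iff_add_eq_0 add.commute)

lemma frob_trace_scale:
  assumes "(t::'b) \<in> fixed_field p"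
  shows "frob_trace p e (t * z) = t * frob_trace p e z"
proof -
  have "t ^ (p ^ j) = t" for j
    using fixed_field_power[OF assms, of j] by (simp add: fixed_field_def)
  then show ?thesis by (simp add: frob_trace_def power_mult_distrib sum_distrib_left)
qed

lemma frob_trace_frob:
  assumes "(z::'b) \<in> fixed_field (p ^ e)"
  shows "frob_trace p e (z ^ p) = frob_trace p e z"
proof -
  have "frob_trace p e (z ^ p) + z = (\<Sum>j<Suc e. z ^ (p ^ j))"
    by (subst sum.lessThan_Suc_shift) (simp add: frob_trace_def flip: power_mult)
  also have "\<dots> = frob_trace p e z + z"
    using assms by (simp add: frob_trace_def fixed_field_def)
  finally show ?thesis by simp
qed

lemma frob_trace_frob_power:
  assumes "(z::'b) \<in> fixed_field (p ^ e)"
  shows "frob_trace p e (z ^ (p ^ k)) = frob_trace p e z"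
proof (induction k)
  case (Suc k)
  have "frob_trace p e (z ^ (p ^ Suc k)) = frob_trace p e ((z ^ (p ^ k)) ^ p)"
    by (simp add: mult.commute flip: power_mult)
  also have "\<dots> = frob_trace p e (z ^ (p ^ k))"
    by (rule frob_trace_frob) (rule fixed_field_closed(6)[OF assms])
  finally show ?case using Suc by simp
qed simp

lemma frob_trace_in:
  assumes "(z::'b) \<in> fixed_field (p ^ e)"
  shows "frob_trace p e z \<in> fixed_field p"
proof -
  have "frob_trace p e z ^ p = frob_trace p e (z ^ p)"
    using frob_sum[of "\<lambda>j. z ^ (p ^ j)" "{..<e}" 1]
    by (simp add: frob_trace_def mult.commute flip: power_mult)
  then show ?thesis using frob_trace_frob[OF assms] by (simp add: fixed_field_def)
qed

text \<open>The trace is a polynomial of degree p^(e-1), too small to vanish on all p^e elements;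
  dividing by \<open>a\<close> turns this into nondegeneracy of the trace form.\<close>

lemma frob_trace_nonzero:
  assumes "(a::'b) \<in> fixed_field (p ^ e)" "a \<noteq> 0" "e > 0"
  obtains z where "z \<in> fixed_field (p ^ e)" "frob_trace p e (a * z) \<noteq> 0"
proof -
  define P :: "'b poly" where "P = (\<Sum>j<e. Polynomial.monom 1 (p ^ j))"
  obtain e' where e': "e = Suc e'" using assms(3) by (cases e) auto
  have "Polynomial.coeff P (p ^ e') = (\<Sum>j<e. if j = e' then 1 else 0)"
    unfolding P_def Polynomial.coeff_sum by (rule sum.cong) (use p_gt_1 in auto)
  then have "Polynomial.coeff P (p ^ e') = 1" by (simp add: e')
  then have P0: "P \<noteq> 0" by auto
  have "Polynomial.degree P \<le> p ^ e'"
    unfolding P_def by (rule degree_sum_le) (use p_gt_1 in \<open>auto simp: e' Polynomial.degree_monom_eq intro!: power_increasing\<close>)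
  moreover have "card {x. poly P x = 0} \<le> Polynomial.degree P" by (rule card_poly_roots_bound[OF P0])
  moreover have "p ^ e' < p ^ e" using p_gt_1 by (simp add: e')
  ultimately have "card {x. poly P x = 0} < card (fixed_field (p ^ e) :: 'b set)"
    using card_fixed_field(2)[OF assms(3)] by simp
  then have "\<not> (fixed_field (p ^ e) :: 'b set) \<subseteq> {x. poly P x = 0}"
    using card_mono[OF poly_roots_finite[OF P0]] by (metis not_less)
  then obtain y where y: "y \<in> fixed_field (p ^ e)" "poly P y \<noteq> 0" by auto
  have "poly P y = frob_trace p e y" by (simp add: P_def frob_trace_def poly_sum poly_monom)
  moreover have "a * (inverse a * y) = y" using assms by simp
  moreover have "inverse a * y \<in> fixed_field (p ^ e)"
    using assms y by (intro fixed_field_closed) auto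
  ultimately show thesis using y that by metis
qed

text \<open>The kernel of the Artin--Schreier map is, under the trace form, the annihilator of its image.\<close>

lemma card_artin_schreier:
  assumes e: "e > 0" and u: "u > 0" and c: "(c::'b) \<in> fixed_field (p ^ e)"
  defines "K \<equiv> fixed_field (p ^ e) :: 'b set"
  defines "E \<equiv> fixed_field (p ^ e) \<inter> fixed_field (p ^ u) :: 'b set"
  shows "of_nat (card {y \<in> K. y ^ (p ^ u) - y = c}) = (\<Sum>b\<in>E. add_char p (frob_trace p e (b * c)))"
proof -
  define ch where "ch b c = add_char p (frob_trace p e (b * c))" for b c :: 'b
  have fin: "finite K" "finite E" using card_fixed_field(1)[OF e] by (auto simp: K_def E_def)
  have EK: "E \<subseteq> K" by (auto simp: E_def K_def)
  have Eadd: "x + y \<in> E" "x - y \<in> E" if "x \<in> E" "y \<in> E" for x y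
    using that by (auto simp: E_def intro: fixed_field_closed)
  have Kcl: "x + y \<in> K" "x * y \<in> K" "x - y \<in> K" "x ^ n \<in> K" if "x \<in> K" "y \<in> K" for x y n
    using that by (auto simp: K_def intro: fixed_field_closed)
  have tr: "frob_trace p e x \<in> fixed_field p" if "x \<in> K" for x
    using that unfolding K_def by (rule frob_trace_in)
  have hom1: "ch (x + y) c = ch x c * ch y c" if "x \<in> K" "y \<in> K" "c \<in> K" for x y c
    using that by (simp add: ch_def distrib_right frob_trace_add add_char_add tr Kcl)
  have hom2: "ch c (x + y) = ch c x * ch c y" if "x \<in> K" "y \<in> K" "c \<in> K" for x y c
    using that by (simp add: ch_def distrib_left frob_trace_add add_char_add tr Kcl)
  define AS where "AS y = y ^ (p ^ u) - y" for y :: 'b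
  have AS_K: "AS y \<in> K" if "y \<in> K" for y using that by (simp add: AS_def Kcl)
  have AS_diff: "AS (x - y) = AS x - AS y" for x y by (simp add: AS_def frob_diff)
  have fib: "card {y \<in> K. AS y = AS y0} = card E" if "y0 \<in> K" for y0
  proof -
    have "{y \<in> K. AS y = AS y0} = (\<lambda>b. b + y0) ` E"
    proof (intro equalityI subsetI)
      fix y assume "y \<in> {y \<in> K. AS y = AS y0}"
      then have "y - y0 \<in> K" "AS (y - y0) = 0" using that by (auto simp: Kcl AS_diff)
      then have "y - y0 \<in> E" by (simp add: E_def K_def AS_def fixed_field_def)
      then show "y \<in> (\<lambda>b. b + y0) ` E" by (intro image_eqI[of _ _ "y - y0"]) auto
    next
      fix y assume "y \<in> (\<lambda>b. b + y0) ` E"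
      then obtain b where "b \<in> E" "y = b + y0" by auto
      then show "y \<in> {y \<in> K. AS y = AS y0}"
        using that EK by (auto simp: Kcl AS_def frob_add E_def fixed_field_def K_def)
    qed
    then show ?thesis by (simp add: card_image inj_on_def)
  qed
  have E0: "0 \<in> E" by (simp add: E_def)
  define perp where "perp = {c \<in> K. \<forall>b\<in>E. frob_trace p e (b * c) = 0}"
  have chi0: "ch b c = 1 \<longleftrightarrow> frob_trace p e (b * c) = 0" if "b \<in> K" "c \<in> K" for b c
    using add_char_eq_1[OF tr[OF Kcl(2)[OF that]]] by (auto simp: ch_def)
  have sumE: "(\<Sum>b\<in>E. ch b c) = (if c \<in> perp then of_nat (card E) else 0)" if cK: "c \<in> K" for c
  proof (cases "c \<in> perp")
    case True
    then show ?thesis by (simp add: ch_def perp_def)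
  next
    case False
    then obtain b where b: "b \<in> E" "frob_trace p e (b * c) \<noteq> 0" using cK by (auto simp: perp_def)
    have "(\<Sum>b\<in>E. ch b c) = 0"
      by (rule sum_character_eq_0[where c = b])
         (use fin Eadd hom1 EK cK b chi0 in \<open>auto simp: subset_iff\<close>)
    with False show ?thesis by simp
  qed
  have sumK: "(\<Sum>c\<in>K. ch b c) = (if b = 0 then of_nat (card K) else 0)" if "b \<in> E" for b
  proof (cases "b = 0")
    case True
    then show ?thesis by (simp add: ch_def)
  next
    case False
    have "b \<in> K" using that EK by auto
    then obtain z where z: "z \<in> K" "frob_trace p e (b * z) \<noteq> 0"
      using frob_trace_nonzero[of b e] False e unfolding K_def by auto
    have "(\<Sum>c\<in>K. ch b c) = 0"
      by (rule sum_character_eq_0[where c = z])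
         (use fin Kcl hom2 \<open>b \<in> K\<close> z chi0 in auto)
    with False show ?thesis by simp
  qed
  \<comment> \<open>The double character sum is counted in both orders: summing over b detects
    \<open>perp\<close>, summing over c detects b = 0.\<close>
  have "of_nat (card E * card perp) = (\<Sum>c\<in>K. \<Sum>b\<in>E. ch b c)"
  proof -
    have "(\<Sum>c\<in>K. \<Sum>b\<in>E. ch b c) = (\<Sum>c\<in>K. if c \<in> perp then of_nat (card E) else 0)"
      by (intro sum.cong refl sumE)
    also have "\<dots> = (\<Sum>c\<in>perp. of_nat (card E))"
      using fin by (simp add: sum.If_cases Int_def perp_def)
    finally show ?thesis by (simp add: mult.commute)
  qed
  also have "\<dots> = (\<Sum>b\<in>E. \<Sum>c\<in>K. ch b c)" by (rule sum.swap)
  also have "\<dots> = of_nat (card K)"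
    using fin E0 by (simp add: sumK)
  finally have card1: "card E * card perp = card K" using of_nat_eq_iff by blast
  have card2: "card E * card (AS ` K) = card K"
  proof -
    have "card K = (\<Sum>c\<in>AS ` K. card {y \<in> K. AS y = c})"
      using sum.image_gen[OF fin(1), of "\<lambda>_. 1::nat" AS] by simp
    also have "\<dots> = (\<Sum>c\<in>AS ` K. card E)" by (intro sum.cong refl) (auto simp: fib)
    finally show ?thesis by simp
  qed
  have "card E > 0" using E0 fin by (auto simp: card_gt_0_iff)
  then have "card (AS ` K) = card perp" using card1 card2 by (metis mult_cancel1 less_numeral_extra(3))
  \<comment> \<open>Equal cardinalities reduce the claim to one inclusion. It holds because b is
    fixed by the p^u-th power map and the trace does not distinguish (b y)^(p^u) from b y.\<close>
  moreover have "AS ` K \<subseteq> perp"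
  proof
    fix c assume "c \<in> AS ` K"
    then obtain y where y: "y \<in> K" "c = AS y" by auto
    have "frob_trace p e (b * c) = 0" if "b \<in> E" for b
    proof -
      have b: "b \<in> K" "b ^ (p ^ u) = b" using that by (auto simp: E_def K_def fixed_field_def)
      have "b * c = (b * y) ^ (p ^ u) + - (b * y)"
        by (simp add: y AS_def power_mult_distrib b algebra_simps)
      moreover have "frob_trace p e ((b * y) ^ (p ^ u)) = frob_trace p e (b * y)"
        by (rule frob_trace_frob_power) (use Kcl b y in \<open>auto simp: K_def\<close>)
      ultimately show ?thesis by (simp add: frob_trace_add frob_trace_minus del: add_uminus_conv_diff)
    qed
    then show "c \<in> perp" using y AS_K by (auto simp: perp_def)
  qed
  moreover have "finite perp" using fin by (simp add: perp_def)
  ultimately have img: "AS ` K = perp" by (simp add: card_subset_eq)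
  have cK: "c \<in> K" using c by (simp add: K_def)
  show ?thesis
  proof (cases "c \<in> perp")
    case True
    then obtain y0 where "y0 \<in> K" "c = AS y0" using img by auto
    then show ?thesis using sumE[OF cK] True fib[of y0] by (simp add: ch_def AS_def)
  next
    case False
    then have none: "{y \<in> K. y ^ (p ^ u) - y = c} = {}" using img by (auto simp: AS_def)
    show ?thesis unfolding none using sumE[OF cK] False by (simp add: ch_def)
  qed
qed

end

subsection \<open>Divisibility of the number of affine points\<close>

text \<open>Field-valued functions of the digits with a degree bound. The values of \<open>h\<close>
  are natural numbers, so they can be read both in the field and as an integer-valued polynomial;
  this takes the place of a lift to characteristic zero.\<close>

inductive polymap :: "'b::field set \<Rightarrow> nat \<Rightarrow> ((nat \<Rightarrow> nat) \<Rightarrow> 'b) \<Rightarrow> bool" for K where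
  polymap_zero: "polymap K n (\<lambda>x. 0)"
| polymap_step: "polymap K n \<phi> \<Longrightarrow> c \<in> K \<Longrightarrow> deg_less (Suc n) (\<lambda>x. int (h x)) \<Longrightarrow>
    polymap K n (\<lambda>x. \<phi> x + c * of_nat (h x))"

lemma polymap_monom: "c \<in> K \<Longrightarrow> deg_less (Suc n) (\<lambda>x. int (h x)) \<Longrightarrow> polymap K n (\<lambda>x. c * of_nat (h x))"
  using polymap_step[OF polymap_zero, of c K n h] by simp

lemma polymap_add: "polymap K n \<psi> \<Longrightarrow> polymap K n \<phi> \<Longrightarrow> polymap K n (\<lambda>x. \<phi> x + \<psi> x)"
  by (induction rule: polymap.induct) (auto simp flip: add.assoc intro: polymap.intros)

lemma polymap_sum: "(\<And>a. a \<in> A \<Longrightarrow> polymap K n (f a)) \<Longrightarrow> polymap K n (\<lambda>x. \<Sum>a\<in>A. f a x)"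
  by (induction A rule: infinite_finite_induct) (auto intro: polymap_add polymap_zero)

lemma polymap_mono: "polymap K n \<phi> \<Longrightarrow> n \<le> m \<Longrightarrow> polymap K m \<phi>"
proof (induction rule: polymap.induct)
  case (polymap_step n \<phi> c h)
  then show ?case by (intro polymap.intros) (auto intro: deg_less_mono[of "Suc n"] simp del: deg_less.simps)
qed (rule polymap_zero)

section \<open>Degree of the trace of a polynomial in the digits of its argument\<close>

context char_field
begin

lemma polymap_mult:
  assumes "polymap (fixed_field (p ^ e)) m (\<phi> :: _ \<Rightarrow> 'b)" "polymap (fixed_field (p ^ e)) n \<psi>"
  shows "polymap (fixed_field (p ^ e)) (m + n) (\<lambda>x. \<phi> x * \<psi> x)"
  using assms
proof (induction rule: polymap.induct)
  case (polymap_step m \<phi> c h)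
  from \<open>polymap _ n \<psi>\<close> have "polymap (fixed_field (p ^ e)) (m + n) (\<lambda>x. c * of_nat (h x) * \<psi> x)"
  proof (induction rule: polymap.induct)
    case (polymap_step n \<psi> c' h')
    have "deg_less (Suc (m + n)) (\<lambda>x. int (h x * h' x))"
      using deg_less_mult[of m "\<lambda>x. int (h x)" n "\<lambda>x. int (h' x)"] polymap_step \<open>deg_less (Suc m) _\<close>
      by (simp del: deg_less.simps)
    then have "polymap (fixed_field (p ^ e)) (m + n) (\<lambda>x. (c * c') * of_nat (h x * h' x))"
      by (rule polymap_monom[rotated]) (intro fixed_field_closed polymap_step \<open>c \<in> _\<close>)
    from polymap_add[OF this polymap_step.IH] show ?case by (simp add: algebra_simps)
  qed (simp add: polymap_zero)
  from polymap_add[OF this polymap_step.IH] show ?case by (simp add: polymap_step algebra_simps)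
qed (simp add: polymap_zero)

lemma polymap_power:
  "polymap (fixed_field (p ^ e)) m (\<phi> :: _ \<Rightarrow> 'b) \<Longrightarrow> polymap (fixed_field (p ^ e)) (n * m) (\<lambda>x. \<phi> x ^ n)"
proof (induction n)
  case 0
  have "polymap (fixed_field (p ^ e)) 0 (\<lambda>x. (1::'b) * of_nat 1)"
    by (rule polymap_monom) (use deg_less_const[of 0 1] in \<open>auto\<close>)
  then show ?case by simp
next
  case (Suc n)
  then show ?case using polymap_mult[of e m \<phi> "n * m"] by simp
qed

text \<open>The coordinates \<open>x i\<close> become elements of the prime field, so the p-th power
  of the linear form merely replaces \<open>om i\<close> by its p-th power. Writing n in base p,
  each of its at most L digits therefore contributes degree at most p - 1, however large n itself
  is.\<close>

lemma polymap_linear_power: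
  assumes "\<And>i. om i \<in> (fixed_field (p ^ e) :: 'b set)" "n < p ^ L"
  shows "polymap (fixed_field (p ^ e)) ((p - 1) * L) (\<lambda>x. (\<Sum>i<r. of_nat (x i) * om i) ^ n)"
  using assms
proof (induction L arbitrary: om n)
  case 0
  then show ?case using polymap_power[OF polymap_zero, of e 0 0] by simp
next
  case (Suc L)
  define K where "K = (fixed_field (p ^ e) :: 'b set)"
  have lin: "polymap K 1 (\<lambda>x. \<Sum>i<r. of_nat (x i) * om i)"
  proof (rule polymap_sum)
    fix i
    have "pdiff j (\<lambda>x. int (x i)) = (\<lambda>x. if j = i then 1 else 0)" for j
      by (auto simp: pdiff_def)
    then have "deg_less (Suc (Suc 0)) (\<lambda>x. int (x i))" by (simp add: pdiff_def)
    then show "polymap K 1 (\<lambda>x. of_nat (x i) * om i)"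
      using polymap_monom[of "om i" K 1 "\<lambda>x. x i"] Suc.prems by (simp add: mult.commute K_def del: deg_less.simps)
  qed
  have "polymap K ((n mod p) * 1) (\<lambda>x. (\<Sum>i<r. of_nat (x i) * om i) ^ (n mod p))"
    unfolding K_def by (rule polymap_power) (use lin in \<open>simp add: K_def\<close>)
  then have 1: "polymap K (p - 1) (\<lambda>x. (\<Sum>i<r. of_nat (x i) * om i) ^ (n mod p))"
  proof (rule polymap_mono)
    have "n mod p < p" using p_gt_1 by simp
    then show "n mod p * 1 \<le> p - 1" by linarith
  qed
  have "n div p < p ^ L" using Suc.prems p_gt_1 by (simp add: less_mult_imp_div_less mult.commute)
  then have 2: "polymap K ((p - 1) * L) (\<lambda>x. (\<Sum>i<r. of_nat (x i) * om i ^ p) ^ (n div p))"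
    unfolding K_def using Suc.prems by (intro Suc.IH) (auto intro: fixed_field_closed)
  have 3: "(\<Sum>i<r. of_nat (x i) * om i) ^ n
      = (\<Sum>i<r. of_nat (x i) * om i) ^ (n mod p) * (\<Sum>i<r. of_nat (x i) * om i ^ p) ^ (n div p)" for x
  proof -
    have "(of_nat m :: 'b) ^ p = of_nat m" for m
      using fixed_field_of_nat[of m 1] by (simp add: fixed_field_def)
    then have "(\<Sum>i<r. of_nat (x i) * om i) ^ p = (\<Sum>i<r. of_nat (x i) * om i ^ p)"
      using frob_sum[of "\<lambda>i. of_nat (x i) * om i" "{..<r}" 1] by (simp add: power_mult_distrib)
    moreover have "(\<Sum>i<r. of_nat (x i) * om i) ^ n = (\<Sum>i<r. of_nat (x i) * om i) ^ (n mod p + p * (n div p))"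
      by simp
    ultimately show ?thesis by (simp only: power_add power_mult)
  qed
  show ?case
    using polymap_mult[OF 1[unfolded K_def] 2[unfolded K_def]] by (simp only: 3 mult_Suc_right)
qed

text \<open>Integer values pass through the trace by linearity over the prime field. Only the
  coefficients are traced, each trace is replaced by a natural representative, and the degree does
  not grow.\<close>

lemma frob_trace_polymap:
  assumes "polymap (fixed_field (p ^ e)) n (\<phi> :: _ \<Rightarrow> 'b)"
  shows "\<exists>g. deg_less (Suc n) (\<lambda>x. int (g x)) \<and> (\<forall>x. frob_trace p e (\<phi> x) = of_nat (g x))"
  using assms
proof (induction rule: polymap.induct)
  case (polymap_zero n)
  show ?case by (intro exI[of _ "\<lambda>_. 0"]) (use deg_less_const[of n 0] in simp)
next
  case (polymap_step n \<phi> c h)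
  then obtain g where g: "deg_less (Suc n) (\<lambda>x. int (g x))" "\<And>x. frob_trace p e (\<phi> x) = of_nat (g x)"
    by auto
  have "frob_trace p e c \<in> fixed_field p" by (rule frob_trace_in) (rule polymap_step)
  then obtain t where t: "frob_trace p e c = of_nat t" unfolding prime_field_eq by auto
  have "of_nat (h x) \<in> (fixed_field p :: 'b set)" for x using fixed_field_of_nat[of _ 1] by simp
  then have "frob_trace p e (of_nat (h x) * c) = of_nat (h x) * of_nat t" for x
    by (simp add: frob_trace_scale t)
  moreover have "deg_less (Suc n) (\<lambda>x. int (g x) + int t * int (h x))"
    by (intro deg_less_add deg_less_cmult g polymap_step)
  ultimately show ?case
    by (intro exI[of _ "\<lambda>x. g x + t * h x"]) (simp add: frob_trace_add g mult.commute del: deg_less.simps)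
qed

text \<open>A basis over the prime field is chosen greedily: k vectors span at most p^k elements, so
  a further independent one exists while k < e. Independence makes the digit map injective on the
  box, and counting p^e elements on both sides makes it bijective.\<close>

lemma fixed_field_basis:
  assumes e: "e > 0"
  shows "\<exists>om. (\<forall>i. om i \<in> (fixed_field (p ^ e) :: 'b set)) \<and>
    bij_betw (\<lambda>x. \<Sum>i<e. of_nat (x i) * om i) (cube p e) (fixed_field (p ^ e))"
proof -
  define K where "K = (fixed_field (p ^ e) :: 'b set)"
  have finK: "finite K" "card K = p ^ e" using card_fixed_field[OF e] by (auto simp: K_def)
  define F where "F = (fixed_field p :: 'b set)"
  have FK: "F \<subseteq> K"
    using fixed_field_of_nat by (auto simp: F_def K_def prime_field_eq)
  have Fcl: "x - y \<in> F" "- x \<in> F" "x * y \<in> F" "inverse x \<in> F" if "x \<in> F" "y \<in> F" for x y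
  proof -
    have xy: "x \<in> fixed_field (p ^ 1)" "y \<in> fixed_field (p ^ 1)" using that by (simp_all add: F_def)
    show "x - y \<in> F" "- x \<in> F" "x * y \<in> F" "inverse x \<in> F"
      using fixed_field_closed(2,3)[OF xy] fixed_field_closed(4,5)[OF xy(1)] by (simp_all add: F_def)
  qed
  have "\<exists>om. (\<forall>i. om i \<in> K) \<and> (\<forall>t. (\<forall>i. t i \<in> F) \<longrightarrow> (\<Sum>i<k. t i * om i) = 0 \<longrightarrow> (\<forall>i<k. t i = 0))"
    if "k \<le> e" for k
    using that
  proof (induction k)
    case 0
    show ?case by (intro exI[of _ "\<lambda>_. 0"]) (auto simp: K_def)
  next
    case (Suc k)
    then obtain om where om: "\<And>i. om i \<in> K"
      "\<And>t. \<forall>i. t i \<in> F \<Longrightarrow> (\<Sum>i<k. t i * om i) = 0 \<Longrightarrow> \<forall>i<k. t i = 0"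
      by auto
    define H where "H = (\<lambda>x. \<Sum>i<k. of_nat (x i) * om i) ` cube p k"
    have "card H \<le> p ^ k" using card_image_le[OF finite_cube] unfolding H_def card_cube [symmetric] .
    also have "\<dots> < card K" using Suc.prems p_gt_1 finK by simp
    finally have "\<not> K \<subseteq> H" using card_mono[of H K] by (auto simp: H_def)
    then obtain w where w: "w \<in> K" "w \<notin> H" by auto
    have H: "(\<Sum>i<k. t i * om i) \<in> H" if "\<And>i. t i \<in> F" for t
    proof -
      have "\<forall>i. \<exists>n. n < p \<and> t i = of_nat n" using that by (auto simp: F_def prime_field_eq)
      then obtain n where n: "\<And>i. n i < p" "\<And>i. t i = of_nat (n i)" by metis
      show ?thesis unfolding H_def
        by (rule image_eqI[of _ _ "\<lambda>i. if i < k then n i else 0"]) (auto simp: n cube_def)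
    qed
    show ?case
    proof (intro exI[of _ "om(k := w)"] conjI allI impI)
      fix t i assume t: "\<forall>i. t i \<in> F" and 0: "(\<Sum>i<Suc k. t i * (om(k := w)) i) = 0" and i: "i < Suc k"
      have "(\<Sum>i<Suc k. t i * (om(k := w)) i) = (\<Sum>i<k. t i * om i) + t k * w"
        unfolding sum.lessThan_Suc by (intro arg_cong2[where f = "(+)"] sum.cong) auto
      with 0 have 0: "(\<Sum>i<k. t i * om i) + t k * w = 0" by (simp only:)
      have tk: "t k = 0"
      proof (rule ccontr)
        assume "t k \<noteq> 0"
        from 0 have "t k * w = - (\<Sum>i<k. t i * om i)" by (simp only: eq_neg_iff_add_eq_0 add.commute)
        then have "inverse (t k) * (t k * w) = inverse (t k) * - (\<Sum>i<k. t i * om i)" by (simp only:)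
        then have "w = - inverse (t k) * (\<Sum>i<k. t i * om i)"
          using \<open>t k \<noteq> 0\<close> by (simp flip: mult.assoc)
        also have "\<dots> = (\<Sum>i<k. (- inverse (t k) * t i) * om i)"
          by (simp add: sum_distrib_left mult.assoc)
        also have "\<dots> \<in> H" by (rule H) (use t in \<open>auto intro!: Fcl\<close>)
        finally show False using w by simp
      qed
      with 0 have "(\<Sum>i<k. t i * om i) = 0" by simp
      with om(2)[of t] t tk i show "t i = 0" by (cases "i = k") auto
    qed (use om w in auto)
  qed
  from this[OF order_refl] obtain om where om: "\<And>i. om i \<in> K"
    "\<And>t. \<forall>i. t i \<in> F \<Longrightarrow> (\<Sum>i<e. t i * om i) = 0 \<Longrightarrow> \<forall>i<e. t i = 0"
    by auto
  define \<beta> where "\<beta> x = (\<Sum>i<e. of_nat (x i) * om i)" for x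
  have natF: "of_nat n \<in> F" for n using fixed_field_of_nat[of n 1] by (simp add: F_def)
  have inj: "inj_on \<beta> (cube p e)"
  proof (rule inj_onI)
    fix x y assume xy: "x \<in> cube p e" "y \<in> cube p e" "\<beta> x = \<beta> y"
    define t where "t i = (of_nat (x i) - of_nat (y i) :: 'b)" for i
    have "(\<Sum>i<e. t i * om i) = 0"
      using xy(3) by (simp add: \<beta>_def t_def left_diff_distrib sum_subtractf)
    moreover have "\<forall>i. t i \<in> F" unfolding t_def by (intro allI Fcl(1) natF)
    ultimately have "\<forall>i<e. t i = 0" by (intro om(2))
    then have "x i = y i" if "i < e" for i
      using that xy by (auto simp: of_nat_eq_iff_cong cube_def t_def)
    then show "x = y" using xy by (auto simp: cube_def fun_eq_iff) (metis not_le)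
  qed
  have "\<beta> ` cube p e \<subseteq> K"
    unfolding \<beta>_def K_def using om(1) natF FK
    by (auto intro!: fixed_field_sum fixed_field_closed simp: K_def)
  moreover have "card (\<beta> ` cube p e) = card K" using inj by (simp add: card_image card_cube finK)
  ultimately have "\<beta> ` cube p e = K" using finK by (simp add: card_subset_eq)
  with inj have "bij_betw \<beta> (cube p e) K" by (simp add: bij_betw_def)
  with om(1) show ?thesis unfolding \<beta>_def K_def by blast
qed

text \<open>The degree w of \<open>ax_divisibility\<close> becomes (p - 1) L: exponents of f have at
  most L digits in base p, and the constants \<open>b\<close> and the coefficients of f cost no
  degree.\<close>

lemma trace_zeros_divisibility:
  assumes e: "e > 0" and L: "L \<ge> 1" and coeffs: "\<And>n. Polynomial.coeff f n \<in> (fixed_field (p ^ e) :: 'b set)"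
    and deg: "Polynomial.degree f < p ^ L" and b: "b \<in> fixed_field (p ^ e)"
    and k: "(p - 1) * L * k < e + (p - 1) * L"
  shows "p ^ k dvd p * card {x \<in> fixed_field (p ^ e). frob_trace p e (b * poly f x) = 0}"
proof -
  obtain om where om: "\<And>i. om i \<in> (fixed_field (p ^ e) :: 'b set)"
    "bij_betw (\<lambda>x. \<Sum>i<e. of_nat (x i) * om i) (cube p e) (fixed_field (p ^ e))"
    using fixed_field_basis[OF e] by blast
  define \<beta> where "\<beta> x = (\<Sum>i<e. of_nat (x i) * om i)" for x
  note bij = om(2)[folded \<beta>_def]
  have "polymap (fixed_field (p ^ e)) (0 + (p - 1) * L) (\<lambda>x. (b * Polynomial.coeff f n) * \<beta> x ^ n)"
    if "n \<le> Polynomial.degree f" for n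
  proof (rule polymap_mult)
    have "polymap (fixed_field (p ^ e)) 0 (\<lambda>x. (b * Polynomial.coeff f n) * of_nat 1)"
      by (rule polymap_monom) (use deg_less_const[of 0 1] b coeffs fixed_field_closed in auto)
    then show "polymap (fixed_field (p ^ e)) 0 (\<lambda>x. b * Polynomial.coeff f n)" by simp
    show "polymap (fixed_field (p ^ e)) ((p - 1) * L) (\<lambda>x. \<beta> x ^ n)"
      unfolding \<beta>_def using that deg by (intro polymap_linear_power om) auto
  qed
  then have "polymap (fixed_field (p ^ e)) ((p - 1) * L)
      (\<lambda>x. \<Sum>n\<le>Polynomial.degree f. (b * Polynomial.coeff f n) * \<beta> x ^ n)"
    by (intro polymap_sum) auto
  also have "(\<lambda>x. \<Sum>n\<le>Polynomial.degree f. (b * Polynomial.coeff f n) * \<beta> x ^ n) = (\<lambda>x. b * poly f (\<beta> x))"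
    by (simp add: poly_altdef sum_distrib_left mult.assoc)
  finally obtain g where g: "deg_less (Suc ((p - 1) * L)) (\<lambda>x. int (g x))"
    "\<And>x. frob_trace p e (b * poly f (\<beta> x)) = of_nat (g x)"
    using frob_trace_polymap by blast
  have "bij_betw \<beta> {x \<in> cube p e. p dvd g x} {x \<in> fixed_field (p ^ e). frob_trace p e (b * poly f x) = 0}"
  proof -
    have "fixed_field (p ^ e) = \<beta> ` cube p e" using bij by (simp add: bij_betw_def)
    then have "{x \<in> fixed_field (p ^ e). frob_trace p e (b * poly f x) = 0} = \<beta> ` {x \<in> cube p e. p dvd g x}"
      using g(2) by (auto simp: of_nat_eq_0_iff_char_dvd CHAR_p)
    then show ?thesis using bij by (auto simp: bij_betw_def inj_on_def)
  qed
  then have "card {x \<in> cube p e. p dvd g x} = card {x \<in> fixed_field (p ^ e). frob_trace p e (b * poly f x) = 0}"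
    by (rule bij_betw_same_card)
  moreover have "(p - 1) * L \<ge> 1" using p_gt_1 L by simp
  ultimately show ?thesis
    using ax_divisibility[OF prime_p _ g(1) k] by simp
qed

definition affine_points :: "nat \<Rightarrow> nat \<Rightarrow> 'b poly \<Rightarrow> ('b \<times> 'b) set" where
  "affine_points e u f =
    {(x, y). x \<in> fixed_field (p ^ e) \<and> y \<in> fixed_field (p ^ e) \<and> y ^ (p ^ u) - y = poly f x}"

definition exp_sum :: "nat \<Rightarrow> 'b poly \<Rightarrow> 'b \<Rightarrow> complex" where
  "exp_sum e f b = (\<Sum>x\<in>fixed_field (p ^ e). add_char p (frob_trace p e (b * poly f x)))"

lemma poly_in_fixed_field:
  assumes "\<And>n. Polynomial.coeff f n \<in> (fixed_field (p ^ e) :: 'b set)" "x \<in> fixed_field (p ^ e)"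
  shows "poly f x \<in> fixed_field (p ^ e)"
  unfolding poly_altdef by (intro fixed_field_sum fixed_field_closed assms)

text \<open>\<open>E\<close> indexes the characters that detect the image of y -> y^(p^u) - y; the
  trivial one, b = 0, contributes the main term p^e.\<close>

lemma card_affine_points:
  assumes e: "e > 0" and u: "u > 0" and coeffs: "\<And>n. Polynomial.coeff f n \<in> (fixed_field (p ^ e) :: 'b set)"
  defines "E \<equiv> fixed_field (p ^ e) \<inter> fixed_field (p ^ u) :: 'b set"
  shows "of_nat (card (affine_points e u f)) - of_nat (p ^ e) = (\<Sum>b\<in>E - {0}. exp_sum e f b)"
proof -
  define K where "K = (fixed_field (p ^ e) :: 'b set)"
  have fin: "finite K" "finite E" "card K = p ^ e" using card_fixed_field[OF e] by (auto simp: K_def E_def)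
  have "affine_points e u f = (SIGMA x:K. {y\<in>K. y ^ (p ^ u) - y = poly f x})"
    by (auto simp: affine_points_def K_def)
  then have "card (affine_points e u f) = (\<Sum>x\<in>K. card {y\<in>K. y ^ (p ^ u) - y = poly f x})"
    using fin by (simp add: card_SigmaI)
  then have "of_nat (card (affine_points e u f)) =
      (\<Sum>x\<in>K. \<Sum>b\<in>E. add_char p (frob_trace p e (b * poly f x)))"
    unfolding of_nat_sum K_def E_def
    by (simp add: card_artin_schreier[OF e u] poly_in_fixed_field coeffs)
  also have "\<dots> = (\<Sum>b\<in>E. exp_sum e f b)" unfolding exp_sum_def K_def by (rule sum.swap)
  also have "\<dots> = exp_sum e f 0 + (\<Sum>b\<in>E - {0}. exp_sum e f b)"
    by (rule sum.remove) (use fin in \<open>auto simp: E_def\<close>)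
  also have "exp_sum e f 0 = of_nat (p ^ e)" using fin by (simp add: exp_sum_def K_def)
  finally show ?thesis by simp
qed

text \<open>A single \<open>exp_sum\<close> need not be an integer. Summed over the multiples t b
  with t nonzero in the prime field it becomes p Z(b) - p^e, where Z(b) counts zeros of a trace.
  Multiplication by t permutes the nonzero elements of \<open>E\<close>, so the double sum is (p -
  1) N, and p - 1 can be cancelled modulo powers of p.\<close>

lemma affine_points_divisibility:
  assumes e: "e > 0" and u: "u > 0" and L: "L \<ge> 1"
    and coeffs: "\<And>n. Polynomial.coeff f n \<in> (fixed_field (p ^ e) :: 'b set)"
    and deg: "Polynomial.degree f < p ^ L"
    and k: "(p - 1) * L * k < e + (p - 1) * L"
  shows "int p ^ k dvd int (card (affine_points e u f)) - int (p ^ e)"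
proof -
  define K where "K = (fixed_field (p ^ e) :: 'b set)"
  define E where "E = (fixed_field (p ^ e) \<inter> fixed_field (p ^ u) :: 'b set)"
  define F where "F = (fixed_field p :: 'b set)"
  have fin: "finite K" "finite E" "card K = p ^ e" using card_fixed_field[OF e] by (auto simp: K_def E_def)
  have finF: "finite F" "card F = p" using card_fixed_field[of 1] by (auto simp: F_def)
  have F0: "0 \<in> F" using fixed_field_simps(1)[of 1] by (simp add: F_def)
  have FE: "F \<subseteq> E" unfolding F_def prime_field_eq E_def by (auto simp: fixed_field_of_nat)
  have Ecl: "x * y \<in> E" "inverse x \<in> E" if "x \<in> E" "y \<in> E" for x y
    using that by (auto simp: E_def intro: fixed_field_closed)
  define Z where "Z b = card {x \<in> K. frob_trace p e (b * poly f x) = 0}" for b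
  define N where "N = int (card (affine_points e u f)) - int (p ^ e)"
  have 1: "(\<Sum>t\<in>F - {0}. exp_sum e f (t * b)) = of_int (int (p * Z b) - int (p ^ e))" if "b \<in> E" for b
  proof -
    have "(\<Sum>t\<in>F. exp_sum e f (t * b)) =
        (\<Sum>x\<in>K. \<Sum>t\<in>F. add_char p (frob_trace p e (t * b * poly f x)))"
      unfolding exp_sum_def K_def by (rule sum.swap)
    also have "\<dots> = (\<Sum>x\<in>K. if frob_trace p e (b * poly f x) = 0 then of_nat p else 0)"
    proof (rule sum.cong[OF refl])
      fix x assume x: "x \<in> K"
      have "frob_trace p e (b * poly f x) \<in> fixed_field p"
        using x that by (intro frob_trace_in fixed_field_closed poly_in_fixed_field coeffs) (auto simp: K_def E_def)
      from sum_add_char_scale[OF this]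
      show "(\<Sum>t\<in>F. add_char p (frob_trace p e (t * b * poly f x))) =
          (if frob_trace p e (b * poly f x) = 0 then of_nat p else 0)"
        by (simp add: frob_trace_scale F_def mult.assoc)
    qed
    also have "\<dots> = of_nat (p * Z b)"
      using fin by (simp add: sum.If_cases Z_def Int_def mult.commute)
    finally have "of_nat (p * Z b) = exp_sum e f (0 * b) + (\<Sum>t\<in>F - {0}. exp_sum e f (t * b))"
      using sum.remove[OF finF(1) F0, of "\<lambda>t. exp_sum e f (t * b)"] by simp
    moreover have "exp_sum e f (0 * b) = of_nat (p ^ e)" using fin by (simp add: exp_sum_def K_def)
    ultimately show ?thesis by (simp add: algebra_simps)
  qed
  have 2: "(\<Sum>b\<in>E - {0}. exp_sum e f (t * b)) = of_int N" if "t \<in> F - {0}" for t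
  proof -
    have "bij_betw (\<lambda>b. t * b) (E - {0}) (E - {0})"
      by (rule bij_betw_byWitness[where f' = "\<lambda>b. inverse t * b"])
         (use that FE in \<open>auto intro!: Ecl simp flip: mult.assoc\<close>)
    then have "(\<Sum>b\<in>E - {0}. exp_sum e f (t * b)) = (\<Sum>b\<in>E - {0}. exp_sum e f b)"
      by (rule sum.reindex_bij_betw)
    also have "\<dots> = of_int N"
      using card_affine_points[OF e u coeffs] by (simp add: N_def E_def)
    finally show ?thesis .
  qed
  have "of_int (\<Sum>b\<in>E - {0}. int (p * Z b) - int (p ^ e)) = (\<Sum>b\<in>E - {0}. \<Sum>t\<in>F - {0}. exp_sum e f (t * b))"
    unfolding of_int_sum by (rule sum.cong) (use 1 in auto)
  also have "\<dots> = (\<Sum>t\<in>F - {0}. \<Sum>b\<in>E - {0}. exp_sum e f (t * b))" by (rule sum.swap)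
  also have "\<dots> = (\<Sum>t\<in>F - {0}. of_int N)" by (rule sum.cong) (use 2 in auto)
  also have "\<dots> = of_int (int (p - 1) * N)" using finF F0 by simp
  finally have eq: "(\<Sum>b\<in>E - {0}. int (p * Z b) - int (p ^ e)) = int (p - 1) * N"
    by (simp only: of_int_eq_iff)
  define \<tau> where "\<tau> = (p - 1) * L"
  have \<tau>: "\<tau> \<ge> 1" using p_gt_1 L by (simp add: \<tau>_def)
  \<comment> \<open>The terms p^e have to be divisible by p^k as well.\<close>
  have "k \<le> e"
  proof (rule ccontr)
    assume "\<not> k \<le> e"
    then have "\<tau> * Suc e \<le> \<tau> * k" by (intro mult_left_mono) auto
    moreover have "\<tau> * k < e + \<tau>" using k by (simp only: \<tau>_def)
    ultimately have "\<tau> * e < e" unfolding mult_Suc_right by linarith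
    with mult_right_mono[OF \<tau>, of e] show False by simp
  qed
  have "int p ^ k dvd (\<Sum>b\<in>E - {0}. int (p * Z b) - int (p ^ e))"
  proof (rule dvd_sum)
    fix b assume "b \<in> E - {0}"
    then have "p ^ k dvd p * Z b"
      unfolding Z_def K_def
      by (intro trace_zeros_divisibility[where L = L] e L coeffs deg k) (auto simp: E_def)
    then have "int p ^ k dvd int (p * Z b)" by (metis of_nat_dvd_iff of_nat_power)
    moreover have "int p ^ k dvd int (p ^ e)" using \<open>k \<le> e\<close> by (simp add: le_imp_power_dvd)
    ultimately show "int p ^ k dvd int (p * Z b) - int (p ^ e)" by (rule dvd_diff)
  qed
  then have "int p ^ k dvd int (p - 1) * N" unfolding eq .
  moreover have "coprime (int p ^ k) (int (p - 1))"
  proof -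
    have "coprime p (p - 1)" using p_gt_1 coprime_diff_one_right_nat[of p] by simp
    then have "coprime (int p) (int (p - 1))" by (simp only: coprime_int_iff)
    then show ?thesis by simp
  qed
  ultimately have "int p ^ k dvd N" by (simp add: coprime_dvd_mult_right_iff)
  then show ?thesis by (simp add: N_def)
qed

end

subsection \<open>Multiplicative weights on effective cycles\<close>

lemma sum_Sigma_fst:
  fixes h :: "'a \<Rightarrow> complex"
  assumes "finite A" "\<And>x. x \<in> A \<Longrightarrow> finite (B x)"
  shows "(\<Sum>z\<in>Sigma A B. h (fst z)) = (\<Sum>x\<in>A. of_nat (card (B x)) * h x)"
  using assms sum.Sigma[of A B "\<lambda>x y. h x"] by (simp add: case_prod_unfold)

locale finite_cycles =
  fixes \<phi> :: "'c \<Rightarrow> 'c" and A :: "'c set"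
  assumes inj_\<phi>: "inj \<phi>" and A_closed: "\<And>a. a \<in> A \<Longrightarrow> \<phi> a \<in> A"
    and finite_fix: "\<And>i. i > 0 \<Longrightarrow> finite {a \<in> A. (\<phi> ^^ i) a = a}"
begin

definition fix_points :: "nat \<Rightarrow> 'c set" where
  "fix_points i = {a \<in> A. (\<phi> ^^ i) a = a}"

text \<open>For \<open>\<phi>\<close> a Frobenius map these are the effective zero-cycles of degree
  n over the base field; invariance of the multiset replaces a decomposition into closed
  points.\<close>

definition cycles :: "nat \<Rightarrow> 'c multiset set" where
  "cycles n = {D. set_mset D \<subseteq> A \<and> image_mset \<phi> D = D \<and> size D = n}"

text \<open>A walk of i steps along the orbit of \<open>a\<close>; if i is a multiple of the period,
  it covers the orbit with constant multiplicity i / \<open>period a\<close>.\<close>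

definition cyc :: "nat \<Rightarrow> 'c \<Rightarrow> 'c multiset" where
  "cyc i a = (\<Sum>j<i. {#(\<phi> ^^ j) a#})"

definition period :: "'c \<Rightarrow> nat" where
  "period a = (LEAST r. r > 0 \<and> (\<phi> ^^ r) a = a)"

lemma funpow_closed: "a \<in> A \<Longrightarrow> (\<phi> ^^ n) a \<in> A"
  by (induction n) (auto intro: A_closed)

lemma funpow_inj: "(\<phi> ^^ n) a = (\<phi> ^^ n) b \<Longrightarrow> a = b"
  using inj_fn[OF inj_\<phi>, of n] by (simp add: inj_eq)

lemma size_cyc: "size (cyc i a) = i"
  by (simp add: cyc_def)

lemma set_cyc: "set_mset (cyc i a) = (\<lambda>j. (\<phi> ^^ j) a) ` {..<i}"
  by (auto simp: cyc_def set_mset_sum)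

lemma image_cyc:
  assumes "(\<phi> ^^ i) a = a"
  shows "image_mset \<phi> (cyc i a) = cyc i a"
proof (cases i)
  case (Suc k)
  have "image_mset \<phi> (cyc i a) = (\<Sum>j<i. {#(\<phi> ^^ Suc j) a#})"
    unfolding cyc_def by (induction i) auto
  also have "\<dots> = (\<Sum>j<k. {#(\<phi> ^^ Suc j) a#}) + {#(\<phi> ^^ 0) a#}"
    using assms by (simp add: Suc)
  also have "\<dots> = cyc i a"
    unfolding cyc_def Suc by (subst sum.lessThan_Suc_shift) simp
  finally show ?thesis .
qed (simp add: cyc_def)

lemma cyc_in_cycles: "a \<in> fix_points i \<Longrightarrow> cyc i a \<in> cycles i"
  by (auto simp: cycles_def fix_points_def size_cyc set_cyc image_cyc funpow_closed)

lemma cyc_add: "(\<phi> ^^ k) a = a \<Longrightarrow> cyc (k + l) a = cyc k a + cyc l a"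
proof (induction l)
  case (Suc l)
  have "(\<phi> ^^ (k + l)) a = (\<phi> ^^ l) a"
    using Suc.prems by (subst add.commute) (simp add: funpow_add)
  then show ?case using Suc by (simp add: cyc_def add.assoc)
qed (simp add: cyc_def)

lemma funpow_mult_period: "(\<phi> ^^ r) a = a \<Longrightarrow> (\<phi> ^^ (j * r)) a = a"
  by (induction j) (auto simp: funpow_add)

lemma cyc_mult: "(\<phi> ^^ r) a = a \<Longrightarrow> cyc (j * r) a = repeat_mset j (cyc r a)"
proof (induction j)
  case (Suc j)
  then show ?case using cyc_add[of r a "j * r"] by simp
qed (simp add: cyc_def)

lemma period_props:
  assumes "(\<phi> ^^ i) a = a" "i > 0"
  shows "period a > 0" "(\<phi> ^^ period a) a = a" "period a dvd i"
proof -
  have ex: "period a > 0 \<and> (\<phi> ^^ period a) a = a"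
    unfolding period_def by (rule LeastI[of _ i]) (use assms in simp)
  then show "period a > 0" and p: "(\<phi> ^^ period a) a = a" by auto
  have "i = i mod period a + (i div period a) * period a"
    by (rule mod_div_mult_eq [symmetric])
  then have "(\<phi> ^^ (i mod period a)) ((\<phi> ^^ (i div period a * period a)) a) = a"
    using assms(1) by (metis comp_apply funpow_add)
  then have *: "(\<phi> ^^ (i mod period a)) a = a" using funpow_mult_period[OF p] by simp
  have "i mod period a < period a" using ex by simp
  with * have "i mod period a = 0"
    using not_less_Least[of "i mod period a" "\<lambda>r. r > 0 \<and> (\<phi> ^^ r) a = a"] unfolding period_def by auto
  then show "period a dvd i" by auto
qed

lemma count_cyc_period:
  assumes "(\<phi> ^^ i) a = a" "i > 0"
  shows "count (cyc (period a) a) b = (if b \<in> (\<lambda>j. (\<phi> ^^ j) a) ` {..<period a} then 1 else 0)"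
proof -
  have inj: "inj_on (\<lambda>j. (\<phi> ^^ j) a) {..<period a}"
  proof (rule linorder_inj_onI)
    fix k l assume "k < l" "k \<in> {..<period a}" "l \<in> {..<period a}"
    show "(\<phi> ^^ k) a \<noteq> (\<phi> ^^ l) a"
    proof
      assume "(\<phi> ^^ k) a = (\<phi> ^^ l) a"
      also have "(\<phi> ^^ l) a = (\<phi> ^^ k) ((\<phi> ^^ (l - k)) a)"
        using \<open>k < l\<close> by (metis comp_apply funpow_add le_add_diff_inverse less_imp_le)
      finally have "(\<phi> ^^ (l - k)) a = a" using funpow_inj by metis
      then have "period a \<le> l - k" unfolding period_def using \<open>k < l\<close> by (intro Least_le) simp
      then show False using \<open>l \<in> {..<period a}\<close> \<open>k < l\<close> by auto
    qed
  qed (simp add: nat_le_linear)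
  have "cyc (period a) a = mset_set ((\<lambda>j. (\<phi> ^^ j) a) ` {..<period a})"
  proof -
    have "cyc (period a) a = image_mset (\<lambda>j. (\<phi> ^^ j) a) (mset_set {..<period a})"
      unfolding cyc_def by (subst sum_unfold_sum_mset) (simp add: image_mset.compositionality)
    then show ?thesis using image_mset_mset_set[OF inj] by simp
  qed
  then show ?thesis by simp
qed

lemma image_mset_inj_count: "count (image_mset \<phi> D) (\<phi> b) = count D b"
  using inj_\<phi> by (induction D) (auto simp: inj_eq)

lemma count_invariant:
  assumes "image_mset \<phi> D = D"
  shows "count D ((\<phi> ^^ j) a) = count D a"
proof (induction j)
  case (Suc j)
  have "count D (\<phi> b) = count D b" for b
    using image_mset_inj_count[of D b] assms by simp
  then show ?case using Suc by simp
qed simp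

lemma periodic_in_cycle:
  assumes "image_mset \<phi> D = D" "a \<in># D"
  shows "\<exists>i>0. (\<phi> ^^ i) a = a"
proof -
  have "range (\<lambda>j. (\<phi> ^^ j) a) \<subseteq> set_mset D"
    using count_invariant[OF assms(1)] assms(2) by (auto simp flip: count_greater_zero_iff)
  then have "finite (range (\<lambda>j. (\<phi> ^^ j) a))" using finite_subset by blast
  then have "\<not> inj (\<lambda>j. (\<phi> ^^ j) a)" using finite_imageD infinite_UNIV_nat by blast
  then obtain k l where "k \<noteq> l" "(\<phi> ^^ k) a = (\<phi> ^^ l) a" by (auto simp: inj_def)
  then obtain k l where kl: "k < l" "(\<phi> ^^ k) a = (\<phi> ^^ l) a" by (metis linorder_neqE_nat)
  then have "(\<phi> ^^ k) a = (\<phi> ^^ k) ((\<phi> ^^ (l - k)) a)"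
    by (metis comp_apply funpow_add le_add_diff_inverse less_imp_le)
  then have "(\<phi> ^^ (l - k)) a = a" using funpow_inj by metis
  with kl show ?thesis by (intro exI[of _ "l - k"]) auto
qed

text \<open>Multiplicities in an invariant multiset are constant along orbits, so j copies of the
  whole orbit fit in as soon as j copies of one point do.\<close>

lemma cyc_subset:
  assumes D: "image_mset \<phi> D = D" and a: "a \<in># D" and j: "j \<le> count D a"
  shows "cyc (j * period a) a \<subseteq># D"
proof -
  obtain i where i: "i > 0" "(\<phi> ^^ i) a = a" using periodic_in_cycle[OF D a] by blast
  note per = period_props[OF i(2,1)]
  have "count (cyc (j * period a) a) b \<le> count D b" for b
    unfolding cyc_mult[OF per(2)] using j count_invariant[OF D, of _ a]
    by (auto simp: count_cyc_period[OF i(2,1)])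
  then show ?thesis by (simp add: subseteq_mset_def)
qed

text \<open>An invariant multiset contains the full orbit of each of its points, so these points
  have period at most n, and there are finitely many such points.\<close>

lemma finite_cycles: "finite (cycles n)"
proof -
  define T where "T = (\<Union>i\<in>{1..n}. fix_points i)"
  have "finite T" unfolding T_def fix_points_def by (intro finite_UN_I finite_fix) auto
  have "cycles n \<subseteq> mset ` {xs. set xs \<subseteq> T \<and> length xs = n}"
  proof
    fix D assume D: "D \<in> cycles n"
    have "a \<in> T" if a: "a \<in># D" for a
    proof -
      have inv: "image_mset \<phi> D = D" using D by (simp add: cycles_def)
      obtain i where i: "i > 0" "(\<phi> ^^ i) a = a" using periodic_in_cycle[OF inv a] by blast
      note per = period_props[OF i(2,1)]
      have "cyc (1 * period a) a \<subseteq># D" by (rule cyc_subset[OF inv a]) (use a in \<open>simp add: Suc_le_eq\<close>)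
      from size_mset_mono[OF this] have "period a \<le> n" using D by (simp add: size_cyc cycles_def)
      then show ?thesis using per D a by (auto simp: T_def fix_points_def cycles_def intro!: bexI[of _ "period a"])
    qed
    moreover obtain xs where "D = mset xs" by (metis ex_mset)
    ultimately show "D \<in> mset ` {xs. set xs \<subseteq> T \<and> length xs = n}"
      using D by (auto simp: cycles_def)
  qed
  then show ?thesis
    by (rule finite_subset) (intro finite_imageI finite_lists_length_eq \<open>finite T\<close>)
qed

text \<open>Newton's identity for a multiplicative weight: a pair of a cycle \<open>D\<close> and one of its points \<open>a\<close>,
  counted with multiplicity, is obtained from a smaller cycle by adding a multiple of the orbit of \<open>a\<close>.\<close>

theorem cycles_newton:
  fixes w :: "'c multiset \<Rightarrow> complex"
  assumes mult: "\<And>n m D E. D \<in> cycles n \<Longrightarrow> E \<in> cycles m \<Longrightarrow> w (D + E) = w D * w E"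
  shows "of_nat n * (\<Sum>D\<in>cycles n. w D) =
    (\<Sum>i\<in>{1..n}. (\<Sum>a\<in>fix_points i. w (cyc i a)) * (\<Sum>D\<in>cycles (n - i). w D))"
proof -
  \<comment> \<open>A point counted with multiplicity is a triple (D, a, j) with j up to the
    multiplicity of a; each D of size n has n of them.\<close>
  define S1 where "S1 = Sigma (cycles n) (\<lambda>D. Sigma (set_mset D) (\<lambda>a. {1..count D a}))"
  define S2 where "S2 = Sigma {1..n} (\<lambda>i. fix_points i \<times> cycles (n - i))"
  have fin: "finite (fix_points i)" if "i \<in> {1..n}" for i
    using that finite_fix[of i] by (simp add: fix_points_def)
  have "(\<Sum>z\<in>S1. w (fst z)) =
      (\<Sum>D\<in>cycles n. of_nat (card (SIGMA a:set_mset D. {1..count D a})) * w D)"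
    unfolding S1_def by (rule sum_Sigma_fst) (simp_all add: finite_cycles)
  also have "\<dots> = (\<Sum>D\<in>cycles n. of_nat n * w D)"
  proof (rule sum.cong[OF refl])
    fix D assume "D \<in> cycles n"
    then have "card (SIGMA a:set_mset D. {1..count D a}) = n"
      by (simp add: card_SigmaI cycles_def size_multiset_overloaded_eq)
    then show "of_nat (card (SIGMA a:set_mset D. {1..count D a})) * w D = of_nat n * w D" by simp
  qed
  also have "\<dots> = of_nat n * (\<Sum>D\<in>cycles n. w D)" by (rule sum_distrib_left [symmetric])
  finally have "of_nat n * (\<Sum>D\<in>cycles n. w D) = (\<Sum>z\<in>S1. w (fst z))" by (rule sym)
  also have "\<dots> = (\<Sum>(i, a, D)\<in>S2. w (cyc i a) * w D)"
  \<comment> \<open>Here j is the number of copies of the orbit of a that are removed, so i = j *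
    \<open>period a\<close>, and j is recovered by division.\<close>
  proof (rule sum.reindex_bij_witness[where
        i = "\<lambda>(i, a, D). (D + cyc i a, a, i div period a)" and
        j = "\<lambda>(D, a, j). (j * period a, a, D - cyc (j * period a) a)"])
    fix z assume "z \<in> S1"
    then obtain D a j where z: "z = (D, a, j)" "D \<in> cycles n" "a \<in># D" "1 \<le> j" "j \<le> count D a"
      by (auto simp: S1_def)
    have D: "image_mset \<phi> D = D" "set_mset D \<subseteq> A" "size D = n" using z by (auto simp: cycles_def)
    obtain i where i: "i > 0" "(\<phi> ^^ i) a = a" using periodic_in_cycle[OF D(1) z(3)] by blast
    note per = period_props[OF i(2,1)]
    note sub = cyc_subset[OF D(1) z(3,5)]
    have fixj: "(\<phi> ^^ (j * period a)) a = a" by (rule funpow_mult_period[OF per(2)])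
    have D': "D - cyc (j * period a) a \<in> cycles (n - j * period a)"
      using D sub by (auto simp: cycles_def image_mset_Diff image_cyc[OF fixj] size_Diff_submset size_cyc
          dest: in_diffD)
    have "j * period a \<le> n" using size_mset_mono[OF sub] D by (simp add: size_cyc)
    then have inS2: "(j * period a, a, D - cyc (j * period a) a) \<in> S2"
      using D' per z D fixj by (auto simp: S2_def fix_points_def)
    show "(\<lambda>(D, a, j). (j * period a, a, D - cyc (j * period a) a)) z \<in> S2" using inS2 by (simp add: z)
    show "(\<lambda>(i, a, D). (D + cyc i a, a, i div period a))
        ((\<lambda>(D, a, j). (j * period a, a, D - cyc (j * period a) a)) z) = z"
      using sub per by (simp add: z)
    have "cyc (j * period a) a \<in> cycles (j * period a)"
      using z D fixj by (intro cyc_in_cycles) (auto simp: fix_points_def)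
    from mult[OF this D'] sub
    show "(case (case z of (D, a, j) \<Rightarrow> (j * period a, a, D - cyc (j * period a) a)) of
        (i, a, D) \<Rightarrow> w (cyc i a) * w D) = w (fst z)"
      by (simp add: z)
  next
    fix z assume "z \<in> S2"
    then obtain i a D where z: "z = (i, a, D)" "1 \<le> i" "i \<le> n" "a \<in> fix_points i" "D \<in> cycles (n - i)"
      by (auto simp: S2_def)
    have fx: "(\<phi> ^^ i) a = a" "a \<in> A" using z by (auto simp: fix_points_def)
    have i0: "i > 0" using z by simp
    note per = period_props[OF fx(1) i0]
    define j where "j = i div period a"
    have ij: "i = j * period a" using per(3) by (simp add: j_def)
    have "cyc i a = repeat_mset j (cyc (period a) a)" using cyc_mult[OF per(2)] ij by simp
    moreover have "count (cyc (period a) a) a = 1"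
      using per(1) by (auto simp: count_cyc_period[OF fx(1) i0] intro!: image_eqI[of _ _ 0])
    ultimately have cnt: "count (cyc i a) a = j" by simp
    have j1: "1 \<le> j" using i0 ij by (cases j) auto
    then have "a \<in># cyc i a" using cnt by (metis count_eq_zero_iff not_one_le_zero)
    then show "(\<lambda>(i, a, D). (D + cyc i a, a, i div period a)) z \<in> S1"
      using z fx cnt j1 by (auto simp: S1_def cycles_def j_def [symmetric] image_cyc size_cyc set_cyc funpow_closed)
    show "(\<lambda>(D, a, j). (j * period a, a, D - cyc (j * period a) a))
        ((\<lambda>(i, a, D). (D + cyc i a, a, i div period a)) z) = z"
      using ij by (simp add: z j_def [symmetric])
  qed
  also have "\<dots> = (\<Sum>i\<in>{1..n}. \<Sum>(a, D)\<in>fix_points i \<times> cycles (n - i). w (cyc i a) * w D)"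
    unfolding S2_def by (subst sum.Sigma) (auto simp: fin finite_cycles case_prod_unfold)
  also have "\<dots> = (\<Sum>i\<in>{1..n}. (\<Sum>a\<in>fix_points i. w (cyc i a)) * (\<Sum>D\<in>cycles (n - i). w D))"
    by (intro sum.cong refl) (simp add: sum_product sum.cartesian_product)
  finally show ?thesis .
qed

end

subsection \<open>Multisets as monic polynomials\<close>

definition prodlin :: "'b::field multiset \<Rightarrow> 'b poly" where
  "prodlin M = (\<Prod>x\<in>#M. [:-x, 1:])"

lemma prodlin_simps [simp]: "prodlin {#} = 1" "prodlin (add_mset x M) = [:-x, 1:] * prodlin M"
  by (simp_all add: prodlin_def)

lemma prodlin_monic: "Polynomial.degree (prodlin M) = size M" "Polynomial.coeff (prodlin M) (size M) = 1"
proof -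
  have "Polynomial.degree (prodlin M) = size M \<and> Polynomial.coeff (prodlin M) (size M) = 1"
  proof (induction M)
    case (add x M)
    have "prodlin M \<noteq> 0" unfolding prodlin_def by (rule prod_linear_nonzero)
    then have "Polynomial.degree (prodlin (add_mset x M)) = Suc (size M)"
      using add by (simp only: prodlin_simps, subst degree_mult_eq) auto
    moreover have "Polynomial.coeff (prodlin (add_mset x M)) (Suc (size M)) = 1"
      using add by (simp add: Polynomial.coeff_eq_0)
    ultimately show ?case by simp
  qed simp
  then show "Polynomial.degree (prodlin M) = size M" "Polynomial.coeff (prodlin M) (size M) = 1" by auto
qed

lemma proots_prodlin: "proots (prodlin M) = M"
  unfolding prodlin_def by (rule proots_prod_linear)

lemma prodlin_proots:
  assumes "Polynomial.lead_coeff (P :: 'b::alg_closed_field poly) = 1"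
  shows "prodlin (proots P) = P"
proof -
  have "P \<noteq> 0" using assms by auto
  then obtain A where "P = Polynomial.smult (Polynomial.lead_coeff P) (\<Prod>x\<in>#A. [:-x, 1:])"
    using alg_closed_imp_factorization by blast
  then have "P = prodlin A" using assms by (simp add: prodlin_def)
  then show ?thesis using proots_prodlin by metis
qed

definition psum :: "nat \<Rightarrow> 'b::field multiset \<Rightarrow> 'b" where
  "psum j M = (\<Sum>x\<in>#M. x ^ j)"

text \<open>Newton's identities as the logarithmic derivative of the reflected polynomial.\<close>

lemma newton_log_deriv:
  "- fps_deriv (fps_of_poly (reflect_poly (prodlin M))) =
    fps_of_poly (reflect_poly (prodlin M)) * Abs_fps (\<lambda>j. psum (Suc j) (M :: 'b::field multiset))"
proof (induction M)
  case (add x M)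
  define R where "R = fps_of_poly (reflect_poly (prodlin M))"
  define S where "S = Abs_fps (\<lambda>j. psum (Suc j) M)"
  define E where "E = Abs_fps (\<lambda>j. x ^ j)"
  define L where "L = 1 - fps_const x * fps_X"
  have refl: "reflect_poly [:-x, 1:] = [:1, -x:]" by (simp add: reflect_poly_def)
  have L: "fps_of_poly [:1, -x:] = L"
    by (rule fps_ext) (simp add: L_def coeff_pCons split: nat.splits)
  have R': "fps_of_poly (reflect_poly (prodlin (add_mset x M))) = L * R"
    by (simp only: prodlin_simps reflect_poly_mult refl fps_of_poly_mult L R_def)
  have S': "Abs_fps (\<lambda>j. psum (Suc j) (add_mset x M)) = S + fps_const x * E"
    by (rule fps_ext) (simp add: S_def E_def psum_def)
  have LE: "L * E = 1"
  proof (rule fps_ext)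
    fix n show "fps_nth (L * E) n = fps_nth 1 n"
      by (cases n) (simp_all add: L_def E_def left_diff_distrib mult.assoc)
  qed
  have dL: "fps_deriv L = - fps_const x" by (simp add: L_def)
  have "- fps_deriv (L * R) = fps_const x * R + L * (- fps_deriv R)"
    by (simp add: dL algebra_simps flip: fps_const_neg)
  also have "- fps_deriv R = R * S" using add by (simp add: R_def S_def)
  also have "fps_const x * R + L * (R * S) = L * R * S + fps_const x * (L * E) * R"
    by (simp only: LE) (simp add: algebra_simps)
  also have "\<dots> = L * R * (S + fps_const x * E)" by (simp add: algebra_simps)
  finally show ?case unfolding R' S' .
qed (simp add: psum_def fps_eq_iff)

text \<open>Changes the d-th elementary symmetric function of the roots by \<open>c\<close>, up to
  sign, and no earlier one. For d > \<open>size M\<close> the exponent is truncated, and then only c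
  = 0 is used.\<close>

definition shift :: "nat \<Rightarrow> 'b::alg_closed_field \<Rightarrow> 'b multiset \<Rightarrow> 'b multiset" where
  "shift d c M = proots (prodlin M + Polynomial.monom c (size M - d))"

lemma prodlin_shift:
  assumes "d \<ge> 1" "d \<le> size M \<or> c = 0"
  shows "prodlin (shift d c M) = prodlin M + Polynomial.monom c (size M - d)"
    and "size (shift d c M) = size M"
proof -
  have "Polynomial.degree (prodlin M + Polynomial.monom c (size M - d)) = size M \<and>
      Polynomial.coeff (prodlin M + Polynomial.monom c (size M - d)) (size M) = 1"
  proof (cases "c = 0")
    case True
    then show ?thesis by (simp add: prodlin_monic)
  next
    case False
    then have "size M - d < size M" using assms by auto
    moreover have "Polynomial.degree (Polynomial.monom c (size M - d)) \<le> size M - d" by (rule degree_monom_le)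
    ultimately have "Polynomial.degree (Polynomial.monom c (size M - d)) < Polynomial.degree (prodlin M)"
      by (simp add: prodlin_monic)
    then have "Polynomial.degree (prodlin M + Polynomial.monom c (size M - d)) = size M"
      by (simp add: degree_add_eq_left prodlin_monic)
    moreover have "Polynomial.coeff (prodlin M + Polynomial.monom c (size M - d)) (size M) = 1"
      using \<open>size M - d < size M\<close> by (simp add: prodlin_monic)
    ultimately show ?thesis by simp
  qed
  then show 1: "prodlin (shift d c M) = prodlin M + Polynomial.monom c (size M - d)"
    unfolding shift_def by (intro prodlin_proots) simp
  then show "size (shift d c M) = size M"
    using prodlin_monic(1)[of "shift d c M"] \<open>_ \<and> _\<close> by simp
qed

lemma shift_shift:
  assumes "d \<ge> 1" "d \<le> size M \<or> c = 0"
  shows "shift d (- c) (shift d c M) = M"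
proof -
  have "prodlin (shift d c M) + Polynomial.monom (- c) (size (shift d c M) - d) = prodlin M"
    using prodlin_shift[OF assms] by (simp add: minus_monom [symmetric])
  then show ?thesis unfolding shift_def[of d "- c"] by (simp only: proots_prodlin)
qed

text \<open>By Newton's recursion the j-th power sum depends only on the first j coefficients of the
  reflected polynomial, and the d-th one contains the d-th coefficient with the factor -d. This
  factor is why the characteristic must not divide the degree of the curve polynomial.\<close>

lemma psum_shift:
  fixes M :: "'b::alg_closed_field multiset"
  assumes d: "d \<ge> 1" and M: "d \<le> size M"
  shows "j < d \<Longrightarrow> psum j (shift d c M) = psum j M"
    and "psum d (shift d c M) = psum d M - of_nat d * c"
proof -
  note sh = prodlin_shift[OF d disjI1[OF M], of c]
  define a where "a M k = Polynomial.coeff (reflect_poly (prodlin M)) k" for M :: "'b::alg_closed_field multiset" and k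
  have a0: "a N 0 = 1" for N by (simp add: a_def prodlin_monic)
  have rec: "psum (Suc j) N = - (of_nat (Suc j) * a N (Suc j)) - (\<Sum>k\<in>{1..j}. a N k * psum (Suc (j - k)) N)" for j N
  proof -
    have "- (of_nat (Suc j) * a N (Suc j)) = (\<Sum>k=0..j. a N k * psum (Suc (j - k)) N)"
      using arg_cong[OF newton_log_deriv[of N], of "\<lambda>A. fps_nth A j"] by (simp add: fps_mult_nth a_def)
    also have "\<dots> = psum (Suc j) N + (\<Sum>k\<in>{1..j}. a N k * psum (Suc (j - k)) N)"
      by (subst sum.atLeast_Suc_atMost) (simp_all add: a0)
    finally show ?thesis by (simp add: algebra_simps)
  qed
  have a_shift: "a (shift d c M) k = a M k + (if k = d then c else 0)" if "k \<le> d" for k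
  proof -
    have a_eq: "a N k = (if k \<le> size N then Polynomial.coeff (prodlin N) (size N - k) else 0)" for N
      by (simp add: a_def coeff_reflect_poly prodlin_monic)
    show ?thesis unfolding a_eq sh using that M by auto
  qed
  have eq: "psum (Suc j) (shift d c M) = psum (Suc j) M" if "Suc j < d" for j
    using that
  proof (induction j rule: less_induct)
    case (less j)
    have "(\<Sum>k\<in>{1..j}. a (shift d c M) k * psum (Suc (j - k)) (shift d c M)) =
        (\<Sum>k\<in>{1..j}. a M k * psum (Suc (j - k)) M)"
      using less by (intro sum.cong refl) (auto simp: a_shift)
    then show ?case
      unfolding rec[of j "shift d c M"] rec[of j M] using less.prems by (simp add: a_shift)
  qed
  show "psum j (shift d c M) = psum j M" if "j < d"
    using that eq[of "j - 1"] sh by (cases j) (auto simp: psum_def)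
  obtain d' where d': "d = Suc d'" using d by (cases d) auto
  have sum_eq: "(\<Sum>k\<in>{1..d'}. a (shift d c M) k * psum (Suc (d' - k)) (shift d c M)) =
      (\<Sum>k\<in>{1..d'}. a M k * psum (Suc (d' - k)) M)"
  proof (rule sum.cong[OF refl])
    fix k assume "k \<in> {1..d'}"
    then have "Suc (d' - k) < d" "k \<le> d" "k \<noteq> d" using d' by auto
    then show "a (shift d c M) k * psum (Suc (d' - k)) (shift d c M) = a M k * psum (Suc (d' - k)) M"
      by (simp add: a_shift eq)
  qed
  show "psum d (shift d c M) = psum d M - of_nat d * c"
    unfolding rec[of d' "shift d c M", folded d'] rec[of d' M, folded d'] sum_eq
    by (simp add: a_shift algebra_simps)
qed

text \<open>Only the leading term of f involves a power sum that the shift changes.\<close>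

lemma sum_poly_shift:
  assumes d: "d \<ge> 1" and M: "d \<le> size M \<or> c = 0" and f: "Polynomial.degree f = d"
  shows "(\<Sum>x\<in>#shift d c M. poly f x) = (\<Sum>x\<in>#M. poly f x) - Polynomial.lead_coeff f * of_nat d * c"
proof (cases "c = 0")
  case True
  then show ?thesis by (simp add: shift_def proots_prodlin)
next
  case False
  then have M: "d \<le> size M" using M by simp
  have sum: "(\<Sum>x\<in>#N. poly f x) = (\<Sum>j<d. Polynomial.coeff f j * psum j N) + Polynomial.lead_coeff f * psum d N" for N
    by (induction N) (auto simp: psum_def poly_altdef f lessThan_Suc_atMost [symmetric] sum.distrib algebra_simps)
  show ?thesis unfolding sum by (simp add: psum_shift[OF d M] algebra_simps)
qed

section \<open>Frobenius on root multisets and transitivity of the trace\<close>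

context char_field
begin

definition frobP :: "nat \<Rightarrow> 'b poly \<Rightarrow> 'b poly" where
  "frobP n P = map_poly (\<lambda>c. c ^ (p ^ n)) P"

lemma zero_power_p: "(0::'b) ^ (p ^ n) = 0"
  using prime_p by (simp add: power_0_left)

lemma coeff_frobP: "Polynomial.coeff (frobP n P) k = Polynomial.coeff P k ^ (p ^ n)"
  by (simp add: frobP_def coeff_map_poly zero_power_p)

lemma frobP_mult: "frobP n (P * R) = frobP n P * frobP n R"
  by (rule poly_eqI) (simp add: coeff_frobP Polynomial.coeff_mult frob_sum power_mult_distrib)

lemma frobP_add: "frobP n (P + R) = frobP n P + frobP n R"
  by (rule poly_eqI) (simp add: coeff_frobP frob_add)

lemma frobP_monom: "frobP n (Polynomial.monom c k) = Polynomial.monom (c ^ (p ^ n)) k"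
  by (rule poly_eqI) (simp add: coeff_frobP zero_power_p)

lemma frobP_prodlin: "frobP n (prodlin M) = prodlin (image_mset (\<lambda>x. x ^ (p ^ n)) M)"
proof (induction M)
  case empty
  show ?case by (rule poly_eqI) (simp add: coeff_frobP zero_power_p)
next
  case (add x M)
  have "frobP n [:-x, 1:] = [:- (x ^ (p ^ n)), 1:]"
    by (rule poly_eqI) (simp add: coeff_frobP coeff_pCons zero_power_p frob_minus split: nat.splits)
  then show ?case using add by (simp only: prodlin_simps frobP_mult image_mset_add_mset)
qed

lemma image_shift:
  assumes "d \<ge> 1" "d \<le> size M \<or> c = 0"
  shows "image_mset (\<lambda>x. x ^ (p ^ n)) (shift d (c :: 'b) M) =
    shift d (c ^ (p ^ n)) (image_mset (\<lambda>x. x ^ (p ^ n)) M)"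
proof -
  have "prodlin (image_mset (\<lambda>x. x ^ (p ^ n)) (shift d c M)) =
      prodlin (image_mset (\<lambda>x. x ^ (p ^ n)) M) + Polynomial.monom (c ^ (p ^ n)) (size M - d)"
    unfolding frobP_prodlin [symmetric] prodlin_shift[OF assms] frobP_add frobP_monom ..
  then have "proots (prodlin (image_mset (\<lambda>x. x ^ (p ^ n)) (shift d c M))) =
      shift d (c ^ (p ^ n)) (image_mset (\<lambda>x. x ^ (p ^ n)) M)"
    by (simp add: shift_def)
  then show ?thesis by (simp only: proots_prodlin)
qed

lemma frob_trace_split: "frob_trace p (k + l) (z :: 'b) = frob_trace p k z + frob_trace p l (z ^ (p ^ k))"
  by (induction l) (simp_all add: frob_trace_def add.assoc power_add power_mult)

text \<open>Transitivity of the trace in the tower of fields with p, p^s and p^(s i) elements, here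
  as an identity of polynomials in z.\<close>

lemma frob_trace_tower: "frob_trace p (s * i) z = frob_trace p s (\<Sum>j<i. (z :: 'b) ^ ((p ^ s) ^ j))"
proof (induction i)
  case 0
  show ?case by (simp add: frob_trace_def[of p 0])
next
  case (Suc i)
  have "frob_trace p (s * i + s) z = frob_trace p (s * i) z + frob_trace p s (z ^ (p ^ (s * i)))"
    by (rule frob_trace_split)
  then show ?case using Suc by (simp add: frob_trace_add power_mult add.commute[of s])
qed

lemma frob_trace_const:
  assumes "z ^ (p ^ s) = (z :: 'b)" shows "z ^ ((p ^ s) ^ j) = z"
  by (induction j) (simp_all add: power_mult assms)

end

text \<open>The fibre over the first component. A cycle of pairs (b, x) thus becomes a family of
  multisets, that is of monic polynomials indexed by b, to which \<open>shift\<close>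
  applies.\<close>

definition slice :: "('b \<times> 'c) multiset \<Rightarrow> 'b \<Rightarrow> 'c multiset" where
  "slice D b = image_mset snd (filter_mset (\<lambda>a. fst a = b) D)"

definition assemble :: "'b set \<Rightarrow> ('b \<Rightarrow> 'c multiset) \<Rightarrow> ('b \<times> 'c) multiset" where
  "assemble B M = (\<Sum>b\<in>B. image_mset (Pair b) (M b))"

lemma slice_add: "slice (D + E) b = slice D b + slice E b"
  by (simp add: slice_def)

lemma slice_sum: "slice (\<Sum>i\<in>I. D i) b = (\<Sum>i\<in>I. slice (D i) b)"
  by (induction I rule: infinite_finite_induct) (auto simp: slice_add slice_def)

lemma slice_Pair: "slice (image_mset (Pair b') M) b = (if b' = b then M else {#})"
  by (induction M) (auto simp: slice_def)

lemma slice_assemble: "finite B \<Longrightarrow> b \<in> B \<Longrightarrow> slice (assemble B M) b = M b"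
  by (simp add: assemble_def slice_sum slice_Pair)

lemma assemble_slice:
  assumes "finite B" "fst ` set_mset D \<subseteq> B"
  shows "assemble B (slice D) = D"
  using assms(2)
proof (induction D)
  case empty
  show ?case by (simp add: assemble_def slice_def)
next
  case (add a D)
  have "image_mset (Pair b) (slice (add_mset a D) b) =
      (if b = fst a then {#a#} else {#}) + image_mset (Pair b) (slice D b)" for b
    by (auto simp: slice_def)
  then have "assemble B (slice (add_mset a D)) = (\<Sum>b\<in>B. if b = fst a then {#a#} else {#}) + assemble B (slice D)"
    by (simp add: assemble_def sum.distrib)
  also have "(\<Sum>b\<in>B. if b = fst a then {#a#} else {#}) = {#a#}"
    using add.prems assms(1) by simp
  finally show ?case using add by simp
qed

lemma size_assemble: "size (assemble B M) = (\<Sum>b\<in>B. size (M b))"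
  by (simp add: assemble_def)

lemma set_assemble: "finite B \<Longrightarrow> set_mset (assemble B M) \<subseteq> B \<times> UNIV"
  by (auto simp: assemble_def set_mset_sum)

subsection \<open>Polynomiality of the L-series\<close>

lemma image_mset_of_sum: "image_mset g (\<Sum>i\<in>I. D i) = (\<Sum>i\<in>I. image_mset g (D i))"
  by (induction I rule: infinite_finite_induct) auto

locale as_sums = char_field p ty for p :: nat and ty :: "'b::alg_closed_field itself" +
  fixes s u d :: nat and f :: "'b poly"
  assumes s_pos: "s > 0" and u_pos: "u > 0" and d_pos: "d \<ge> 1" and degree_f: "Polynomial.degree f = d"
    and p_dvd: "\<not> p dvd d" and coeff_f: "\<And>n. Polynomial.coeff f n \<in> fixed_field (p ^ s)"
begin

definition Q :: nat where "Q = p ^ s"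

text \<open>Frobenius moves the characters b too. A pair fixed by its i-th power has b in the field
  with Q^i elements, so the fixed points match exactly the characters that occur over that
  extension, a set that varies with i.\<close>

definition frob :: "'b \<times> 'b \<Rightarrow> 'b \<times> 'b" where
  "frob = (\<lambda>(b, x). (b ^ Q, x ^ Q))"

definition B :: "'b set" where "B = fixed_field (p ^ u) - {0}"

lemma finite_B: "finite B"
  using card_fixed_field(1)[OF u_pos] by (simp add: B_def)

lemma Q_power: "Q ^ i = p ^ (s * i)"
  by (simp add: Q_def power_mult)

lemma frob_inj_Q: "(x :: 'b) ^ Q = y ^ Q \<longleftrightarrow> x = y"
  unfolding Q_def by (rule frob_inj)

lemma B_closed: "b \<in> B \<Longrightarrow> b ^ n \<in> B"
  by (auto simp: B_def intro: fixed_field_closed)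

lemma frob_funpow: "(frob ^^ i) (b, x) = (b ^ (Q ^ i), x ^ (Q ^ i))"
  by (induction i) (simp_all add: frob_def flip: power_mult, simp_all add: mult.commute)

lemma fix_eq: "{a \<in> B \<times> UNIV. (frob ^^ i) a = a} =
    (fixed_field (p ^ (s * i)) \<inter> fixed_field (p ^ u) - {0}) \<times> fixed_field (p ^ (s * i))"
  by (auto simp: frob_funpow Q_power B_def fixed_field_def)

sublocale finite_cycles frob "B \<times> UNIV"
proof
  show "inj frob" by (auto simp: inj_def frob_def frob_inj_Q)
  show "frob a \<in> B \<times> UNIV" if "a \<in> B \<times> UNIV" for a
    using that by (auto simp: frob_def B_closed)
  show "finite {a \<in> B \<times> UNIV. (frob ^^ i) a = a}" if "i > 0" for i
    unfolding fix_eq using card_fixed_field(1)[of "s * i"] s_pos that by auto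
qed

definition val :: "('b \<times> 'b) multiset \<Rightarrow> 'b" where
  "val D = (\<Sum>(b, x)\<in>#D. b * poly f x)"

text \<open>For a cycle D, \<open>val D\<close> is fixed by Frobenius and lies in the field with
  \<open>Q\<close> elements; its trace is then in the prime field, where \<open>add_char\<close> is
  a homomorphism. Hence the weight is multiplicative on cycles.\<close>

definition wt :: "('b \<times> 'b) multiset \<Rightarrow> complex" where
  "wt D = add_char p (frob_trace p s (val D))"

lemma val_add: "val (D + E) = val D + val E"
  by (simp add: val_def)

lemma val_sum: "val (\<Sum>i\<in>I. D i) = (\<Sum>i\<in>I. val (D i))"
  by (induction I rule: infinite_finite_induct) (simp_all add: val_add, simp_all add: val_def)

lemma val_frob: "val (image_mset frob D) = val D ^ Q"
proof (induction D)
  case empty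
  show ?case using zero_power_p[of s] by (simp add: val_def Q_def)
next
  case (add a D)
  obtain b x where a: "a = (b, x)" by fastforce
  have "poly f x ^ Q = poly f (x ^ Q)"
  proof -
    have "Polynomial.coeff f i ^ Q = Polynomial.coeff f i" for i
      using coeff_f[of i] by (simp add: fixed_field_def Q_def)
    then have "(Polynomial.coeff f i * x ^ i) ^ Q = Polynomial.coeff f i * (x ^ Q) ^ i" for i
      by (simp add: power_mult_distrib mult.commute flip: power_mult)
    then show ?thesis
      unfolding poly_altdef using frob_sum[of "\<lambda>i. Polynomial.coeff f i * x ^ i" _ s] by (simp add: Q_def)
  qed
  then have "val {#frob a#} = val {#a#} ^ Q" by (simp add: val_def a frob_def power_mult_distrib)
  with add show ?case
    using val_add[of "{#a#}" D] val_add[of "{#frob a#}" "image_mset frob D"] frob_add[of "val {#a#}" "val D" s]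
    by (simp add: Q_def)
qed

lemma val_cycle: "D \<in> cycles n \<Longrightarrow> val D \<in> fixed_field (p ^ s)"
  using val_frob[of D] by (simp add: cycles_def fixed_field_def Q_def)

lemma wt_mult: "D \<in> cycles n \<Longrightarrow> E \<in> cycles m \<Longrightarrow> wt (D + E) = wt D * wt E"
  unfolding wt_def val_add frob_trace_add
  by (intro add_char_add frob_trace_in val_cycle)

lemma val_funpow: "val {#(frob ^^ j) a#} = val {#a#} ^ (Q ^ j)"
proof (induction j)
  case (Suc j)
  have "val {#(frob ^^ Suc j) a#} = val (image_mset frob {#(frob ^^ j) a#})" by simp
  also have "\<dots> = val {#a#} ^ (Q ^ Suc j)"
    unfolding val_frob Suc by (simp add: mult.commute flip: power_mult)
  finally show ?case .
qed simp

lemma wt_cyc: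
  "wt (cyc i (b, x)) = add_char p (frob_trace p (s * i) (b * poly f x))"
proof -
  have "val (cyc i a) = (\<Sum>j<i. val {#(frob ^^ j) a#})" for a
    unfolding cyc_def by (rule val_sum)
  then have "val (cyc i (b, x)) = (\<Sum>j<i. (b * poly f x) ^ ((p ^ s) ^ j))"
    unfolding val_funpow by (simp add: val_def Q_def)
  then show ?thesis by (simp add: wt_def frob_trace_tower)
qed

definition S :: "nat \<Rightarrow> int" where
  "S i = int (card (affine_points (s * i) u f)) - int (p ^ (s * i))"

lemma sum_fix_points:
  assumes "i > 0"
  shows "(\<Sum>a\<in>fix_points i. wt (cyc i a)) = of_int (S i)"
proof -
  have "coeff_i": "Polynomial.coeff f n \<in> fixed_field (p ^ (s * i))" for n
    using fixed_field_power[OF coeff_f] by (simp add: power_mult)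
  have "(\<Sum>a\<in>fix_points i. wt (cyc i a)) =
      (\<Sum>(b, x)\<in>(fixed_field (p ^ (s * i)) \<inter> fixed_field (p ^ u) - {0}) \<times> fixed_field (p ^ (s * i)).
        add_char p (frob_trace p (s * i) (b * poly f x)))"
    unfolding fix_points_def fix_eq by (intro sum.cong refl) (auto simp: wt_cyc)
  also have "\<dots> = (\<Sum>b\<in>fixed_field (p ^ (s * i)) \<inter> fixed_field (p ^ u) - {0}. exp_sum (s * i) f b)"
    by (simp add: exp_sum_def sum.cartesian_product)
  also have "\<dots> = of_nat (card (affine_points (s * i) u f)) - of_nat (p ^ (s * i))"
    by (rule card_affine_points [symmetric]) (use s_pos u_pos assms coeff_i in auto)
  finally show ?thesis by (simp add: S_def)
qed

definition coef :: "nat \<Rightarrow> complex" where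
  "coef n = (\<Sum>D\<in>cycles n. wt D)"

lemma coef_0: "coef 0 = 1"
proof -
  have "cycles 0 = {{#}}" by (auto simp: cycles_def)
  then show ?thesis by (simp add: coef_def wt_def val_def)
qed

lemma coef_recursion: "of_nat n * coef n = (\<Sum>i\<in>{1..n}. of_int (S i) * coef (n - i))"
proof -
  have "of_nat n * coef n = (\<Sum>i\<in>{1..n}. (\<Sum>a\<in>fix_points i. wt (cyc i a)) * coef (n - i))"
    unfolding coef_def by (rule cycles_newton) (rule wt_mult)
  also have "\<dots> = (\<Sum>i\<in>{1..n}. of_int (S i) * coef (n - i))"
    by (intro sum.cong refl) (simp add: sum_fix_points)
  finally show ?thesis .
qed

lemma sum_eq_0_twist:
  fixes w :: "'c \<Rightarrow> complex"
  assumes "finite Z" and T: "\<And>D. D \<in> Z \<Longrightarrow> T D \<in> Z" "\<And>D. D \<in> Z \<Longrightarrow> T' (T D) = D"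
    and w: "\<And>D. D \<in> Z \<Longrightarrow> w (T D) = w D * \<zeta>" and "\<zeta> \<noteq> 1"
  shows "(\<Sum>D\<in>Z. w D) = 0"
proof -
  have "inj_on T Z" by (rule inj_on_inverseI[where g = T']) (rule T)
  then have "bij_betw T Z Z" using assms(1) T(1) by (simp add: bij_betw_def endo_inj_surj image_subset_iff)
  then have "(\<Sum>D\<in>Z. w D) = (\<Sum>D\<in>Z. w (T D))" by (rule sum.reindex_bij_betw [symmetric])
  also have "\<dots> = (\<Sum>D\<in>Z. w D) * \<zeta>" by (simp add: w sum_distrib_right)
  finally show ?thesis using \<open>\<zeta> \<noteq> 1\<close> by (simp add: algebra_simps)
qed

lemma frob_B: "bij_betw (\<lambda>b. b ^ Q) B B"
proof -
  have "inj_on (\<lambda>b. b ^ Q) B" by (auto simp: inj_on_def frob_inj_Q)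
  moreover have "(\<lambda>b. b ^ Q) ` B \<subseteq> B" using B_closed by auto
  ultimately show ?thesis using finite_B by (simp add: bij_betw_def endo_inj_surj)
qed

text \<open>The fibres over b and b^Q determine each other, so a cycle can be modified only along
  whole Frobenius orbits of characters.\<close>

lemma slice_cycle:
  assumes "D \<in> cycles n"
  shows "slice D (b ^ Q) = image_mset (\<lambda>x. x ^ Q) (slice D b)"
proof -
  have inv: "image_mset frob D = D" using assms by (simp add: cycles_def)
  have "slice (image_mset frob D) (b ^ Q) = image_mset (\<lambda>x. x ^ Q) (slice D b)"
    by (induction D) (auto simp: slice_def frob_def frob_inj_Q)
  then show ?thesis by (simp only: inv)
qed

lemma assemble_cycle:
  assumes "\<And>b. b \<in> B \<Longrightarrow> M (b ^ Q) = image_mset (\<lambda>x. x ^ Q) (M b)"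
  shows "assemble B M \<in> cycles (\<Sum>b\<in>B. size (M b))"
proof -
  have "image_mset frob (assemble B M) = (\<Sum>b\<in>B. image_mset (Pair (b ^ Q)) (M (b ^ Q)))"
  proof -
    have "image_mset frob (assemble B M) = (\<Sum>b\<in>B. image_mset frob (image_mset (Pair b) (M b)))"
      unfolding assemble_def by (rule image_mset_of_sum)
    also have "\<dots> = (\<Sum>b\<in>B. image_mset (Pair (b ^ Q)) (M (b ^ Q)))"
      by (intro sum.cong refl) (simp add: assms image_mset.compositionality o_def frob_def)
    finally show ?thesis .
  qed
  also have "\<dots> = assemble B M" unfolding assemble_def by (rule sum.reindex_bij_betw[OF frob_B])
  finally show ?thesis using set_assemble[OF finite_B, of M] by (simp add: cycles_def size_assemble)
qed

lemma val_assemble: "val (assemble B M) = (\<Sum>b\<in>B. b * (\<Sum>x\<in>#M b. poly f x))"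
proof -
  have "val (image_mset (Pair b) N) = b * (\<Sum>x\<in>#N. poly f x)" for b N
    by (induction N) (auto simp: val_def algebra_simps)
  then show ?thesis by (simp add: assemble_def val_sum)
qed

lemma cycle_assemble: "D \<in> cycles n \<Longrightarrow> assemble B (slice D) = D"
  by (rule assemble_slice[OF finite_B]) (auto simp: cycles_def)

text \<open>Adding \<open>c\<^sub>b x\<^bsup>n-d\<^esup>\<close> to the polynomials encoding a cycle permutes the cycles of given degrees
  and multiplies the weight by a character value, by Newton's identities.\<close>

definition translate :: "('b \<Rightarrow> 'b) \<Rightarrow> ('b \<times> 'b) multiset \<Rightarrow> ('b \<times> 'b) multiset" where
  "translate c D = assemble B (\<lambda>b. shift d (c b) (slice D b))"

lemma translate:
  assumes D: "D \<in> cycles n" and c: "\<And>b. b \<in> B \<Longrightarrow> c (b ^ Q) = c b ^ Q"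
    and big: "\<And>b. b \<in> B \<Longrightarrow> d \<le> size (slice D b) \<or> c b = 0"
  shows "translate c D \<in> cycles n" and "b \<in> B \<Longrightarrow> size (slice (translate c D) b) = size (slice D b)"
    and "translate (\<lambda>b. - c b) (translate c D) = D"
    and "val (translate c D) = val D + - (Polynomial.lead_coeff f * of_nat d * (\<Sum>b\<in>B. b * c b))"
proof -
  define M where "M b = shift d (c b) (slice D b)" for b
  have sl: "slice (translate c D) b = M b" if "b \<in> B" for b
    unfolding translate_def M_def by (rule slice_assemble[OF finite_B that])
  have size_M: "size (M b) = size (slice D b)" if "b \<in> B" for b
    unfolding M_def by (rule prodlin_shift(2)[OF d_pos big[OF that]])
  have inv: "M (b ^ Q) = image_mset (\<lambda>x. x ^ Q) (M b)" if "b \<in> B" for b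
    unfolding M_def slice_cycle[OF D] c[OF that]
    using image_shift[OF d_pos big[OF that], where n = s, folded Q_def] by (rule sym)
  have "translate c D \<in> cycles (\<Sum>b\<in>B. size (M b))"
    unfolding translate_def M_def [symmetric] by (rule assemble_cycle) (rule inv)
  also have "(\<Sum>b\<in>B. size (M b)) = size (assemble B (slice D))"
    unfolding size_assemble by (rule sum.cong) (use size_M in auto)
  also have "\<dots> = n" using D by (simp add: cycle_assemble[OF D]) (simp add: cycles_def)
  finally show "translate c D \<in> cycles n" .
  show "b \<in> B \<Longrightarrow> size (slice (translate c D) b) = size (slice D b)" using sl size_M by simp
  have "translate (\<lambda>b. - c b) (translate c D) = assemble B (slice D)"
    unfolding translate_def[of "\<lambda>b. - c b"] assemble_def
    by (intro sum.cong refl) (simp add: sl M_def shift_shift[OF d_pos big])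
  then show "translate (\<lambda>b. - c b) (translate c D) = D" by (simp add: cycle_assemble[OF D])
  have "val (translate c D) = (\<Sum>b\<in>B. b * ((\<Sum>x\<in>#slice D b. poly f x) - Polynomial.lead_coeff f * of_nat d * c b))"
    unfolding translate_def val_assemble
    by (intro sum.cong refl) (simp only: sum_poly_shift[OF d_pos big degree_f])
  also have "\<dots> = val (assemble B (slice D)) + - (Polynomial.lead_coeff f * of_nat d * (\<Sum>b\<in>B. b * c b))"
    unfolding val_assemble by (simp add: right_diff_distrib sum_subtractf sum_distrib_left mult_ac)
  finally show "val (translate c D) = val D + - (Polynomial.lead_coeff f * of_nat d * (\<Sum>b\<in>B. b * c b))"
    by (simp only: cycle_assemble[OF D])
qed

text \<open>Spreads c0 equivariantly along the Frobenius orbit of b0. The index runs over u steps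
  because b0^(Q^u) = b0; a shorter orbit is traversed several times and the contributions add up, so
  that the total over \<open>B\<close> is a relative trace of b0 c0 in any case.\<close>

definition orbit_fun :: "'b \<Rightarrow> 'b \<Rightarrow> 'b \<Rightarrow> 'b" where
  "orbit_fun b0 c0 b = (\<Sum>j<u. if b = b0 ^ (Q ^ j) then c0 ^ (Q ^ j) else 0)"

lemma orbit_fun:
  assumes b0: "b0 \<in> B" and c0: "c0 \<in> fixed_field (p ^ (s * u))"
  shows "orbit_fun b0 c0 (b ^ Q) = orbit_fun b0 c0 b ^ Q"
    and "(\<Sum>b\<in>B. b * orbit_fun b0 c0 b) = (\<Sum>j<u. (b0 * c0) ^ (Q ^ j))"
    and "orbit_fun b0 c0 b \<noteq> 0 \<Longrightarrow> \<exists>j. b = b0 ^ (Q ^ j)"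
proof -
  define g where "g j = (if b ^ Q = b0 ^ (Q ^ j) then c0 ^ (Q ^ j) else 0)" for j
  have per: "b0 ^ (Q ^ u) = b0" "c0 ^ (Q ^ u) = c0"
  proof -
    have "b0 \<in> fixed_field (p ^ u)" using b0 by (simp add: B_def)
    from fixed_field_power[OF this, of s] show "b0 ^ (Q ^ u) = b0"
      by (simp add: fixed_field_def Q_power mult.commute flip: power_mult)
    show "c0 ^ (Q ^ u) = c0" using c0 by (simp add: fixed_field_def Q_power)
  qed
  have "orbit_fun b0 c0 b ^ Q = (\<Sum>j<u. (if b = b0 ^ (Q ^ j) then c0 ^ (Q ^ j) else 0) ^ Q)"
    unfolding orbit_fun_def Q_def by (rule frob_sum)
  also have "\<dots> = (\<Sum>j<u. g (Suc j))"
  proof (intro sum.cong refl)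
    fix j
    have "b ^ Q = b0 ^ (Q ^ Suc j) \<longleftrightarrow> b = b0 ^ (Q ^ j)"
      using frob_inj_Q[of b "b0 ^ (Q ^ j)"] by (simp add: mult.commute flip: power_mult)
    then show "(if b = b0 ^ (Q ^ j) then c0 ^ (Q ^ j) else 0) ^ Q = g (Suc j)"
      using zero_power_p[of s] by (simp add: g_def Q_def mult.commute flip: power_mult)
  qed
  \<comment> \<open>Cyclic shift of the index: the terms for j = 0 and j = u agree.\<close>
  also have "\<dots> = (\<Sum>j<Suc u. g j) - g 0" unfolding sum.lessThan_Suc_shift by simp
  also have "\<dots> = (\<Sum>j<u. g j)" using per by (simp add: g_def)
  also have "\<dots> = orbit_fun b0 c0 (b ^ Q)" by (simp add: orbit_fun_def g_def)
  finally show "orbit_fun b0 c0 (b ^ Q) = orbit_fun b0 c0 b ^ Q" by (rule sym)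
  have "(\<Sum>b\<in>B. b * orbit_fun b0 c0 b) =
      (\<Sum>j<u. \<Sum>b\<in>B. if b = b0 ^ (Q ^ j) then b * c0 ^ (Q ^ j) else 0)"
    unfolding orbit_fun_def sum_distrib_left by (subst sum.swap) (intro sum.cong refl, simp)
  also have "\<dots> = (\<Sum>j<u. (b0 * c0) ^ (Q ^ j))"
    by (intro sum.cong refl) (simp add: finite_B B_closed[OF b0] power_mult_distrib)
  finally show "(\<Sum>b\<in>B. b * orbit_fun b0 c0 b) = (\<Sum>j<u. (b0 * c0) ^ (Q ^ j))" .
  assume nz: "orbit_fun b0 c0 b \<noteq> 0"
  show "\<exists>j. b = b0 ^ (Q ^ j)"
  proof (rule ccontr)
    assume "\<nexists>j. b = b0 ^ (Q ^ j)"
    then have "orbit_fun b0 c0 b = 0" by (simp add: orbit_fun_def)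
    with nz show False by simp
  qed
qed

lemma size_slice_orbit:
  assumes "D \<in> cycles n"
  shows "size (slice D (b ^ (Q ^ j))) = size (slice D b)"
proof (induction j)
  case (Suc j)
  have "slice D ((b ^ (Q ^ j)) ^ Q) = image_mset (\<lambda>x. x ^ Q) (slice D (b ^ (Q ^ j)))"
    by (rule slice_cycle[OF assms])
  then show ?case using Suc by (simp add: mult.commute flip: power_mult)
qed simp

text \<open>Translation preserves the sizes of all fibres, so each size profile can be treated on
  its own. Only fibres over the orbit of b0 are shifted; they all have the size of the one over b0,
  hence room for a shift in degree d. Every weight of the profile is multiplied by the same root of
  unity \<open>\<zeta>\<close>.\<close>

lemma profile_sum_eq_0:
  assumes b0: "b0 \<in> B" and big: "\<nu> b0 \<ge> d"
  shows "(\<Sum>D\<in>{D \<in> cycles n. \<forall>b\<in>B. size (slice D b) = \<nu> b}. wt D) = 0"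
proof -
  define \<kappa> where "\<kappa> = Polynomial.lead_coeff f * of_nat d"
  have \<kappa>: "\<kappa> \<in> fixed_field (p ^ s)"
    unfolding \<kappa>_def by (intro fixed_field_closed fixed_field_of_nat coeff_f)
  have "\<kappa> \<noteq> 0"
    using p_dvd d_pos degree_f by (auto simp: \<kappa>_def of_nat_eq_0_iff_char_dvd CHAR_p)
  have \<kappa>': "\<kappa> \<in> fixed_field (p ^ (s * u))" using fixed_field_power[OF \<kappa>, of u] by (simp add: power_mult)
  have b0': "b0 \<in> fixed_field (p ^ (s * u))" "b0 \<noteq> 0"
    using b0 fixed_field_power[of b0 "p ^ u" s] by (auto simp: B_def mult.commute simp flip: power_mult)
  have "\<kappa> * b0 \<in> fixed_field (p ^ (s * u))" "\<kappa> * b0 \<noteq> 0"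
    using \<open>\<kappa> \<noteq> 0\<close> b0' by (auto intro: fixed_field_closed \<kappa>')
  \<comment> \<open>Nondegeneracy of the trace form on the field with p^(s u) elements is what makes
    \<open>\<zeta>\<close> nontrivial.\<close>
  then obtain c0 where c0: "c0 \<in> fixed_field (p ^ (s * u))" "frob_trace p (s * u) (\<kappa> * b0 * c0) \<noteq> 0"
    using frob_trace_nonzero[of "\<kappa> * b0" "s * u"] s_pos u_pos by auto
  define c where "c = orbit_fun b0 c0"
  note orb = orbit_fun[OF b0 c0(1), folded c_def]
  define \<delta> where "\<delta> = \<kappa> * (\<Sum>b\<in>B. b * c b)"
  have \<kappa>j: "\<kappa> ^ (Q ^ j) = \<kappa>" for j
    unfolding Q_def by (rule frob_trace_const) (use \<kappa> in \<open>simp add: fixed_field_def\<close>)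
  have \<delta>: "\<delta> = (\<Sum>j<u. (\<kappa> * b0 * c0) ^ ((p ^ s) ^ j))"
    unfolding \<delta>_def orb(2) sum_distrib_left Q_def [symmetric]
    by (intro sum.cong refl) (simp add: power_mult_distrib \<kappa>j mult_ac)
  have tr\<delta>: "frob_trace p s \<delta> = frob_trace p (s * u) (\<kappa> * b0 * c0)"
    unfolding \<delta> by (rule frob_trace_tower [symmetric])
  have "frob_trace p (s * u) (\<kappa> * b0 * c0) \<in> fixed_field p"
    by (intro frob_trace_in fixed_field_closed \<kappa>' b0' c0)
  then have tr_in: "- frob_trace p s \<delta> \<in> fixed_field p"
    using fixed_field_closed(4)[of _ 1] by (simp add: tr\<delta>)
  define \<zeta> where "\<zeta> = add_char p (- frob_trace p s \<delta>)"
  have "\<zeta> \<noteq> 1" using add_char_eq_1[OF tr_in] c0 by (auto simp: \<zeta>_def tr\<delta>)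
  define Z where "Z = {D \<in> cycles n. \<forall>b\<in>B. size (slice D b) = \<nu> b}"
  have bigD: "d \<le> size (slice D b) \<or> c b = 0" if "D \<in> Z" "b \<in> B" for D b
  proof (cases "c b = 0")
    case False
    then obtain j where "b = b0 ^ (Q ^ j)" using orb(3) by blast
    then show ?thesis using that size_slice_orbit[of D n b0 j] b0 big by (simp add: Z_def)
  qed simp
  have tl: "translate c D \<in> cycles n" "b \<in> B \<Longrightarrow> size (slice (translate c D) b) = size (slice D b)"
    "translate (\<lambda>b. - c b) (translate c D) = D" "val (translate c D) = val D + - \<delta>" if "D \<in> Z" for D b
  proof -
    have D: "D \<in> cycles n" using that by (simp add: Z_def)
    note tr = translate[OF D orb(1) bigD[OF that]]
    show "translate c D \<in> cycles n" "b \<in> B \<Longrightarrow> size (slice (translate c D) b) = size (slice D b)"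
      "translate (\<lambda>b. - c b) (translate c D) = D" "val (translate c D) = val D + - \<delta>"
      using tr by (simp_all add: \<delta>_def \<kappa>_def)
  qed
  have "(\<Sum>D\<in>Z. wt D) = 0"
  proof (rule sum_eq_0_twist[where T = "translate c" and T' = "translate (\<lambda>b. - c b)" and \<zeta> = \<zeta>])
    show "finite Z" using finite_cycles[of n] by (simp add: Z_def)
    show "translate c D \<in> Z" if "D \<in> Z" for D using tl[OF that] that by (simp add: Z_def)
    show "translate (\<lambda>b. - c b) (translate c D) = D" if "D \<in> Z" for D by (rule tl(3)[OF that])
    show "wt (translate c D) = wt D * \<zeta>" if "D \<in> Z" for D
    proof -
      have "frob_trace p s (val D) \<in> fixed_field p"
        using that by (intro frob_trace_in val_cycle[of D n]) (simp add: Z_def)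
      then show ?thesis
        unfolding wt_def tl(4)[OF that] frob_trace_add frob_trace_minus \<zeta>_def by (rule add_char_add) (rule tr_in)
    qed
  qed (rule \<open>\<zeta> \<noteq> 1\<close>)
  then show ?thesis by (simp add: Z_def)
qed

text \<open>Pigeonhole: with at most d - 1 points over each character there are at most card
  \<open>B\<close> * (d - 1) points. Since card \<open>B\<close> = p^u - 1, this threshold is
  2g.\<close>

theorem coef_eq_0:
  assumes "n > card B * (d - 1)"
  shows "coef n = 0"
proof -
  define prof where "prof D = (\<lambda>b. if b \<in> B then size (slice D b) else 0)" for D :: "('b \<times> 'b) multiset"
  have "coef n = (\<Sum>\<nu>\<in>prof ` cycles n. \<Sum>D\<in>{D \<in> cycles n. prof D = \<nu>}. wt D)"
    unfolding coef_def by (rule sum.image_gen[OF finite_cycles])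
  also have "\<dots> = (\<Sum>\<nu>\<in>prof ` cycles n. 0)"
  proof (rule sum.cong[OF refl])
    fix \<nu> assume "\<nu> \<in> prof ` cycles n"
    then obtain D0 where D0: "D0 \<in> cycles n" "\<nu> = prof D0" by auto
    have "n = (\<Sum>b\<in>B. \<nu> b)"
      using D0 size_assemble[of B "slice D0"] cycle_assemble[OF D0(1)] by (simp add: cycles_def prof_def)
    have "\<exists>b0\<in>B. \<nu> b0 \<ge> d"
    proof (rule ccontr)
      assume "\<not> (\<exists>b0\<in>B. \<nu> b0 \<ge> d)"
      then have "(\<Sum>b\<in>B. \<nu> b) \<le> of_nat (card B) * (d - 1)" by (intro sum_bounded_above) fastforce
      then show False using assms \<open>n = _\<close> by simp
    qed
    then obtain b0 where b0: "b0 \<in> B" "\<nu> b0 \<ge> d" by blast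
    have "{D \<in> cycles n. prof D = \<nu>} = {D \<in> cycles n. \<forall>b\<in>B. size (slice D b) = \<nu> b}"
      by (auto simp: prof_def D0 fun_eq_iff)
    then show "(\<Sum>D\<in>{D \<in> cycles n. prof D = \<nu>}. wt D) = 0"
      using profile_sum_eq_0[where \<nu> = \<nu> and n = n, OF b0] by (simp only:)
  qed
  finally show ?thesis by simp
qed

end

subsection \<open>Gauss valuations\<close>

lemma rat_ord_fract:
  assumes p: "Factorial_Ring.prime (p::nat)" and ab: "a \<noteq> 0" "b \<noteq> 0"
  shows "rat_ord p (of_int a / of_int b) =
    int (multiplicity (int p) a) - int (multiplicity (int p) b)"
proof -
  obtain n m where nm: "quotient_of (of_int a / of_int b) = (n, m)" by fastforce
  have m: "m > 0" using quotient_of_denom_pos[OF nm] .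
  have eq: "(of_int a / of_int b :: rat) = of_int n / of_int m" using quotient_of_div[OF nm] .
  then have "(of_int (a * m) :: rat) = of_int (n * b)" using ab m by (simp add: field_simps)
  then have "a * m = n * b" by (simp only: of_int_eq_iff)
  moreover have "n \<noteq> 0" using calculation ab m by auto
  moreover have pe: "prime_elem (int p)" using p by simp
  ultimately have "multiplicity (int p) a + multiplicity (int p) m = multiplicity (int p) n + multiplicity (int p) b"
    using ab m prime_elem_multiplicity_mult_distrib[OF pe, of a m] prime_elem_multiplicity_mult_distrib[OF pe, of n b]
    by simp
  then show ?thesis by (simp add: rat_ord_def nm)
qed

lemma rat_fract_obtain:
  assumes "(c::rat) \<noteq> 0"
  obtains a b where "a \<noteq> 0" "b \<noteq> 0" "c = of_int a / of_int b"
proof -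
  obtain a b where ab: "quotient_of c = (a, b)" by fastforce
  have "b > 0" using quotient_of_denom_pos[OF ab] .
  moreover have "c = of_int a / of_int b" using quotient_of_div[OF ab] .
  moreover have "a \<noteq> 0" using assms calculation by auto
  ultimately show thesis using that[of a b] by auto
qed

lemma rat_ord_mult:
  assumes p: "Factorial_Ring.prime (p::nat)" and "c \<noteq> 0" "d \<noteq> 0"
  shows "rat_ord p (c * d) = rat_ord p c + rat_ord p d"
proof -
  obtain a b where 1: "a \<noteq> 0" "b \<noteq> 0" "c = of_int a / of_int b" using rat_fract_obtain[OF assms(2)] .
  obtain a' b' where 2: "a' \<noteq> 0" "b' \<noteq> 0" "d = of_int a' / of_int b'" using rat_fract_obtain[OF assms(3)] .
  have pe: "prime_elem (int p)" using p by simp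
  have "c * d = of_int (a * a') / of_int (b * b')" by (simp add: 1 2)
  then have "rat_ord p (c * d) = int (multiplicity (int p) (a * a')) - int (multiplicity (int p) (b * b'))"
    using rat_ord_fract[OF p, of "a * a'" "b * b'"] 1 2 by simp
  then show ?thesis
    using 1 2 by (simp add: rat_ord_fract[OF p] prime_elem_multiplicity_mult_distrib[OF pe])
qed

lemma rat_ord_uminus: "rat_ord p (- c) = rat_ord p c"
  by (simp add: rat_ord_def rat_uminus_code Let_def split: prod.splits)

lemma rat_ord_1: "rat_ord p 1 = 0"
  by (simp add: rat_ord_def)

lemma rat_ord_add:
  assumes p: "Factorial_Ring.prime (p::nat)" and "c \<noteq> 0" "d \<noteq> 0" "c + d \<noteq> 0"
  shows "rat_ord p (c + d) \<ge> min (rat_ord p c) (rat_ord p d)"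
proof -
  obtain a b where 1: "a \<noteq> 0" "b \<noteq> 0" "c = of_int a / of_int b" using rat_fract_obtain[OF assms(2)] .
  obtain a' b' where 2: "a' \<noteq> 0" "b' \<noteq> 0" "d = of_int a' / of_int b'" using rat_fract_obtain[OF assms(3)] .
  have c: "c = of_int (a * b') / of_int (b * b')" and d: "d = of_int (a' * b) / of_int (b * b')"
    using 1 2 by simp_all
  have cd: "c + d = of_int (a * b' + a' * b) / of_int (b * b')"
    using 1 2 by (simp add: field_simps)
  have n0: "a * b' + a' * b \<noteq> 0"
  proof
    assume "a * b' + a' * b = 0"
    then have "c + d = 0" unfolding cd by (simp only: of_int_0 div_0)
    with assms(4) show False ..
  qed
  define k where "k = min (multiplicity (int p) (a * b')) (multiplicity (int p) (a' * b))"
  have "int p ^ k dvd a * b' + a' * b"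
    by (intro dvd_add multiplicity_dvd') (auto simp: k_def)
  then have "k \<le> multiplicity (int p) (a * b' + a' * b)"
    using n0 p by (intro multiplicity_geI) (auto simp: prime_gt_Suc_0_nat dest: prime_gt_1_nat)
  moreover have "rat_ord p (c + d) = int (multiplicity (int p) (a * b' + a' * b)) - int (multiplicity (int p) (b * b'))"
    unfolding cd by (rule rat_ord_fract[OF p n0]) (use 1 2 in simp)
  moreover have "rat_ord p c = int (multiplicity (int p) (a * b')) - int (multiplicity (int p) (b * b'))"
    by (subst c, rule rat_ord_fract[OF p]) (use 1 2 in auto)
  moreover have "rat_ord p d = int (multiplicity (int p) (a' * b)) - int (multiplicity (int p) (b * b'))"
    by (subst d, rule rat_ord_fract[OF p]) (use 1 2 in auto)
  ultimately show ?thesis unfolding k_def by linarith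
qed

text \<open>The weight \<open>\<tau> ord\<^sub>p(c) - s n\<close> of a term \<open>c T\<^sup>n\<close> is \<open>\<tau>\<close> times a Gauss valuation of \<open>\<rat>[T]\<close>; the
  lower bound \<open>0\<close> for all terms says that the Newton polygon lies above the line of slope \<open>1 / \<tau>\<close>.\<close>

locale gauss_val =
  fixes p \<tau> s :: nat
  assumes prime_p: "Factorial_Ring.prime p"
begin

definition term_ge :: "int \<Rightarrow> nat \<Rightarrow> rat \<Rightarrow> bool" where
  "term_ge C n c \<longleftrightarrow> c = 0 \<or> int \<tau> * rat_ord p c - int s * int n \<ge> C"

definition fps_ge :: "int \<Rightarrow> rat fps \<Rightarrow> bool" where
  "fps_ge C A \<longleftrightarrow> (\<forall>n. term_ge C n (fps_nth A n))"

lemma term_ge_add: "term_ge C n c \<Longrightarrow> term_ge C n d \<Longrightarrow> term_ge C n (c + d)"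
proof (cases "c = 0 \<or> d = 0 \<or> c + d = 0")
  case False
  assume *: "term_ge C n c" "term_ge C n d"
  have "rat_ord p c \<le> rat_ord p (c + d) \<or> rat_ord p d \<le> rat_ord p (c + d)"
    using rat_ord_add[OF prime_p, of c d] False by (auto simp: min_def split: if_splits)
  then have "int \<tau> * rat_ord p c \<le> int \<tau> * rat_ord p (c + d) \<or> int \<tau> * rat_ord p d \<le> int \<tau> * rat_ord p (c + d)"
    by (auto intro: mult_left_mono)
  then show ?thesis using * False by (auto simp: term_ge_def)
qed (auto simp: term_ge_def)

lemma term_ge_uminus: "term_ge C n (- c) \<longleftrightarrow> term_ge C n c"
  by (simp add: term_ge_def rat_ord_uminus)

lemma term_ge_sum: "(\<And>i. i \<in> A \<Longrightarrow> term_ge C n (h i)) \<Longrightarrow> term_ge C n (sum h A)"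
  by (induction A rule: infinite_finite_induct) (auto intro: term_ge_add simp: term_ge_def[of _ _ 0])

lemma term_ge_mult: "term_ge C n c \<Longrightarrow> term_ge D m d \<Longrightarrow> term_ge (C + D) (n + m) (c * d)"
  by (cases "c = 0 \<or> d = 0") (auto simp: term_ge_def rat_ord_mult[OF prime_p] algebra_simps)

lemma fps_ge_add: "fps_ge C A \<Longrightarrow> fps_ge C B \<Longrightarrow> fps_ge C (A + B)"
  by (simp add: fps_ge_def term_ge_add)

lemma fps_ge_uminus: "fps_ge C A \<Longrightarrow> fps_ge C (- A)"
  by (simp add: fps_ge_def term_ge_uminus)

lemma fps_ge_mult:
  assumes "fps_ge C A" "fps_ge D B"
  shows "fps_ge (C + D) (A * B)"
  unfolding fps_ge_def fps_mult_nth
proof (intro allI term_ge_sum)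
  fix n i :: nat assume "i \<in> {0..n}"
  then show "term_ge (C + D) n (fps_nth A i * fps_nth B (n - i))"
    using term_ge_mult[of C i "fps_nth A i" D "n - i" "fps_nth B (n - i)"] assms by (simp add: fps_ge_def)
qed

lemma fps_ge_mono: "fps_ge C A \<Longrightarrow> D \<le> C \<Longrightarrow> fps_ge D A"
  by (force simp: fps_ge_def term_ge_def)

section \<open>Gauss's lemma for power series with valuation bounded below\<close>

definition bounded_fps :: "rat fps \<Rightarrow> bool" where
  "bounded_fps A \<longleftrightarrow> (\<exists>C. fps_ge C A)"

lemma bounded_fps_add: "bounded_fps A \<Longrightarrow> bounded_fps B \<Longrightarrow> bounded_fps (A + B)"
proof -
  assume "bounded_fps A" "bounded_fps B"
  then obtain C D where "fps_ge C A" "fps_ge D B" by (auto simp: bounded_fps_def)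
  then have "fps_ge (min C D) (A + B)" by (intro fps_ge_add) (auto elim: fps_ge_mono)
  then show ?thesis by (auto simp: bounded_fps_def)
qed

lemma bounded_fps_mult: "bounded_fps A \<Longrightarrow> bounded_fps B \<Longrightarrow> bounded_fps (A * B)"
  unfolding bounded_fps_def by (blast intro: fps_ge_mult)

lemma bounded_fps_uminus: "bounded_fps A \<Longrightarrow> bounded_fps (- A)"
  using fps_ge_uminus by (auto simp: bounded_fps_def)

lemma bounded_fps_of_poly: "bounded_fps (fps_of_poly P)"
proof -
  define h where "h n = int \<tau> * rat_ord p (Polynomial.coeff P n) - int s * int n" for n
  have "term_ge (Min (h ` {..Polynomial.degree P})) n (Polynomial.coeff P n)" for n
  proof (cases "n \<le> Polynomial.degree P")
    case True
    then have "Min (h ` {..Polynomial.degree P}) \<le> h n" by (intro Min_le) auto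
    then show ?thesis by (simp add: term_ge_def h_def)
  next
    case False
    then show ?thesis by (simp add: term_ge_def Polynomial.coeff_eq_0)
  qed
  then show ?thesis by (auto simp: bounded_fps_def fps_ge_def)
qed

text \<open>The valuations of the terms are integers bounded below, so a minimum exists. The first
  index attaining it plays the part of the leading term in Gauss's lemma, and integrality gives the
  gap of 1 before it.\<close>

lemma minimal_term:
  assumes "bounded_fps A" "A \<noteq> 0"
  obtains \<alpha> a where "fps_ge \<alpha> A" "fps_nth A a \<noteq> 0" "int \<tau> * rat_ord p (fps_nth A a) - int s * int a = \<alpha>"
    "\<And>i. i < a \<Longrightarrow> term_ge (\<alpha> + 1) i (fps_nth A i)"
proof -
  obtain C where C: "fps_ge C A" using assms by (auto simp: bounded_fps_def)
  obtain n0 where n0: "fps_nth A n0 \<noteq> 0" using assms(2) by (auto simp: fps_eq_iff)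
  define h where "h n = int \<tau> * rat_ord p (fps_nth A n) - int s * int n" for n
  define k where "k = (LEAST k. \<exists>n. fps_nth A n \<noteq> 0 \<and> nat (h n - C) = k)"
  have hC: "h n \<ge> C" if "fps_nth A n \<noteq> 0" for n
    using C that unfolding fps_ge_def term_ge_def h_def by auto
  have ex: "\<exists>n. fps_nth A n \<noteq> 0 \<and> nat (h n - C) = k"
    unfolding k_def by (rule LeastI[of _ "nat (h n0 - C)"]) (use n0 in blast)
  have least: "k \<le> nat (h n - C)" if "fps_nth A n \<noteq> 0" for n
    unfolding k_def by (rule Least_le) (use that in blast)
  define \<alpha> where "\<alpha> = C + int k"
  define a where "a = (LEAST n. fps_nth A n \<noteq> 0 \<and> h n = \<alpha>)"
  have "\<exists>n. fps_nth A n \<noteq> 0 \<and> h n = \<alpha>" using ex hC by (force simp: \<alpha>_def)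
  then have a: "fps_nth A a \<noteq> 0 \<and> h a = \<alpha>" unfolding a_def by (rule LeastI_ex)
  have ge: "h n \<ge> \<alpha>" if "fps_nth A n \<noteq> 0" for n
    using least[OF that] hC[OF that] by (simp add: \<alpha>_def)
  show thesis
  proof (rule that)
    show "fps_ge \<alpha> A" using ge by (auto simp: fps_ge_def term_ge_def h_def)
    show "fps_nth A a \<noteq> 0" "int \<tau> * rat_ord p (fps_nth A a) - int s * int a = \<alpha>" using a by (auto simp: h_def)
    fix i assume "i < a"
    then have "\<not> (fps_nth A i \<noteq> 0 \<and> h i = \<alpha>)" unfolding a_def by (rule not_less_Least)
    then show "term_ge (\<alpha> + 1) i (fps_nth A i)" using ge[of i]
      by (cases "fps_nth A i = 0") (auto simp: term_ge_def h_def)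
  qed
qed

text \<open>At index a + b the product of the two first minimal terms is the only summand of minimal
  valuation and cannot cancel. As the product of the series is 1, this forces a + b = 0, so the
  minimum over A is attained at its constant term 1. Boundedness of both series is what provides the
  minimal terms.\<close>

lemma fps_ge_unit:
  assumes "bounded_fps A" "bounded_fps B" and AB: "A * B = 1" and A0: "fps_nth A 0 = 1"
  shows "fps_ge 0 A"
proof -
  have "A \<noteq> 0" "B \<noteq> 0" using AB by auto
  obtain \<alpha> a where a: "fps_ge \<alpha> A" "fps_nth A a \<noteq> 0" "int \<tau> * rat_ord p (fps_nth A a) - int s * int a = \<alpha>"
    "\<And>i. i < a \<Longrightarrow> term_ge (\<alpha> + 1) i (fps_nth A i)" using minimal_term[OF assms(1) \<open>A \<noteq> 0\<close>] by blast
  obtain \<beta> b where b: "fps_ge \<beta> B" "fps_nth B b \<noteq> 0" "int \<tau> * rat_ord p (fps_nth B b) - int s * int b = \<beta>"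
    "\<And>i. i < b \<Longrightarrow> term_ge (\<beta> + 1) i (fps_nth B i)" using minimal_term[OF assms(2) \<open>B \<noteq> 0\<close>] by blast
  define t where "t i = fps_nth A i * fps_nth B (a + b - i)" for i
  have others: "term_ge (\<alpha> + \<beta> + 1) (a + b) (t i)" if "i \<in> {0..a+b} - {a}" for i
  proof (cases "i < a")
    case True
    have "term_ge \<beta> (a + b - i) (fps_nth B (a + b - i))" using b(1) by (simp add: fps_ge_def)
    from term_ge_mult[OF a(4)[OF True] this] show ?thesis using that True by (simp add: t_def algebra_simps)
  next
    case False
    then have lt: "a + b - i < b" using that by auto
    have "term_ge \<alpha> i (fps_nth A i)" using a(1) by (simp add: fps_ge_def)
    from term_ge_mult[OF this b(4)[OF lt]] show ?thesis using that by (simp add: t_def algebra_simps)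
  qed
  have "a + b = 0"
  proof (rule ccontr)
    assume ab: "a + b \<noteq> 0"
    then have "0 = fps_nth (A * B) (a + b)" by (simp add: AB)
    also have "\<dots> = (\<Sum>i=0..a+b. t i)" by (simp add: fps_mult_nth t_def)
    also have "\<dots> = t a + (\<Sum>i\<in>{0..a+b} - {a}. t i)" by (rule sum.remove) auto
    finally have "t a = - (\<Sum>i\<in>{0..a+b} - {a}. t i)" by simp
    moreover have "term_ge (\<alpha> + \<beta> + 1) (a + b) (\<Sum>i\<in>{0..a+b} - {a}. t i)" by (rule term_ge_sum) (rule others)
    ultimately have "term_ge (\<alpha> + \<beta> + 1) (a + b) (t a)" by (simp add: term_ge_uminus)
    moreover have "int \<tau> * rat_ord p (t a) - int s * int (a + b) = \<alpha> + \<beta>"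
      using a b by (simp add: t_def rat_ord_mult[OF prime_p] algebra_simps)
    ultimately show False using a(2) b(2) by (simp add: term_ge_def t_def)
  qed
  then have "a = 0" by simp
  then have "\<alpha> = 0" using a(3) A0 by (simp add: rat_ord_1)
  with a(1) show ?thesis by simp
qed

text \<open>With P = \<pi>^a R, cancelling \<pi>^(a-1) in the differential equation shows that the
  polynomial Q = a T \<pi>' R is \<pi> times a bounded series. Over the rationals \<pi> divides none
  of a, T, \<pi>' and R, so it is coprime to Q; the Bezout identity then exhibits an inverse of
  \<pi> among the bounded series, and \<open>fps_ge_unit\<close> applies.\<close>

lemma fps_of_poly_prime_factor_ge:
  assumes irr: "prime_elem (\<pi> :: rat poly)" and \<pi>0: "Polynomial.coeff \<pi> 0 = 1" and dvd: "\<pi> dvd P"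
    and P0: "P \<noteq> 0" and G: "fps_ge 0 G" and eq: "fps_X * fps_deriv (fps_of_poly P) = G * fps_of_poly P"
  shows "fps_ge 0 (fps_of_poly \<pi>)"
proof -
  have not_unit: "\<not> is_unit \<pi>" and "\<pi> \<noteq> 0" using irr by (auto simp: prime_elem_def)
  obtain R where R: "P = \<pi> ^ multiplicity \<pi> P * R" "\<not> \<pi> dvd R"
    using multiplicity_decompose'[OF P0 not_unit] by metis
  define a where "a = multiplicity \<pi> P"
  have "a > 0" unfolding a_def using dvd P0 not_unit by (simp add: multiplicity_gt_zero_iff)
  then obtain a' where a': "a = Suc a'" by (cases a) auto
  have "Polynomial.degree \<pi> > 0" using not_unit \<open>\<pi> \<noteq> 0\<close> by (auto simp: is_unit_iff_degree)
  then have "pderiv \<pi> \<noteq> 0" "Polynomial.degree (pderiv \<pi>) < Polynomial.degree \<pi>"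
    by (auto simp: pderiv_eq_0_iff degree_pderiv)
  then have n1: "\<not> \<pi> dvd pderiv \<pi>" using dvd_imp_degree_le by force
  have n2: "\<not> \<pi> dvd [:0, 1:]"
  proof
    assume "\<pi> dvd [:0, 1:]"
    then obtain H where H: "[:0, 1:] = \<pi> * H" by blast
    have "poly \<pi> 0 \<noteq> 0" using \<pi>0 by (simp add: poly_0_coeff_0)
    have "Polynomial.degree [:0, 1 :: rat:] = Polynomial.degree \<pi> + Polynomial.degree H"
      unfolding H by (rule degree_mult_eq) (use H in auto)
    then have "Polynomial.degree H = 0" using \<open>Polynomial.degree \<pi> > 0\<close> by simp
    then obtain c where c: "H = [:c:]" by (rule degree_eq_zeroE)
    have "poly \<pi> 0 * poly H 0 = 0" using arg_cong[OF H, of "\<lambda>P. poly P 0"] by simp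
    then have "H = 0" using \<open>poly \<pi> 0 \<noteq> 0\<close> c by simp
    then show False using H by simp
  qed
  have n3: "\<not> \<pi> dvd [:of_nat a:]"
    using \<open>a > 0\<close> not_unit dvd_unit_imp_unit[of \<pi> "[:of_nat a:]"] by (auto simp: is_unit_const_poly_iff dvd_field_iff)
  define Q where "Q = [:of_nat a:] * ([:0, 1:] * (pderiv \<pi> * R))"
  have "\<not> \<pi> dvd Q" unfolding Q_def using n1 n2 n3 R(2) irr by (simp only: prime_elem_dvd_mult_iff) simp
  then have "coprime \<pi> Q" using irr by (simp add: prime_elem_imp_coprime)
  then obtain U V where UV: "U * \<pi> + V * Q = 1"
    by (metis bezout_coefficients_fst_snd coprime_iff_gcd_eq_1)
  have derivP: "pderiv P = \<pi> ^ a' * ([:of_nat a:] * (pderiv \<pi> * R) + \<pi> * pderiv R)"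
  proof -
    have "pderiv P = pderiv (\<pi> ^ Suc a' * R)" using R(1) by (simp only: a_def [symmetric] a')
    also have "\<dots> = \<pi> ^ Suc a' * pderiv R + R * (Polynomial.smult (of_nat (Suc a')) (\<pi> ^ a') * pderiv \<pi>)"
      by (simp only: pderiv_mult pderiv_power_Suc)
    also have "\<dots> = \<pi> ^ a' * ([:of_nat a:] * (pderiv \<pi> * R) + \<pi> * pderiv R)"
      by (simp add: a' algebra_simps)
    finally show ?thesis .
  qed
  have fX: "fps_of_poly [:0, 1:] = fps_X" by (simp add: fps_of_poly_pCons)
  have "fps_of_poly \<pi> ^ a' * (fps_of_poly Q + fps_X * fps_of_poly \<pi> * fps_of_poly (pderiv R)) =
      fps_X * fps_of_poly (pderiv P)"
    unfolding derivP Q_def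
    by (simp only: fps_of_poly_mult fps_of_poly_add fps_of_poly_power fX) (simp add: algebra_simps)
  also have "\<dots> = G * fps_of_poly P" using eq by (simp add: fps_of_poly_pderiv)
  also have "fps_of_poly P = fps_of_poly \<pi> ^ a' * (fps_of_poly \<pi> * fps_of_poly R)"
    by (subst R(1)) (simp add: a_def [symmetric] a' fps_of_poly_mult fps_of_poly_power)
  finally have "fps_of_poly \<pi> ^ a' * (fps_of_poly Q + fps_X * fps_of_poly \<pi> * fps_of_poly (pderiv R)) =
      fps_of_poly \<pi> ^ a' * (G * (fps_of_poly \<pi> * fps_of_poly R))" by (simp add: algebra_simps)
  moreover have "fps_of_poly \<pi> ^ a' \<noteq> 0"
    using \<open>\<pi> \<noteq> 0\<close> fps_of_poly_eq_iff[of \<pi> 0] by simp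
  ultimately have "fps_of_poly Q + fps_X * fps_of_poly \<pi> * fps_of_poly (pderiv R) = G * (fps_of_poly \<pi> * fps_of_poly R)"
    unfolding mult_cancel_left by blast
  then have Q: "fps_of_poly Q = fps_of_poly \<pi> * (G * fps_of_poly R - fps_X * fps_of_poly (pderiv R))"
    unfolding right_diff_distrib eq_diff_eq by (simp add: mult_ac)
  define W where "W = fps_of_poly U + fps_of_poly V * (G * fps_of_poly R + - (fps_X * fps_of_poly (pderiv R)))"
  have "fps_of_poly \<pi> * W = fps_of_poly (U * \<pi> + V * Q)"
    by (simp add: W_def fps_of_poly_add fps_of_poly_mult Q algebra_simps)
  then have "fps_of_poly \<pi> * W = 1" by (simp add: UV)
  moreover have "bounded_fps W"
  proof -
    have "bounded_fps G" using G by (auto simp: bounded_fps_def)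
    moreover have "bounded_fps fps_X" using bounded_fps_of_poly[of "[:0, 1:]"] by (simp add: fX)
    ultimately show ?thesis unfolding W_def
      by (intro bounded_fps_add bounded_fps_mult bounded_fps_uminus bounded_fps_of_poly)
  qed
  ultimately show ?thesis
    using fps_ge_unit[OF bounded_fps_of_poly] \<pi>0 by simp
qed

text \<open>The bound is multiplicative, so it is enough to split off one prime factor at a time;
  the induction runs over the divisors of P, since the differential equation is available for P
  itself only.\<close>

theorem fps_ge_of_log_deriv:
  assumes P0: "Polynomial.coeff P 0 = 1" and G: "fps_ge 0 G"
    and eq: "fps_X * fps_deriv (fps_of_poly P) = G * fps_of_poly P"
  shows "fps_ge 0 (fps_of_poly P)"
proof -
  have "P \<noteq> 0" using P0 by auto
  have "fps_ge 0 (fps_of_poly A)" if "A dvd P" "Polynomial.coeff A 0 = 1" for A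
    using that
  proof (induction "Polynomial.degree A" arbitrary: A rule: less_induct)
    case less
    have "A \<noteq> 0" using less.prems by auto
    show ?case
    proof (cases "is_unit A")
      case True
      then obtain c where "A = [:c:]" using \<open>A \<noteq> 0\<close> by (auto simp: is_unit_iff_degree elim: degree_eq_zeroE)
      then have "A = 1" using less.prems by (simp add: one_pCons)
      then show ?thesis by (auto simp: fps_ge_def term_ge_def rat_ord_1 fps_one_nth)
    next
      case False
      then obtain \<pi>0 where \<pi>0: "\<pi>0 dvd A" "Factorial_Ring.prime \<pi>0"
        using prime_divisor_exists[OF \<open>A \<noteq> 0\<close>] by blast
      obtain B0 where B0: "A = \<pi>0 * B0" using \<pi>0 by blast
      \<comment> \<open>Factors are normalised to constant term 1 rather than to leading coefficient
        1: this is the form that \<open>fps_ge_unit\<close> bounds.\<close>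
      define c where "c = Polynomial.coeff \<pi>0 0"
      have c: "c * Polynomial.coeff B0 0 = 1"
        using less.prems(2) unfolding B0 c_def by (simp add: Polynomial.coeff_mult)
      then have "c \<noteq> 0" by auto
      define \<pi> where "\<pi> = Polynomial.smult (inverse c) \<pi>0"
      define B where "B = Polynomial.smult c B0"
      have A: "A = \<pi> * B" using \<open>c \<noteq> 0\<close> by (simp add: \<pi>_def B_def B0)
      have coeffs: "Polynomial.coeff \<pi> 0 = 1" "Polynomial.coeff B 0 = 1"
        using c \<open>c \<noteq> 0\<close> by (auto simp: \<pi>_def B_def c_def)
      have "\<pi>0 dvd \<pi>" "\<pi> dvd \<pi>0"
        using \<open>c \<noteq> 0\<close> by (simp_all add: \<pi>_def dvd_smult smult_dvd)
      then have "prime_elem \<pi>"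
        using \<pi>0 prime_elem_normalize_iff associated_iff_dvd prime_imp_prime_elem by metis
      have "\<pi> dvd P" "B dvd P" using less.prems(1) A by (auto intro: dvd_mult_left dvd_mult_right)
      have "Polynomial.degree \<pi> > 0"
        using \<open>prime_elem \<pi>\<close> by (auto simp: prime_elem_def is_unit_iff_degree)
      moreover have "Polynomial.degree A = Polynomial.degree \<pi> + Polynomial.degree B"
        unfolding A by (rule degree_mult_eq) (use A \<open>A \<noteq> 0\<close> in auto)
      ultimately have "fps_ge 0 (fps_of_poly B)"
        using \<open>B dvd P\<close> coeffs by (intro less.hyps) auto
      moreover have "fps_ge 0 (fps_of_poly \<pi>)"
        by (rule fps_of_poly_prime_factor_ge[OF \<open>prime_elem \<pi>\<close> coeffs(1) \<open>\<pi> dvd P\<close> \<open>P \<noteq> 0\<close> G eq])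
      ultimately show ?thesis using fps_ge_mult[of 0 _ 0] by (simp add: A fps_of_poly_mult)
    qed
  qed
  then show ?thesis using P0 by simp
qed

end

subsection \<open>The coordinate ring\<close>

text \<open>As \<open>K\<close> is a finite field, an element is algebraic over it exactly when two
  powers with distinct exponents coincide; hence the form of \<open>transcendental\<close>.\<close>

locale as_curve =
  fixes K :: "'b::field set" and x y :: 'b and q d :: nat and f :: "'b poly"
  assumes K0: "0 \<in> K" and K1: "1 \<in> K"
    and K_add: "\<And>a b. a \<in> K \<Longrightarrow> b \<in> K \<Longrightarrow> a + b \<in> K"
    and K_mult: "\<And>a b. a \<in> K \<Longrightarrow> b \<in> K \<Longrightarrow> a * b \<in> K"
    and K_minus: "\<And>a. a \<in> K \<Longrightarrow> - a \<in> K"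
    and K_inverse: "\<And>a. a \<in> K \<Longrightarrow> inverse a \<in> K"
    and finite_K: "finite K"
    and q_ge_2: "q \<ge> 2" and of_nat_q: "of_nat q = (0 :: 'b)" and d_pos: "d \<ge> 1" and coprime_qd: "coprime q d"
    and degree_f: "Polynomial.degree f = d" and coeff_f: "\<And>n. Polynomial.coeff f n \<in> K"
    and curve_eq: "y ^ q - y = poly f x"
    and transcendental: "\<And>m n. x ^ m = x ^ n \<Longrightarrow> m = n"
begin

lemma K_diff: "a \<in> K \<Longrightarrow> b \<in> K \<Longrightarrow> a - b \<in> K"
  using K_add[of a "- b"] K_minus by simp

lemma K_power: "a \<in> K \<Longrightarrow> a ^ n \<in> K"
  by (induction n) (auto intro: K1 K_mult)

lemma K_sum: "(\<And>i. i \<in> A \<Longrightarrow> h i \<in> K) \<Longrightarrow> sum h A \<in> K"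
  by (induction A rule: infinite_finite_induct) (auto intro: K0 K_add)

lemma K_divide: "a \<in> K \<Longrightarrow> b \<in> K \<Longrightarrow> a / b \<in> K"
  by (simp add: divide_inverse K_mult K_inverse)

lemma x_notin_K: "x \<notin> K"
proof
  assume "x \<in> K"
  then have "range (\<lambda>n. x ^ n) \<subseteq> K" by (auto intro: K_power)
  then have "finite (range (\<lambda>n. x ^ n))" using finite_K finite_subset by blast
  moreover have "inj (\<lambda>n. x ^ n)" using transcendental by (auto intro: injI)
  ultimately show False using finite_imageD infinite_UNIV_nat by blast
qed

lemma x_nonzero: "x \<noteq> 0"
  using x_notin_K K0 by auto

definition lc :: 'b where "lc = Polynomial.coeff f d"

lemma lc_nonzero: "lc \<noteq> 0"
  using d_pos degree_f by (auto simp: lc_def)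

lemma poly_f: "poly f z = (\<Sum>i<d. Polynomial.coeff f i * z ^ i) + lc * z ^ d"
  unfolding poly_altdef degree_f lc_def by (simp add: lessThan_Suc_atMost [symmetric])

text \<open>\<open>pair_span a b n g v\<close>: \<open>g\<close> is a combination of monomials \<open>x\<^sup>i y\<^sup>j\<close> of weight \<open>q i + d j < n\<close>
  (the weight is the pole order at infinity), and \<open>v\<close> is the same combination of the \<open>a\<^sup>i b\<^sup>j\<close>.
  Tracking both components makes evaluation at \<open>(a, b)\<close> well-defined as soon as
  \<open>pair_span a b n 0 v\<close> implies \<open>v = 0\<close>.\<close>

inductive pair_span :: "'b \<Rightarrow> 'b \<Rightarrow> nat \<Rightarrow> 'b \<Rightarrow> 'b \<Rightarrow> bool" for a b n where
  zero: "pair_span a b n 0 0"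
| step: "pair_span a b n g v \<Longrightarrow> c \<in> K \<Longrightarrow> q * i + d * j < n \<Longrightarrow>
    pair_span a b n (g + c * x ^ i * y ^ j) (v + c * a ^ i * b ^ j)"

lemma monom: "c \<in> K \<Longrightarrow> q * i + d * j < n \<Longrightarrow> pair_span a b n (c * x ^ i * y ^ j) (c * a ^ i * b ^ j)"
  using step[OF zero, of c i j n a b] by simp

lemma span_add: "pair_span a b n h w \<Longrightarrow> pair_span a b n g v \<Longrightarrow> pair_span a b n (g + h) (v + w)"
  by (induction rule: pair_span.induct) (auto simp flip: add.assoc intro: pair_span.intros)

lemma span_cmult: "pair_span a b n g v \<Longrightarrow> c \<in> K \<Longrightarrow> pair_span a b n (c * g) (c * v)"
proof (induction rule: pair_span.induct)
  case (step g v c' i j)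
  from pair_span.step[OF step.IH[OF step.prems] K_mult[OF step.prems step.hyps(2)] step.hyps(3)]
  show ?case by (simp add: algebra_simps)
qed (simp add: zero)

lemma span_diff: "pair_span a b n g v \<Longrightarrow> pair_span a b n h w \<Longrightarrow> pair_span a b n (g - h) (v - w)"
  using span_add[OF span_cmult[of a b n h w "- 1"]] K_minus[OF K1] by force

lemma span_mono: "pair_span a b n g v \<Longrightarrow> n \<le> m \<Longrightarrow> pair_span a b m g v"
  by (induction rule: pair_span.induct) (auto intro: pair_span.intros)

lemma span_sum:
  "(\<And>i. i \<in> A \<Longrightarrow> pair_span a b n (g i) (v i)) \<Longrightarrow> pair_span a b n (sum g A) (sum v A)"
  by (induction A rule: infinite_finite_induct) (auto intro: zero span_add)

lemma span_mult_monom: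
  "pair_span a b n g v \<Longrightarrow> pair_span a b (n + (q * i + d * j)) (g * (x ^ i * y ^ j)) (v * (a ^ i * b ^ j))"
proof (induction rule: pair_span.induct)
  case (step g v c i' j')
  have "q * (i' + i) + d * (j' + j) < n + (q * i + d * j)" using step.hyps(3) by (simp add: algebra_simps)
  from pair_span.step[OF step.IH step.hyps(2) this] show ?case by (simp add: algebra_simps power_add)
qed (simp add: zero)

lemma span_mult:
  assumes "pair_span a b n g v" "pair_span a b (Suc m) h w"
  shows "pair_span a b (n + m) (g * h) (v * w)"
  using assms(2)
proof (induction rule: pair_span.induct)
  case (step h w c i j)
  have "pair_span a b (n + (q * i + d * j)) (c * (g * (x ^ i * y ^ j))) (c * (v * (a ^ i * b ^ j)))"
    by (rule span_cmult[OF span_mult_monom[OF assms(1)] step.hyps(2)])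
  then have "pair_span a b (n + m) (c * (g * (x ^ i * y ^ j))) (c * (v * (a ^ i * b ^ j)))"
    by (rule span_mono) (use step.hyps(3) in simp)
  from span_add[OF this step.IH] show ?case by (simp add: algebra_simps)
qed (simp add: zero)

definition on_curve :: "'b \<Rightarrow> 'b \<Rightarrow> bool" where
  "on_curve a b \<longleftrightarrow> b ^ q - b = poly f a"

lemma on_curve_xy: "on_curve x y"
  by (simp add: on_curve_def curve_eq)

text \<open>The curve equation exchanges y^q for \<open>lc\<close> * x^d up to smaller weight, both
  of weight q d. The induction iterates the exchange, and the constant remains nonzero.\<close>

lemma span_y_power:
  assumes "on_curve a b"
  shows "\<exists>c\<in>K - {0}. pair_span a b (q * (d * k)) (y ^ (q * k) - c * x ^ (d * k)) (b ^ (q * k) - c * a ^ (d * k))"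
proof (induction k)
  case 0
  show ?case using K1 by (intro bexI[of _ 1]) (auto simp: zero)
next
  case (Suc k)
  then obtain c where c: "c \<in> K" "c \<noteq> 0"
    "pair_span a b (q * (d * k)) (y ^ (q * k) - c * x ^ (d * k)) (b ^ (q * k) - c * a ^ (d * k))" by auto
  have 1: "pair_span a b (q * d) (y ^ q - lc * x ^ d) (b ^ q - lc * a ^ d)"
  proof -
    have "pair_span a b (q * d) (1 * x ^ 0 * y ^ 1 + (\<Sum>i<d. Polynomial.coeff f i * x ^ i * y ^ 0))
        (1 * a ^ 0 * b ^ 1 + (\<Sum>i<d. Polynomial.coeff f i * a ^ i * b ^ 0))"
      by (intro span_add span_sum monom) (use q_ge_2 d_pos coeff_f K1 in auto)
    moreover have "y ^ q - lc * x ^ d = y + (\<Sum>i<d. Polynomial.coeff f i * x ^ i)"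
      using curve_eq by (simp add: poly_f algebra_simps)
    moreover have "b ^ q - lc * a ^ d = b + (\<Sum>i<d. Polynomial.coeff f i * a ^ i)"
      using assms by (simp add: on_curve_def poly_f algebra_simps)
    ultimately show ?thesis by simp
  qed
  have lcK: "lc \<in> K" using coeff_f by (simp add: lc_def)
  have "pair_span a b (q * d + (q * 0 + d * (q * k))) ((y ^ q - lc * x ^ d) * (x ^ 0 * y ^ (q * k)))
      ((b ^ q - lc * a ^ d) * (a ^ 0 * b ^ (q * k)))"
    by (rule span_mult_monom[OF 1])
  moreover have "pair_span a b (q * (d * k) + (q * d + d * 0))
      (lc * ((y ^ (q * k) - c * x ^ (d * k)) * (x ^ d * y ^ 0)))
      (lc * ((b ^ (q * k) - c * a ^ (d * k)) * (a ^ d * b ^ 0)))"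
    by (rule span_cmult[OF span_mult_monom[OF c(3)] lcK])
  ultimately have "pair_span a b (q * (d * Suc k))
      ((y ^ q - lc * x ^ d) * (x ^ 0 * y ^ (q * k)) + lc * ((y ^ (q * k) - c * x ^ (d * k)) * (x ^ d * y ^ 0)))
      ((b ^ q - lc * a ^ d) * (a ^ 0 * b ^ (q * k)) + lc * ((b ^ (q * k) - c * a ^ (d * k)) * (a ^ d * b ^ 0)))"
    by (intro span_add) (simp_all add: algebra_simps)
  then have "pair_span a b (q * (d * Suc k)) (y ^ (q * Suc k) - (lc * c) * x ^ (d * Suc k))
      (b ^ (q * Suc k) - (lc * c) * a ^ (d * Suc k))"
    by (simp add: algebra_simps power_add)
  then show ?case using lcK c lc_nonzero by (intro bexI[of _ "lc * c"]) (auto intro: K_mult)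
qed

text \<open>Equal weights force q to divide j' - j, because q and d are coprime; the two monomials
  then differ by trading y^(q k) for x^(d k).\<close>

lemma monom_proportional_aux:
  assumes ab: "on_curve a b" and wt: "q * i + d * j = q * i' + d * j'" and "j \<le> j'"
  shows "\<exists>c\<in>K - {0}. pair_span a b (q * i + d * j) (x ^ i' * y ^ j' - c * (x ^ i * y ^ j)) (a ^ i' * b ^ j' - c * (a ^ i * b ^ j))"
proof -
  have *: "q * i = q * i' + d * (j' - j)" using assms(2,3) by (simp add: diff_mult_distrib2)
  have "q dvd q * i' + d * (j' - j)" unfolding * [symmetric] by simp
  then have "q dvd d * (j' - j)" by (simp add: dvd_add_right_iff)
  then have "q dvd j' - j" using coprime_qd by (simp add: coprime_dvd_mult_right_iff)
  then obtain k where k: "j' - j = q * k" by blast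
  then have j': "j' = j + q * k" using assms(3) by simp
  have "q * i = q * (i' + d * k)" using * k by (simp add: algebra_simps)
  then have i: "i = i' + d * k" using q_ge_2 by simp
  obtain c where c: "c \<in> K - {0}"
    "pair_span a b (q * (d * k)) (y ^ (q * k) - c * x ^ (d * k)) (b ^ (q * k) - c * a ^ (d * k))"
    using span_y_power[OF ab, of k] by blast
  have "pair_span a b (q * (d * k) + (q * i' + d * j)) ((y ^ (q * k) - c * x ^ (d * k)) * (x ^ i' * y ^ j))
     ((b ^ (q * k) - c * a ^ (d * k)) * (a ^ i' * b ^ j))"
    by (rule span_mult_monom[OF c(2)])
  then have "pair_span a b (q * i + d * j) (x ^ i' * y ^ j' - c * (x ^ i * y ^ j)) (a ^ i' * b ^ j' - c * (a ^ i * b ^ j))"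
    by (simp add: i j' algebra_simps power_add)
  with c show ?thesis by blast
qed

lemma monom_proportional:
  assumes ab: "on_curve a b" and wt: "q * i + d * j = n" "q * i' + d * j' = n"
  shows "\<exists>c\<in>K. pair_span a b n (x ^ i' * y ^ j' - c * (x ^ i * y ^ j)) (a ^ i' * b ^ j' - c * (a ^ i * b ^ j))"
proof (cases "j \<le> j'")
  case True
  with monom_proportional_aux[OF ab, of i j i' j'] wt show ?thesis by auto
next
  case False
  with monom_proportional_aux[OF ab, of i' j' i j] wt obtain c where c: "c \<in> K" "c \<noteq> 0"
    "pair_span a b n (x ^ i * y ^ j - c * (x ^ i' * y ^ j')) (a ^ i * b ^ j - c * (a ^ i' * b ^ j'))"
    by auto
  have "pair_span a b n (- inverse c * (x ^ i * y ^ j - c * (x ^ i' * y ^ j')))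
      (- inverse c * (a ^ i * b ^ j - c * (a ^ i' * b ^ j')))"
    by (rule span_cmult[OF c(3)]) (intro K_minus K_inverse c)
  moreover have "- inverse c * (u - c * w) = w - inverse c * u" for u w
    using c(2) by (simp add: right_diff_distrib flip: mult.assoc)
  ultimately show ?thesis using c(1) by (intro bexI[of _ "inverse c"]) (auto intro: K_inverse)
qed

text \<open>The graded pieces of the weight filtration have dimension at most one, so one fixed
  monomial of weight n serves as leading monomial for all elements.\<close>

lemma span_leading:
  assumes ab: "on_curve a b" and wt: "q * i0 + d * j0 = n"
  shows "pair_span a b (Suc n) g v \<Longrightarrow>
    \<exists>c\<in>K. pair_span a b n (g - c * (x ^ i0 * y ^ j0)) (v - c * (a ^ i0 * b ^ j0))"
proof (induction rule: pair_span.induct)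
  case zero
  show ?case by (intro bexI[of _ 0]) (auto intro: pair_span.zero K0)
next
  case (step g v c i j)
  then obtain c1 where c1: "c1 \<in> K" "pair_span a b n (g - c1 * (x ^ i0 * y ^ j0)) (v - c1 * (a ^ i0 * b ^ j0))"
    by auto
  obtain c2 where c2: "c2 \<in> K"
    "pair_span a b n (c * (x ^ i * y ^ j) - c2 * (x ^ i0 * y ^ j0)) (c * (a ^ i * b ^ j) - c2 * (a ^ i0 * b ^ j0))"
  proof (cases "q * i + d * j = n")
    case True
    from monom_proportional[OF ab wt True] obtain c' where c': "c' \<in> K"
      "pair_span a b n (x ^ i * y ^ j - c' * (x ^ i0 * y ^ j0)) (a ^ i * b ^ j - c' * (a ^ i0 * b ^ j0))" by auto
    from span_cmult[OF c'(2) step.hyps(2)] show thesis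
      by (intro that[of "c * c'"]) (auto simp: algebra_simps intro: K_mult c' step)
  next
    case False
    then have "pair_span a b n (c * x ^ i * y ^ j) (c * a ^ i * b ^ j)"
      by (intro monom step) (use step.hyps(3) in simp)
    then show thesis by (intro that[of 0]) (auto simp: mult.assoc intro: K0)
  qed
  from span_add[OF c1(2) c2(2)] show ?case
    by (intro bexI[of _ "c1 + c2"]) (auto simp: algebra_simps intro: K_add c1 c2)
qed

lemma span_no_monom:
  assumes "\<And>i j. q * i + d * j \<noteq> n"
  shows "pair_span a b (Suc n) g v \<Longrightarrow> pair_span a b n g v"
proof (induction rule: pair_span.induct)
  case (step g v c i j)
  then show ?case using assms[of i j] by (intro pair_span.step) auto
qed (rule zero)

section \<open>Filtration of the coordinate ring by pole order at infinity\<close>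

definition below :: "nat \<Rightarrow> 'b set" where
  "below n = {g. \<exists>v. pair_span x y n g v}"

lemma span_below: "pair_span a b n g v \<Longrightarrow> g \<in> below n"
proof (induction rule: pair_span.induct)
  case (step g v c i j)
  then show ?case unfolding below_def by (blast intro: pair_span.step)
qed (auto simp: below_def intro: zero)

lemma below_span: "g \<in> below n \<Longrightarrow> \<exists>v. pair_span a b n g v"
proof -
  assume "g \<in> below n"
  then obtain v where "pair_span x y n g v" by (auto simp: below_def)
  then show ?thesis by (induction rule: pair_span.induct) (blast intro: pair_span.intros)+
qed

lemma below_closed:
  "0 \<in> below n" "g \<in> below n \<Longrightarrow> h \<in> below n \<Longrightarrow> g + h \<in> below n"
  "g \<in> below n \<Longrightarrow> h \<in> below n \<Longrightarrow> g - h \<in> below n"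
  "g \<in> below n \<Longrightarrow> c \<in> K \<Longrightarrow> c * g \<in> below n"
  unfolding below_def by (blast intro: zero span_add span_diff span_cmult)+

lemma below_mult: "g \<in> below n \<Longrightarrow> h \<in> below (Suc m) \<Longrightarrow> g * h \<in> below (n + m)"
  unfolding below_def by (blast intro: span_mult)

lemma below_mono: "g \<in> below n \<Longrightarrow> n \<le> m \<Longrightarrow> g \<in> below m"
  unfolding below_def by (blast intro: span_mono)

lemma below_monom: "c \<in> K \<Longrightarrow> q * i + d * j < n \<Longrightarrow> c * (x ^ i * y ^ j) \<in> below n"
  using span_below[OF monom[of c i j n 0 0]] by (simp add: mult.assoc)

lemma below_leading:
  assumes "q * i + d * j = n" "g \<in> below (Suc n)"
  obtains c where "c \<in> K" "g - c * (x ^ i * y ^ j) \<in> below n"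
  using span_leading[OF on_curve_xy assms(1)] assms(2) unfolding below_def by blast

lemma below_no_monom: "(\<And>i j. q * i + d * j \<noteq> n) \<Longrightarrow> g \<in> below (Suc n) \<Longrightarrow> g \<in> below n"
  unfolding below_def using span_no_monom by blast

lemma below_0: "below 0 = {0}"
proof -
  have "pair_span x y 0 g v \<Longrightarrow> g = 0" for g v
    by (induction rule: pair_span.induct) auto
  then show ?thesis by (auto simp: below_def intro: zero)
qed

lemma finite_below: "finite (below n)"
proof (induction n)
  case (Suc n)
  show ?case
  proof (cases "\<exists>i j. q * i + d * j = n")
    case True
    then obtain i j where ij: "q * i + d * j = n" by blast
    have "below (Suc n) \<subseteq> (\<lambda>(g, c). g + c * (x ^ i * y ^ j)) ` (below n \<times> K)"
    proof
      fix g assume "g \<in> below (Suc n)"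
      from below_leading[OF ij this] obtain c where "c \<in> K" "g - c * (x ^ i * y ^ j) \<in> below n" .
      then show "g \<in> (\<lambda>(g, c). g + c * (x ^ i * y ^ j)) ` (below n \<times> K)"
        by (intro image_eqI[of _ _ "(g - c * (x ^ i * y ^ j), c)"]) auto
    qed
    then show ?thesis using Suc finite_K by (meson finite_SigmaI finite_imageI finite_subset)
  next
    case False
    then have "below (Suc n) \<subseteq> below n" using below_no_monom by blast
    then show ?thesis using Suc finite_subset by blast
  qed
qed (simp add: below_0)

text \<open>First j is found modulo q by inverting d; then j < q keeps d j below q d, and the
  remainder is a nonnegative multiple of q.\<close>

lemma representable:
  assumes "n \<ge> q * d"
  shows "\<exists>i j. q * i + d * j = n"
proof -
  obtain c where c: "[d * c = 1] (mod q)"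
    using cong_solve_coprime_nat[of d q] coprime_qd by (auto simp: coprime_commute)
  define j where "j = (c * n) mod q"
  have "[d * j = d * (c * n)] (mod q)" unfolding j_def by (simp add: cong_def mod_mult_right_eq)
  also have "d * (c * n) = (d * c) * n" by simp
  also have "[(d * c) * n = 1 * n] (mod q)" by (intro cong_mult c cong_refl)
  finally have cong: "[d * j = n] (mod q)" by simp
  have "j < q" unfolding j_def using q_ge_2 by simp
  then have "d * j \<le> d * q" by simp
  also have "\<dots> \<le> n" using assms by (simp add: mult.commute)
  finally have le: "d * j \<le> n" .
  with cong have "q dvd n - d * j" by (metis cong_altdef_nat cong_sym)
  then obtain i where "n - d * j = q * i" by blast
  with le have "q * i + d * j = n" by simp
  then show ?thesis by blast
qed

text \<open>If a monomial were a combination of monomials of smaller weight, then so would be all monomials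
  of large weight, \<open>K[x, y]\<close> would be finite and \<open>x\<close> a root of unity.\<close>

lemma monom_not_below: "q * i + d * j = n \<Longrightarrow> x ^ i * y ^ j \<notin> below n"
proof
  assume wt: "q * i + d * j = n" and in_below: "x ^ i * y ^ j \<in> below n"
  define N where "N = n + q * d"
  have stable: "below (Suc m) \<subseteq> below m" if mN: "m \<ge> N" for m
  proof
    fix g assume g: "g \<in> below (Suc m)"
    obtain i1 j1 where ij1: "q * i1 + d * j1 = m - n" 
      using representable[of "m - n"] add_le_imp_le_diff[of "q * d" n m] mN
      by (auto simp: N_def add.commute)
    have "m = n + (q * i1 + d * j1)" using ij1 that by (simp add: N_def)
    have "q * (i + i1) + d * (j + j1) = m"
      using wt \<open>m = _\<close> by (simp add: algebra_simps)
    from below_leading[OF this g] obtain c where c: "c \<in> K" "g - c * (x ^ (i + i1) * y ^ (j + j1)) \<in> below m" .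
    have "x ^ i1 * y ^ j1 \<in> below (Suc (m - n))" using below_monom[OF K1, of i1 j1] ij1 by simp
    from below_mult[OF in_below this] have "x ^ (i + i1) * y ^ (j + j1) \<in> below m"
      using that by (simp add: N_def power_add algebra_simps)
    from below_closed(2)[OF c(2) below_closed(4)[OF this c(1)]] show "g \<in> below m" by simp
  qed
  have "below m \<subseteq> below N" if "m \<ge> N" for m
    using that by (induction m rule: dec_induct) (use stable in blast)+
  then have "below m \<subseteq> below N" for m
    using below_mono by (cases "m \<ge> N") (auto simp: subset_iff)
  moreover have "x ^ k \<in> below (Suc (q * k))" for k
    using below_monom[OF K1, of k 0] by simp
  ultimately have "range (\<lambda>n. x ^ n) \<subseteq> below N" by blast
  then have "finite (range (\<lambda>n. x ^ n))" using finite_below finite_subset by blast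
  moreover have "inj (\<lambda>n. x ^ n)" using transcendental by (auto intro: injI)
  ultimately show False using finite_imageD infinite_UNIV_nat by blast
qed

lemma exact_leading:
  assumes "g \<in> below (Suc n)" "g \<notin> below n"
  obtains c i j where "c \<in> K" "c \<noteq> 0" "q * i + d * j = n" "g - c * (x ^ i * y ^ j) \<in> below n"
proof -
  obtain i j where ij: "q * i + d * j = n" using assms below_no_monom by blast
  from below_leading[OF ij assms(1)] obtain c where c: "c \<in> K" "g - c * (x ^ i * y ^ j) \<in> below n" .
  then show thesis using that[of c i j] assms ij by (cases "c = 0") auto
qed

text \<open>Leading monomials multiply, and by \<open>monom_not_below\<close> the product monomial
  does not drop in weight. The pole order at infinity is therefore additive, as a valuation has to
  be.\<close>

lemma exact_mult:
  assumes g: "g \<in> below (Suc n)" "g \<notin> below n" and h: "h \<in> below (Suc m)" "h \<notin> below m"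
  shows "g * h \<in> below (Suc (n + m))" "g * h \<notin> below (n + m)"
proof -
  show "g * h \<in> below (Suc (n + m))" using below_mult[OF g(1) h(1)] by simp
  obtain c i j where c: "c \<in> K" "c \<noteq> 0" "q * i + d * j = n" "g - c * (x ^ i * y ^ j) \<in> below n"
    using exact_leading[OF g] .
  obtain c' i' j' where c': "c' \<in> K" "c' \<noteq> 0" "q * i' + d * j' = m" "h - c' * (x ^ i' * y ^ j') \<in> below m"
    using exact_leading[OF h] .
  have 1: "(g - c * (x ^ i * y ^ j)) * h \<in> below (n + m)" by (rule below_mult[OF c(4) h(1)])
  have "(h - c' * (x ^ i' * y ^ j')) * (c * (x ^ i * y ^ j)) \<in> below (m + n)"
    by (rule below_mult[OF c'(4)]) (use below_monom[OF c(1), of i j] c(3) in simp)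
  then have 2: "c * (x ^ i * y ^ j) * (h - c' * (x ^ i' * y ^ j')) \<in> below (n + m)"
    by (simp add: mult.commute add.commute)
  show "g * h \<notin> below (n + m)"
  proof
    assume "g * h \<in> below (n + m)"
    from below_closed(3)[OF below_closed(3)[OF this 1] 2]
    have "c * c' * (x ^ (i + i') * y ^ (j + j')) \<in> below (n + m)" by (simp add: algebra_simps power_add)
    then have "inverse (c * c') * (c * c' * (x ^ (i + i') * y ^ (j + j'))) \<in> below (n + m)"
      by (rule below_closed(4)) (intro K_inverse K_mult c c')
    moreover have "inverse (c * c') * (c * c' * z) = z" for z
      using c(2) c'(2) by (simp add: field_simps)
    ultimately have "x ^ (i + i') * y ^ (j + j') \<in> below (n + m)" by (simp only:)
    moreover have "q * (i + i') + d * (j + j') = n + m" using c(3) c'(3) by (simp add: algebra_simps)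
    ultimately show False using monom_not_below by blast
  qed
qed

lemma exact_exists:
  assumes "g \<in> below n" "g \<noteq> 0"
  obtains m where "g \<in> below (Suc m)" "g \<notin> below m"
proof -
  define k where "k = (LEAST k. g \<in> below k)"
  have k: "g \<in> below k" unfolding k_def by (rule LeastI) (rule assms)
  then obtain m where m: "k = Suc m" using assms(2) below_0 by (cases k) auto
  moreover have "g \<notin> below m" using not_less_Least[of m "\<lambda>k. g \<in> below k"] m k_def by simp
  ultimately show thesis using that k by blast
qed

definition coord_ring :: "'b set" where
  "coord_ring = (\<Union>n. below n)"

text \<open>The leading coefficient of a representation of 0 vanishes, since no monomial is a
  combination of lower ones; descending through the weights kills the evaluated side as well. Thus
  every relation between monomials in x and y holds at each point of the curve.\<close>

lemma span_zero_unique: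
  assumes ab: "on_curve a b"
  shows "pair_span a b n 0 v \<Longrightarrow> v = 0"
proof (induction n)
  case 0
  have "pair_span a b 0 g v \<Longrightarrow> v = 0" for g
    by (induction rule: pair_span.induct) auto
  with 0 show ?case by blast
next
  case (Suc n)
  show ?case
  proof (cases "\<exists>i j. q * i + d * j = n")
    case True
    then obtain i j where ij: "q * i + d * j = n" by blast
    from span_leading[OF ab ij Suc.prems] obtain c where c: "c \<in> K"
      "pair_span a b n (0 - c * (x ^ i * y ^ j)) (v - c * (a ^ i * b ^ j))" by auto
    have "c = 0"
    proof (rule ccontr)
      assume "c \<noteq> 0"
      have "- inverse c * (0 - c * (x ^ i * y ^ j)) \<in> below n"
        by (rule below_closed(4)[OF span_below[OF c(2)]]) (intro K_minus K_inverse c)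
      then show False using monom_not_below[OF ij] \<open>c \<noteq> 0\<close> by (simp flip: mult.assoc)
    qed
    with c show ?thesis using Suc.IH by simp
  next
    case False
    then show ?thesis using span_no_monom[OF _ Suc.prems] Suc.IH by blast
  qed
qed

definition ev :: "'b \<Rightarrow> 'b \<Rightarrow> 'b \<Rightarrow> 'b" where
  "ev a b g = (THE v. \<exists>n. pair_span a b n g v)"

lemma ev_eqI:
  assumes "on_curve a b" "pair_span a b n g v"
  shows "ev a b g = v"
  unfolding ev_def
proof (rule the_equality)
  fix w assume "\<exists>m. pair_span a b m g w"
  then obtain m where "pair_span a b m g w" by blast
  then have "pair_span a b (max n m) (g - g) (w - v)"
    using assms(2) by (intro span_diff) (auto intro: span_mono)
  then show "w = v" using span_zero_unique[OF assms(1), of "max n m" "w - v"] by simp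
qed (use assms in blast)

lemma coord_ring_span: "g \<in> coord_ring \<Longrightarrow> on_curve a b \<Longrightarrow> \<exists>n. pair_span a b n g (ev a b g)"
  unfolding coord_ring_def using below_span ev_eqI by blast

lemma coord_ring_closed:
  "g \<in> coord_ring \<Longrightarrow> h \<in> coord_ring \<Longrightarrow> g + h \<in> coord_ring"
  "g \<in> coord_ring \<Longrightarrow> h \<in> coord_ring \<Longrightarrow> g - h \<in> coord_ring"
  "g \<in> coord_ring \<Longrightarrow> h \<in> coord_ring \<Longrightarrow> g * h \<in> coord_ring"
  "c \<in> K \<Longrightarrow> c \<in> coord_ring" "x \<in> coord_ring" "y \<in> coord_ring"
proof -
  assume "g \<in> coord_ring" "h \<in> coord_ring"
  then obtain n m where "g \<in> below n" "h \<in> below m" by (auto simp: coord_ring_def)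
  then have "g \<in> below (Suc (max n m))" "h \<in> below (Suc (max n m))" by (auto elim: below_mono)
  note below_closed(2,3)[OF this] below_mult[OF this]
  then show "g + h \<in> coord_ring" "g - h \<in> coord_ring" "g * h \<in> coord_ring"
    unfolding coord_ring_def by blast+
next
  show "c \<in> K \<Longrightarrow> c \<in> coord_ring" using below_monom[of c 0 0 1] by (auto simp: coord_ring_def)
  show "x \<in> coord_ring" using below_monom[OF K1, of 1 0 "Suc q"] by (auto simp: coord_ring_def)
  show "y \<in> coord_ring" using below_monom[OF K1, of 0 1 "Suc d"] by (auto simp: coord_ring_def)
qed

lemma coord_ring_power: "g \<in> coord_ring \<Longrightarrow> g ^ n \<in> coord_ring"
  by (induction n) (auto intro: coord_ring_closed K1)

lemma coord_ring_sum: "(\<And>i. i \<in> A \<Longrightarrow> h i \<in> coord_ring) \<Longrightarrow> sum h A \<in> coord_ring"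
  by (induction A rule: infinite_finite_induct) (auto intro: coord_ring_closed K0)

lemma ev_hom:
  assumes ab: "on_curve a b"
  shows "g \<in> coord_ring \<Longrightarrow> h \<in> coord_ring \<Longrightarrow> ev a b (g + h) = ev a b g + ev a b h"
    and "g \<in> coord_ring \<Longrightarrow> h \<in> coord_ring \<Longrightarrow> ev a b (g - h) = ev a b g - ev a b h"
    and "g \<in> coord_ring \<Longrightarrow> h \<in> coord_ring \<Longrightarrow> ev a b (g * h) = ev a b g * ev a b h"
    and "c \<in> K \<Longrightarrow> ev a b c = c" and "ev a b x = a" and "ev a b y = b"
proof -
  assume "g \<in> coord_ring" "h \<in> coord_ring"
  then obtain n m where nm: "pair_span a b n g (ev a b g)" "pair_span a b m h (ev a b h)"
    using coord_ring_span[OF _ ab] by blast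
  have *: "pair_span a b (Suc (max n m)) g (ev a b g)" "pair_span a b (Suc (max n m)) h (ev a b h)"
    by (rule span_mono[OF nm(1)], simp, rule span_mono[OF nm(2)], simp)
  show "ev a b (g + h) = ev a b g + ev a b h" "ev a b (g - h) = ev a b g - ev a b h"
    "ev a b (g * h) = ev a b g * ev a b h"
    using ev_eqI[OF ab span_add[OF *(2,1)]] ev_eqI[OF ab span_diff[OF *]] ev_eqI[OF ab span_mult[OF *]]
    by auto
next
  show "c \<in> K \<Longrightarrow> ev a b c = c" using ev_eqI[OF ab monom, of c 0 0 1] by simp
  show "ev a b x = a" using ev_eqI[OF ab monom[OF K1, of 1 0 "Suc q"]] by simp
  show "ev a b y = b" using ev_eqI[OF ab monom[OF K1, of 0 1 "Suc d"]] by simp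
qed

lemma ev_power: "on_curve a b \<Longrightarrow> g \<in> coord_ring \<Longrightarrow> ev a b (g ^ n) = ev a b g ^ n"
  by (induction n) (auto simp: ev_hom K1 coord_ring_power)

lemma ev_sum:
  "on_curve a b \<Longrightarrow> (\<And>i. i \<in> A \<Longrightarrow> h i \<in> coord_ring) \<Longrightarrow> ev a b (sum h A) = (\<Sum>i\<in>A. ev a b (h i))"
  by (induction A rule: infinite_finite_induct) (auto simp: ev_hom K0 coord_ring_sum)

lemma ev_in_K:
  assumes "on_curve a b" "a \<in> K" "b \<in> K" "g \<in> coord_ring"
  shows "ev a b g \<in> K"
proof -
  obtain n where "pair_span a b n g (ev a b g)" using coord_ring_span assms by blast
  then show ?thesis
    by (induction rule: pair_span.induct) (auto intro!: K0 K_add K_mult K_power assms)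
qed

end

subsection \<open>Rational places\<close>

lemma ring_of_type_algebra_ops:
  "carrier ring_of_type_algebra = UNIV" "\<one>\<^bsub>ring_of_type_algebra\<^esub> = 1" "\<zero>\<^bsub>ring_of_type_algebra\<^esub> = 0"
  "a \<oplus>\<^bsub>ring_of_type_algebra\<^esub> b = a + b" "a \<otimes>\<^bsub>ring_of_type_algebra\<^esub> b = a * b"
  by (simp_all add: ring_of_type_algebra_def)

lemma ring_of_type_algebra_minus: "\<ominus>\<^bsub>ring_of_type_algebra\<^esub> a = - (a :: 'b::field)"
proof -
  interpret Ring.field "ring_of_type_algebra :: 'b ring" by (rule field_from_type_algebra)
  have "- a \<oplus>\<^bsub>ring_of_type_algebra\<^esub> a = \<zero>\<^bsub>ring_of_type_algebra\<^esub>"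
    by (simp add: ring_of_type_algebra_ops)
  then show ?thesis by (intro minus_equality) (auto simp: ring_of_type_algebra_ops)
qed

lemma ring_of_type_algebra_inv: "a \<noteq> 0 \<Longrightarrow> inv\<^bsub>ring_of_type_algebra\<^esub> a = inverse (a :: 'b::field)"
proof -
  assume a: "a \<noteq> 0"
  interpret Ring.field "ring_of_type_algebra :: 'b ring" by (rule field_from_type_algebra)
  show ?thesis by (rule comm_inv_char) (use a in \<open>auto simp: ring_of_type_algebra_ops\<close>)
qed

lemma subring_of_type_iff:
  "subring (R :: 'b::field set) ring_of_type_algebra \<longleftrightarrow>
    1 \<in> R \<and> (\<forall>a\<in>R. \<forall>b\<in>R. a + b \<in> R \<and> a * b \<in> R) \<and> (\<forall>a\<in>R. - a \<in> R)"
proof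
  interpret Ring.field "ring_of_type_algebra :: 'b ring" by (rule field_from_type_algebra)
  {
    assume "subring R ring_of_type_algebra"
    from subringE[OF this] show "1 \<in> R \<and> (\<forall>a\<in>R. \<forall>b\<in>R. a + b \<in> R \<and> a * b \<in> R) \<and> (\<forall>a\<in>R. - a \<in> R)"
      by (simp add: ring_of_type_algebra_ops ring_of_type_algebra_minus)
  next
    assume "1 \<in> R \<and> (\<forall>a\<in>R. \<forall>b\<in>R. a + b \<in> R \<and> a * b \<in> R) \<and> (\<forall>a\<in>R. - a \<in> R)"
    then show "subring R ring_of_type_algebra"
      by (intro subringI) (auto simp: ring_of_type_algebra_ops ring_of_type_algebra_minus)
  }
qed

locale valuation_place =
  fixes K F R :: "'b::field set"
  assumes R: "R \<in> valuation_rings K F"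
    and F_mult: "\<And>a b. a \<in> F \<Longrightarrow> b \<in> F \<Longrightarrow> a * b \<in> F" and F_inverse: "\<And>a. a \<in> F \<Longrightarrow> inverse a \<in> F"
begin

definition mm where "mm = maximal_ideal_of R"

lemma R_closed: "1 \<in> R" "a \<in> R \<Longrightarrow> b \<in> R \<Longrightarrow> a + b \<in> R" "a \<in> R \<Longrightarrow> b \<in> R \<Longrightarrow> a * b \<in> R"
  "a \<in> R \<Longrightarrow> - a \<in> R" and KR: "K \<subseteq> R" and RF: "R \<subseteq> F"
  using R by (auto simp: valuation_rings_def subring_of_type_iff)

lemma R_diff: "a \<in> R \<Longrightarrow> b \<in> R \<Longrightarrow> a - b \<in> R"
  using R_closed(2)[of a "- b"] R_closed(4) by simp

lemma R_zero: "0 \<in> R"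
  using R_diff[of 1 1] R_closed(1) by simp

lemma R_power: "a \<in> R \<Longrightarrow> a ^ n \<in> R"
  by (induction n) (auto intro: R_closed)

lemma R_sum: "(\<And>i. i \<in> A \<Longrightarrow> h i \<in> R) \<Longrightarrow> sum h A \<in> R"
  by (induction A rule: infinite_finite_induct) (auto intro: R_zero R_closed)

lemma dichotomy: "z \<in> F \<Longrightarrow> z \<in> R \<or> inverse z \<in> R"
  using R by (auto simp: valuation_rings_def)

lemma mm_R: "z \<in> mm \<Longrightarrow> z \<in> R"
  by (simp add: mm_def maximal_ideal_of_def)

lemma one_notin_mm: "1 \<notin> mm"
  using R_closed(1) by (simp add: mm_def maximal_ideal_of_def)

lemma zero_mm: "0 \<in> mm"
  using R_zero by (simp add: mm_def maximal_ideal_of_def)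

lemma unit: "z \<in> R \<Longrightarrow> z \<notin> mm \<Longrightarrow> inverse z \<in> R"
  by (auto simp: mm_def maximal_ideal_of_def)

lemma unit_nonzero: "z \<notin> mm \<Longrightarrow> z \<noteq> 0"
  using zero_mm by auto

lemma inverse_mm: "z \<in> F \<Longrightarrow> z \<notin> R \<Longrightarrow> inverse z \<in> mm"
  using dichotomy[of z] by (auto simp: mm_def maximal_ideal_of_def)

lemma mm_mult: 
  assumes "z \<in> mm" "w \<in> R" shows "z * w \<in> mm" "w * z \<in> mm"
proof -
  have "inverse (z * w) \<notin> R" if "z * w \<noteq> 0"
  proof
    assume "inverse (z * w) \<in> R"
    then have "w * inverse (z * w) \<in> R" using assms by (intro R_closed)
    moreover have "w * inverse (z * w) = inverse z" using that by (simp add: field_simps)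
    ultimately have "inverse z \<in> R" by (simp only:)
    then show False using assms that by (auto simp: mm_def maximal_ideal_of_def)
  qed
  moreover have "z * w \<in> R" using assms mm_R by (intro R_closed)
  ultimately show "z * w \<in> mm" by (auto simp: mm_def maximal_ideal_of_def)
  then show "w * z \<in> mm" by (simp add: mult.commute)
qed

lemma mm_minus: "z \<in> mm \<Longrightarrow> - z \<in> mm"
  using mm_mult(1)[of z "- 1"] R_closed by simp

lemma mm_add:
  assumes "z \<in> mm" "w \<in> mm"
  shows "z + w \<in> mm"
proof (cases "z = 0 \<or> w = 0")
  case False
  then have nz: "z \<noteq> 0" "w \<noteq> 0" by auto
  have "z * inverse w \<in> F" using assms mm_R RF by (blast intro: F_mult F_inverse)
  from dichotomy[OF this] show ?thesis
  proof
    assume "z * inverse w \<in> R"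
    then have "w * (1 + z * inverse w) \<in> mm" by (intro mm_mult(1)[OF assms(2)] R_closed(2)[OF R_closed(1)])
    moreover have "w * (1 + z * inverse w) = z + w" using nz by (simp add: algebra_simps)
    ultimately show ?thesis by (simp only:)
  next
    assume "inverse (z * inverse w) \<in> R"
    then have "z * (1 + inverse (z * inverse w)) \<in> mm" by (intro mm_mult(1)[OF assms(1)] R_closed(2)[OF R_closed(1)])
    moreover have "z * (1 + inverse (z * inverse w)) = z + w" using nz by (simp add: field_simps)
    ultimately show ?thesis by (simp only:)
  qed
qed (use assms in auto)

lemma mm_diff: "z \<in> mm \<Longrightarrow> w \<in> mm \<Longrightarrow> z - w \<in> mm"
  using mm_add[of z "- w"] mm_minus by simp

lemma mm_sum: "(\<And>i. i \<in> A \<Longrightarrow> h i \<in> mm) \<Longrightarrow> sum h A \<in> mm"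
  by (induction A rule: infinite_finite_induct) (auto intro: zero_mm mm_add)

lemma mm_power: "z \<in> mm \<Longrightarrow> n > 0 \<Longrightarrow> z ^ n \<in> mm"
  by (cases n) (simp_all add: mm_mult(1) R_power mm_R)

lemma power_mm:
  assumes "z \<in> F" "z ^ n \<in> mm" "n > 0"
  shows "z \<in> mm"
proof (rule ccontr)
  assume "z \<notin> mm"
  then have inv: "inverse z \<in> R"
    using dichotomy[OF assms(1)] unit by blast
  have "z \<noteq> 0" using \<open>z \<notin> mm\<close> zero_mm by auto
  have "z ^ n * inverse z ^ n \<in> mm" by (intro mm_mult assms R_power inv)
  moreover have "z ^ n * inverse z ^ n = 1" using \<open>z \<noteq> 0\<close> by (simp flip: power_mult_distrib)
  ultimately show False using one_notin_mm by simp
qed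

lemma unit_mult: "z \<in> R \<Longrightarrow> z \<notin> mm \<Longrightarrow> w \<in> R \<Longrightarrow> w \<notin> mm \<Longrightarrow> z * w \<notin> mm"
proof
  assume *: "z \<in> R" "z \<notin> mm" "w \<in> R" "w \<notin> mm" and "z * w \<in> mm"
  from this(5) unit[OF this(1,2)] have "inverse z * (z * w) \<in> mm" by (rule mm_mult(2))
  then show False using * unit_nonzero[of z] by (simp flip: mult.assoc)
qed

lemma unit_inverse: "z \<in> R \<Longrightarrow> z \<notin> mm \<Longrightarrow> inverse z \<notin> mm"
  using mm_mult(1)[of "inverse z" z] one_notin_mm unit_nonzero[of z] by auto

lemma unit_power: "z \<in> R \<Longrightarrow> z \<notin> mm \<Longrightarrow> z ^ n \<in> R \<and> z ^ n \<notin> mm"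
proof (induction n)
  case (Suc n)
  then show ?case using unit_mult[of z "z ^ n"] R_closed(3)[of z "z ^ n"] by simp
qed (use R_closed(1) one_notin_mm in simp)

lemma add_mm_notin: "z \<notin> mm \<Longrightarrow> w \<in> mm \<Longrightarrow> z + w \<notin> mm"
  using mm_diff[of "z + w" w] by auto

lemma cong_mult: "u - v \<in> mm \<Longrightarrow> u' - v' \<in> mm \<Longrightarrow> u \<in> R \<Longrightarrow> v' \<in> R \<Longrightarrow> u * u' - v * v' \<in> mm"
proof -
  assume "u - v \<in> mm" "u' - v' \<in> mm" "u \<in> R" "v' \<in> R"
  then have "u * (u' - v') + (u - v) * v' \<in> mm" by (intro mm_add mm_mult)
  then show ?thesis by (simp add: algebra_simps)
qed

lemma cong_add: "u - v \<in> mm \<Longrightarrow> u' - v' \<in> mm \<Longrightarrow> u + u' - (v + v') \<in> mm"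
  using mm_add[of "u - v" "u' - v'"] by (simp add: algebra_simps)

lemma cong_power: "u - v \<in> mm \<Longrightarrow> u \<in> R \<Longrightarrow> v \<in> R \<Longrightarrow> u ^ n - v ^ n \<in> mm"
  by (induction n) (auto intro: cong_mult R_power zero_mm)

end

text \<open>Valuation rings are maximal for domination: an element of R2 outside R1 has its inverse
  in the maximal ideal of R1, hence in that of R2, which would then contain 1.\<close>

lemma valuation_place_eqI:
  assumes "valuation_place K F R1" "valuation_place K F R2"
    and sub: "R1 \<subseteq> R2" "maximal_ideal_of R1 \<subseteq> maximal_ideal_of R2"
  shows "R1 = R2"
proof (rule equalityI[OF sub(1)], rule subsetI, rule ccontr)
  interpret R1: valuation_place K F R1 by fact
  interpret R2: valuation_place K F R2 by fact
  fix z assume z: "z \<in> R2" "z \<notin> R1"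
  then have "inverse z \<in> maximal_ideal_of R1" using R1.inverse_mm[of z] R2.RF by (auto simp: R1.mm_def)
  then have "inverse z \<in> R2.mm" using sub by (auto simp: R2.mm_def)
  from R2.mm_mult(1)[OF this z(1)] have "inverse z * z \<in> R2.mm" .
  moreover have "z \<noteq> 0" using z R1.R_zero by auto
  ultimately show False using R2.one_notin_mm by simp
qed

section \<open>The place at infinity and the local rings of affine points\<close>

context as_curve
begin

definition fun_field :: "'b set" where
  "fun_field = {g / h | g h. g \<in> coord_ring \<and> h \<in> coord_ring \<and> h \<noteq> 0}"

lemma fun_fieldI: "g \<in> coord_ring \<Longrightarrow> h \<in> coord_ring \<Longrightarrow> h \<noteq> 0 \<Longrightarrow> g / h \<in> fun_field"
  by (auto simp: fun_field_def)

lemma coord_ring_fun_field: "coord_ring \<subseteq> fun_field"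
proof
  fix g assume "g \<in> coord_ring"
  then show "g \<in> fun_field" using fun_fieldI[of g 1] coord_ring_closed(4)[OF K1] by simp
qed

lemmas coord_ring_ops = coord_ring_closed(1,2,3,5,6)

lemma fun_field_closed:
  "z \<in> fun_field \<Longrightarrow> w \<in> fun_field \<Longrightarrow> z * w \<in> fun_field"
  "z \<in> fun_field \<Longrightarrow> w \<in> fun_field \<Longrightarrow> z + w \<in> fun_field"
  "z \<in> fun_field \<Longrightarrow> inverse z \<in> fun_field"
  "z \<in> fun_field \<Longrightarrow> - z \<in> fun_field"
proof -
  assume "z \<in> fun_field" "w \<in> fun_field"
  then obtain g h g' h' where *: "z = g / h" "w = g' / h'" "g \<in> coord_ring" "h \<in> coord_ring" "h \<noteq> 0"
    "g' \<in> coord_ring" "h' \<in> coord_ring" "h' \<noteq> 0" by (auto simp: fun_field_def)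
  have "z * w = (g * g') / (h * h')" "z + w = (g * h' + g' * h) / (h * h')"
    unfolding *(1,2) using *(5,8) by (simp_all add: field_simps)
  then show "z * w \<in> fun_field" "z + w \<in> fun_field"
    using * by (auto intro!: fun_fieldI coord_ring_ops)
next
  assume "z \<in> fun_field"
  then obtain g h where *: "z = g / h" "g \<in> coord_ring" "h \<in> coord_ring" "h \<noteq> 0" by (auto simp: fun_field_def)
  have "0 - g \<in> coord_ring" using * coord_ring_closed(2,4) K0 by blast
  then have "(- g) / h \<in> fun_field" using * fun_fieldI[of "- g" h] by simp
  then show "- z \<in> fun_field" using * by simp
  show "inverse z \<in> fun_field"
  proof (cases "g = 0")
    case True
    then show ?thesis using * fun_fieldI[of 0 h] by simp
  next
    case False
    then show ?thesis using * fun_fieldI[of h g] by simp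
  qed
qed

lemma place: "R \<in> valuation_rings K fun_field \<Longrightarrow> valuation_place K fun_field R"
  by unfold_locales (auto intro: fun_field_closed)

lemma valuation_ringsI:
  assumes "\<And>a b. a \<in> R \<Longrightarrow> b \<in> R \<Longrightarrow> a + b \<in> R" "\<And>a b. a \<in> R \<Longrightarrow> b \<in> R \<Longrightarrow> a * b \<in> R"
    and "K \<subseteq> R" "R \<subseteq> fun_field" "t \<in> R" "t \<notin> K" "t' \<in> fun_field" "t' \<notin> R"
    and "\<And>z. z \<in> fun_field \<Longrightarrow> z \<in> R \<or> inverse z \<in> R"
  shows "R \<in> valuation_rings K fun_field"
proof -
  have "- a \<in> R" if "a \<in> R" for a
    using assms(2)[of "- 1" a] assms(3) K_minus[OF K1] that by auto
  then have "subring R ring_of_type_algebra"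
    using assms(1-3) K1 by (auto simp: subring_of_type_iff)
  moreover have "K \<subset> R" "R \<subset> fun_field" using assms(3-8) by auto
  ultimately show ?thesis using assms(9) by (simp add: valuation_rings_def)
qed

text \<open>Quotients without pole at infinity: \<open>n\<close> is the exact pole order of the
  denominator and bounds that of the numerator.\<close>

definition inf_ring :: "'b set" where
  "inf_ring = {g / h | g h n. g \<in> below (Suc n) \<and> h \<in> below (Suc n) \<and> h \<notin> below n}"

lemma inf_ringI: "g \<in> below (Suc n) \<Longrightarrow> h \<in> below (Suc n) \<Longrightarrow> h \<notin> below n \<Longrightarrow> g / h \<in> inf_ring"
  by (auto simp: inf_ring_def)

lemma below_coord_ring: "g \<in> below n \<Longrightarrow> g \<in> coord_ring"
  by (auto simp: coord_ring_def)

lemma below_le_mult: "g \<in> below (Suc n) \<Longrightarrow> h \<in> below (Suc m) \<Longrightarrow> g * h \<in> below (Suc (n + m))"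
  using below_mult[of g "Suc n" h m] by simp

lemma one_below: "1 \<in> below (Suc n)"
  using below_monom[OF K1, of 0 0 "Suc n"] by simp

lemma x_exact: "x \<in> below (Suc q)" "x \<notin> below q"
  using below_monom[OF K1, of 1 0 "Suc q"] monom_not_below[of 1 0 q] by auto

lemma x_notin_inf_ring: "x \<notin> inf_ring"
proof
  assume "x \<in> inf_ring"
  then obtain g h n where *: "x = g / h" "g \<in> below (Suc n)" "h \<in> below (Suc n)" "h \<notin> below n"
    by (auto simp: inf_ring_def)
  then have "h \<noteq> 0" using below_closed(1) by metis
  then have "x * h = g" using * by simp
  moreover have "x * h \<notin> below (q + n)" using exact_mult[OF x_exact] * by blast
  moreover have "g \<in> below (q + n)" by (rule below_mono[OF *(2)]) (use q_ge_2 in simp)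
  ultimately show False by simp
qed

lemma inf_ring_valuation: "inf_ring \<in> valuation_rings K fun_field"
proof (rule valuation_ringsI[where t = "1 / x" and t' = x])
  fix a b assume "a \<in> inf_ring" "b \<in> inf_ring"
  then obtain g h n g' h' n' where *: "a = g / h" "g \<in> below (Suc n)" "h \<in> below (Suc n)" "h \<notin> below n"
    "b = g' / h'" "g' \<in> below (Suc n')" "h' \<in> below (Suc n')" "h' \<notin> below n'"
    unfolding inf_ring_def by blast
  have nz: "h \<noteq> 0" "h' \<noteq> 0" using * below_closed(1) by metis+
  have "a * b = (g * g') / (h * h')" "a + b = (g * h' + g' * h) / (h * h')"
    unfolding *(1,5) using nz by (simp_all add: field_simps)
  moreover have "g * g' \<in> below (Suc (n + n'))" "g * h' \<in> below (Suc (n + n'))"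
    using * by (auto intro: below_le_mult)
  moreover have "g' * h \<in> below (Suc (n + n'))"
    using below_le_mult[OF *(6,3)] by (simp add: add.commute)
  ultimately show "a + b \<in> inf_ring" "a * b \<in> inf_ring"
    using inf_ringI[OF _ exact_mult[OF *(3,4,7,8)]] below_closed(2) by simp_all
next
  show "K \<subseteq> inf_ring"
  proof
    fix c assume "c \<in> K"
    then have "c / 1 \<in> inf_ring"
      by (intro inf_ringI[of _ 0]) (use below_monom[of c 0 0 1] one_below below_0 in auto)
    then show "c \<in> inf_ring" by simp
  qed
  show "inf_ring \<subseteq> fun_field"
  proof
    fix z assume "z \<in> inf_ring"
    then obtain g h n where "z = g / h" "g \<in> below (Suc n)" "h \<in> below (Suc n)" "h \<notin> below n"
      by (auto simp: inf_ring_def)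
    then show "z \<in> fun_field" using below_closed(1) by (auto intro!: fun_fieldI below_coord_ring)
  qed
  show "1 / x \<in> inf_ring" by (rule inf_ringI[OF one_below x_exact])
  show "1 / x \<notin> K" using K_inverse[of "1 / x"] x_notin_K by auto
  show "x \<in> fun_field" using coord_ring_fun_field coord_ring_closed by blast
  show "x \<notin> inf_ring" by (rule x_notin_inf_ring)
  fix z assume "z \<in> fun_field"
  then obtain g h where *: "z = g / h" "g \<in> coord_ring" "h \<in> coord_ring" "h \<noteq> 0" by (auto simp: fun_field_def)
  show "z \<in> inf_ring \<or> inverse z \<in> inf_ring"
  proof (cases "g = 0")
    case True
    then show ?thesis using * \<open>K \<subseteq> inf_ring\<close> K0 by auto
  next
    case False
    obtain n where n: "g \<in> below (Suc n)" "g \<notin> below n"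
      using * exact_exists[OF _ False] by (auto simp: coord_ring_def)
    obtain m where m: "h \<in> below (Suc m)" "h \<notin> below m"
      using * exact_exists[of h] by (auto simp: coord_ring_def)
    show ?thesis
    proof (cases "n \<le> m")
      case True
      then have "g \<in> below (Suc m)" using below_mono[OF n(1)] by simp
      then show ?thesis using inf_ringI[OF _ m] * by blast
    next
      case False
      then have "h \<in> below (Suc n)" using below_mono[OF m(1)] by simp
      from inf_ringI[OF this n] show ?thesis using * by simp
    qed
  qed
qed

text \<open>Numerator and denominator are compared with one and the same monomial of weight n; the
  residue is the quotient of the two leading coefficients.\<close>

lemma inf_ring_rational: "inf_ring \<in> rational_places K fun_field"
  unfolding rational_places_def
proof (intro CollectI conjI inf_ring_valuation ballI)
  fix z assume z: "z \<in> inf_ring"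
  interpret valuation_place K fun_field inf_ring by (rule place[OF inf_ring_valuation])
  from z obtain g h n where *: "z = g / h" "g \<in> below (Suc n)" "h \<in> below (Suc n)" "h \<notin> below n"
    by (auto simp: inf_ring_def)
  obtain c i j where c: "c \<in> K" "c \<noteq> 0" "q * i + d * j = n" "h - c * (x ^ i * y ^ j) \<in> below n"
    using exact_leading[OF *(3,4)] .
  obtain c' where c': "c' \<in> K" "g - c' * (x ^ i * y ^ j) \<in> below n"
    using below_leading[OF c(3) *(2)] .
  have K: "c' / c \<in> K" by (intro K_divide c c')
  have "g - c' * (x ^ i * y ^ j) - (c' / c) * (h - c * (x ^ i * y ^ j)) \<in> below n"
    by (intro below_closed c' c K)
  moreover have "g - c' * (x ^ i * y ^ j) - (c' / c) * (h - c * (x ^ i * y ^ j)) = g - (c' / c) * h"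
    using c(2) by (simp add: field_simps)
  ultimately have g1: "g - (c' / c) * h \<in> below n" by (simp only:)
  have hnz: "h \<noteq> 0" using * below_closed(1) by metis
  have z1: "z - c' / c = (g - (c' / c) * h) / h" using *(1) hnz c(2) by (simp add: field_simps)
  have "z - c' / c \<in> inf_ring" by (rule R_diff[OF z]) (use KR K in blast)
  moreover have "inverse (z - c' / c) \<notin> inf_ring" if "z - c' / c \<noteq> 0"
  proof
    assume "inverse (z - c' / c) \<in> inf_ring"
    then obtain k l m where m: "inverse (z - c' / c) = k / l" "k \<in> below (Suc m)" "l \<in> below (Suc m)" "l \<notin> below m"
      by (auto simp: inf_ring_def)
    have lnz: "l \<noteq> 0" using m below_closed(1) by metis
    define G where "G = g - (c' / c) * h"
    have "G \<noteq> 0" using that z1 by (simp add: G_def)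
    moreover have "h / G = k / l" using m(1) unfolding z1 G_def by simp
    ultimately have "h * l = (g - (c' / c) * h) * k"
      using lnz by (simp add: frac_eq_eq G_def mult.commute)
    moreover have "(g - (c' / c) * h) * k \<in> below (n + m)" by (rule below_mult[OF g1 m(2)])
    moreover have "h * l \<notin> below (n + m)" by (rule exact_mult(2)[OF *(3,4) m(3,4)])
    ultimately show False by simp
  qed
  ultimately show "\<exists>c\<in>K. z - c \<in> maximal_ideal_of inf_ring"
    using K by (auto simp: maximal_ideal_of_def)
qed

definition point_ring :: "'b \<Rightarrow> 'b \<Rightarrow> 'b set" where
  "point_ring a b = {g / h | g h. g \<in> coord_ring \<and> h \<in> coord_ring \<and> ev a b h \<noteq> 0}"

lemma point_ringI:
  "g \<in> coord_ring \<Longrightarrow> h \<in> coord_ring \<Longrightarrow> ev a b h \<noteq> 0 \<Longrightarrow> g / h \<in> point_ring a b"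
  by (auto simp: point_ring_def)

lemma ev_nonzero: "on_curve a b \<Longrightarrow> ev a b h \<noteq> 0 \<Longrightarrow> h \<noteq> 0"
  using ev_hom(4)[of a b 0] K0 by auto

lemma power_diff_factor: "(u :: 'b) ^ n - v ^ n = (u - v) * (\<Sum>i<n. u ^ i * v ^ (n - Suc i))"
  using power_diff_sumr2[of u n v] by (simp add: mult.commute)

text \<open>Since \<open>\<partial>/\<partial>y (y\<^sup>q - y) = -1\<close>, the function \<open>y - b\<close> is divisible by \<open>x - a\<close> in the local ring.\<close>

lemma uniformizer:
  assumes ab: "on_curve a b" and K: "a \<in> K" "b \<in> K"
  obtains w where "w \<in> coord_ring" "ev a b w \<noteq> 0"
    "\<And>g. g \<in> coord_ring \<Longrightarrow> \<exists>u\<in>coord_ring. (g - ev a b g) * w = (x - a) * u"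
proof -
  \<comment> \<open>The difference quotient of y^q - y at b. Its value at the point is q b^(q-1) - 1
    = -1.\<close>
  define w where "w = (\<Sum>i<q. y ^ i * b ^ (q - Suc i)) - 1"
  have sums: "(\<Sum>i<n. x ^ i * a ^ (n - Suc i)) \<in> coord_ring" "(\<Sum>i<n. y ^ i * b ^ (n - Suc i)) \<in> coord_ring" for n
    by (intro coord_ring_sum coord_ring_ops coord_ring_power coord_ring_closed(4)[OF K_power] K)+
  have w: "w \<in> coord_ring" unfolding w_def by (intro coord_ring_ops sums coord_ring_closed(4)[OF K1])
  have "ev a b w = (\<Sum>i<q. b ^ i * b ^ (q - Suc i)) - 1"
    unfolding w_def using K sums
    by (simp add: ev_hom[OF ab] ev_sum[OF ab] ev_power[OF ab] K1 K_power coord_ring_closed coord_ring_power)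
  also have "(\<Sum>i<q. b ^ i * b ^ (q - Suc i)) = (\<Sum>i<q. b ^ (q - 1))"
    by (rule sum.cong) (auto simp flip: power_add)
  also have "\<dots> = 0" by (simp add: of_nat_q)
  finally have ev_w: "ev a b w \<noteq> 0" by simp
  have yw: "\<exists>u\<in>coord_ring. (y - b) * w = (x - a) * u"
  proof -
    have "(y - b) * w = (y ^ q - b ^ q) - (y - b)"
      by (simp add: w_def power_diff_factor[of y q b] algebra_simps)
    also have "\<dots> = poly f x - poly f a" using ab curve_eq by (simp add: on_curve_def algebra_simps)
    also have "\<dots> = (\<Sum>i\<le>d. Polynomial.coeff f i * (x ^ i - a ^ i))"
      by (simp add: poly_altdef degree_f sum_subtractf right_diff_distrib)
    also have "\<dots> = (x - a) * (\<Sum>i\<le>d. Polynomial.coeff f i * (\<Sum>k<i. x ^ k * a ^ (i - Suc k)))"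
      unfolding power_diff_factor by (simp add: sum_distrib_left mult_ac)
    finally show ?thesis
      by (rule bexI) (intro coord_ring_sum coord_ring_ops coord_ring_closed(4)[OF coeff_f] sums)
  qed
  have mon: "\<exists>u\<in>coord_ring. (x ^ i * y ^ j - a ^ i * b ^ j) * w = (x - a) * u" for i j
  proof -
    obtain u0 where u0: "u0 \<in> coord_ring" "(y - b) * w = (x - a) * u0" using yw by blast
    define sx where "sx = (\<Sum>k<i. x ^ k * a ^ (i - Suc k))"
    define sy where "sy = (\<Sum>k<j. y ^ k * b ^ (j - Suc k))"
    have "(x ^ i * y ^ j - a ^ i * b ^ j) * w = (x ^ i - a ^ i) * (y ^ j * w) + a ^ i * ((y ^ j - b ^ j) * w)"
      by (simp add: algebra_simps)
    also have "\<dots> = (x - a) * (sx * (y ^ j * w)) + a ^ i * (sy * ((y - b) * w))"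
      by (simp add: power_diff_factor sx_def sy_def mult_ac)
    also have "\<dots> = (x - a) * (sx * (y ^ j * w) + a ^ i * (sy * u0))"
      unfolding u0(2) by (simp add: algebra_simps)
    finally show ?thesis
      by (rule bexI) (unfold sx_def sy_def, intro coord_ring_ops coord_ring_power coord_ring_closed(4)[OF K_power] sums u0 w K)
  qed
  have "\<exists>u\<in>coord_ring. (g - ev a b g) * w = (x - a) * u" if g: "g \<in> coord_ring" for g
  proof -
    obtain n where "pair_span a b n g (ev a b g)" using coord_ring_span[OF g ab] by blast
    then show ?thesis
    proof (induction rule: pair_span.induct)
      case zero
      show ?case using coord_ring_closed(4)[OF K0] by (intro bexI[of _ 0]) auto
    next
      case (step g v c i j)
      then obtain u where u: "u \<in> coord_ring" "(g - v) * w = (x - a) * u" by blast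
      obtain u' where u': "u' \<in> coord_ring" "(x ^ i * y ^ j - a ^ i * b ^ j) * w = (x - a) * u'" using mon by blast
      have "(g + c * x ^ i * y ^ j - (v + c * a ^ i * b ^ j)) * w
          = (g - v) * w + c * ((x ^ i * y ^ j - a ^ i * b ^ j) * w)" by (simp add: algebra_simps)
      also have "\<dots> = (x - a) * (u + c * u')" unfolding u u' by (simp add: algebra_simps)
      finally show ?case
        by (rule bexI) (intro coord_ring_ops u u' coord_ring_closed(4)[OF step.hyps(2)])
    qed
  qed
  with w ev_w show thesis by (rule that)
qed

end

text \<open>\<open>norm_exists\<close> stands in for the norm to K[x]: a nonzero multiple of g in
  K[x] bounds the order of vanishing of g at a point, and this makes the local rings of points
  valuation rings.\<close>

locale algebraic_as_curve = as_curve K x y q d f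
  for K :: "'b::field set" and x y :: 'b and q d :: nat and f :: "'b poly" +
  assumes norm_exists: "\<And>g. g \<in> coord_ring \<Longrightarrow> g \<noteq> 0 \<Longrightarrow>
    \<exists>G z. G \<noteq> 0 \<and> (\<forall>n. Polynomial.coeff G n \<in> K) \<and> z \<in> coord_ring \<and> g * z = poly G x"
begin

definition points :: "('b \<times> 'b) set" where
  "points = {(a, b). a \<in> K \<and> b \<in> K \<and> on_curve a b}"

lemma poly_coord_ring:
  assumes "\<And>n. Polynomial.coeff G n \<in> K"
  shows "poly G x \<in> coord_ring" and "on_curve a b \<Longrightarrow> ev a b (poly G x) = poly G a"
proof -
  have 1: "Polynomial.coeff G i * x ^ i \<in> coord_ring" for i
    by (intro coord_ring_ops coord_ring_power coord_ring_closed(4) assms)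
  then show "poly G x \<in> coord_ring" unfolding poly_altdef by (intro coord_ring_sum)
  assume ab: "on_curve a b"
  have "ev a b (poly G x) = (\<Sum>i\<le>Polynomial.degree G. ev a b (Polynomial.coeff G i * x ^ i))"
    unfolding poly_altdef by (rule ev_sum[OF ab 1])
  also have "\<dots> = poly G a"
    unfolding poly_altdef
    by (intro sum.cong refl)
      (simp add: ev_hom[OF ab] ev_power[OF ab] assms coord_ring_closed coord_ring_power)
  finally show "ev a b (poly G x) = poly G a" .
qed

text \<open>Polynomials over \<open>K\<close> evaluate into \<open>coord_ring\<close>, so the
  quotient by a linear factor has to stay over \<open>K\<close>; its coefficients are recovered from
  the top down.\<close>

lemma poly_synthetic_div_K:
  assumes "\<And>n. Polynomial.coeff G n \<in> K" "a \<in> K" "G = [:-a, 1:] * H"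
  shows "Polynomial.coeff H n \<in> K"
proof -
  have step: "Polynomial.coeff H n \<in> K" if "Polynomial.coeff H (Suc n) \<in> K" for n
  proof -
    have "Polynomial.coeff G (Suc n) = Polynomial.coeff H n - a * Polynomial.coeff H (Suc n)"
      using assms(3) by simp
    then have "Polynomial.coeff H n = Polynomial.coeff G (Suc n) + a * Polynomial.coeff H (Suc n)" by simp
    then show ?thesis using K_add[OF assms(1)[of "Suc n"] K_mult[OF assms(2) that]] by (simp only:)
  qed
  show ?thesis
  proof (cases "n \<le> Suc (Polynomial.degree H)")
    case True
    then show ?thesis
    proof (induction n rule: inc_induct)
      case base
      show ?case using K0 by (simp add: Polynomial.coeff_eq_0)
    qed (rule step)
  next
    case False
    then show ?thesis using K0 by (simp add: Polynomial.coeff_eq_0)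
  qed
qed

text \<open>Factors x - a are extracted from g, up to a unit w of the local ring, as often as
  possible. This stops because g divides G(x), in which x - a has finite order k. At the last step
  the cofactor is nonzero at the point, since otherwise \<open>uniformizer\<close> would extract one
  more factor.\<close>

lemma order_at_point:
  assumes ab: "on_curve a b" and K: "a \<in> K" "b \<in> K" and g: "g \<in> coord_ring" "g \<noteq> 0"
  shows "\<exists>n. \<exists>u\<in>coord_ring. \<exists>w\<in>coord_ring. ev a b u \<noteq> 0 \<and> ev a b w \<noteq> 0 \<and> g * w = (x - a) ^ n * u"
proof -
  define P where "P n \<longleftrightarrow> (\<exists>u\<in>coord_ring. \<exists>w\<in>coord_ring. ev a b w \<noteq> 0 \<and> g * w = (x - a) ^ n * u)" for n
  have xa: "x - a \<noteq> 0" using x_notin_K K by auto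
  have xa_ring: "x - a \<in> coord_ring" by (intro coord_ring_ops coord_ring_closed(4) K)
  have ev_xa: "ev a b (x - a) = 0" using K by (simp add: ev_hom[OF ab] coord_ring_closed)
  have P0: "P 0" unfolding P_def using g coord_ring_closed(4)[OF K1] ev_hom(4)[OF ab K1] by force
  obtain G z where G: "G \<noteq> 0" "\<And>n. Polynomial.coeff G n \<in> K" "z \<in> coord_ring" "g * z = poly G x"
    using norm_exists[OF g] by blast
  have "\<exists>k H. G = [:-a, 1:] ^ k * H \<and> poly H a \<noteq> 0"
    using order_decomp[OF G(1), of a] by (metis dvd_refl poly_eq_0_iff_dvd)
  then obtain k H where H: "G = [:-a, 1:] ^ k * H" "poly H a \<noteq> 0" by blast
  have "\<forall>n. Polynomial.coeff ([:-a, 1:] ^ (k - j) * H) n \<in> K" if "j \<le> k" for j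
    using that
  proof (induction j)
    case 0
    then show ?case using G(2) H(1) by simp
  next
    case (Suc j)
    have "[:-a, 1:] ^ (k - j) * H = [:-a, 1:] * ([:-a, 1:] ^ (k - Suc j) * H)"
      using Suc.prems by (metis Suc_diff_Suc Suc_le_eq mult.assoc power_Suc)
    then show ?case using poly_synthetic_div_K[OF _ K(1)] Suc by (meson Suc_leD)
  qed
  from this[of k] have HK: "Polynomial.coeff H n \<in> K" for n by simp
  note H_ring = poly_coord_ring[OF HK]
  have bound: "n \<le> k" if Pn: "P n" for n
  proof (rule ccontr)
    assume "\<not> n \<le> k"
    then obtain r where r: "n = k + Suc r" by (metis add_Suc_right less_imp_Suc_add not_le)
    obtain u w where uw: "u \<in> coord_ring" "w \<in> coord_ring" "ev a b w \<noteq> 0" "g * w = (x - a) ^ n * u"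
      using Pn by (auto simp: P_def)
    have "(x - a) ^ k * (poly H x * w) = poly G x * w" by (simp add: H(1) algebra_simps)
    also have "\<dots> = (g * w) * z" by (simp add: G(4) [symmetric] algebra_simps)
    also have "\<dots> = (x - a) ^ k * ((x - a) * ((x - a) ^ r * u * z))"
      unfolding uw(4) by (simp add: r power_add algebra_simps)
    finally have "poly H x * w = (x - a) * ((x - a) ^ r * u * z)" using xa by simp
    then have "ev a b (poly H x * w) = ev a b ((x - a) * ((x - a) ^ r * u * z))" by simp
    moreover have "(x - a) ^ r * u * z \<in> coord_ring" by (intro coord_ring_ops coord_ring_power xa_ring uw G)
    ultimately have "poly H a * ev a b w = 0"
      using uw by (simp add: ev_hom(3)[OF ab] H_ring H_ring(2)[OF ab] ev_xa xa_ring)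
    with H uw show False by simp
  qed
  define n where "n = (GREATEST n. P n)"
  have Pn: "P n" unfolding n_def by (rule GreatestI_nat[where P = P, OF P0 bound])
  then obtain u w where uw: "u \<in> coord_ring" "w \<in> coord_ring" "ev a b w \<noteq> 0" "g * w = (x - a) ^ n * u"
    by (auto simp: P_def)
  have "ev a b u \<noteq> 0"
  proof
    assume 0: "ev a b u = 0"
    obtain w0 where w0: "w0 \<in> coord_ring" "ev a b w0 \<noteq> 0"
      "\<And>g. g \<in> coord_ring \<Longrightarrow> \<exists>u\<in>coord_ring. (g - ev a b g) * w0 = (x - a) * u"
      using uniformizer[OF ab K] by blast
    from w0(3)[OF uw(1)] 0 obtain u1 where u1: "u1 \<in> coord_ring" "u * w0 = (x - a) * u1" by auto
    have "g * (w * w0) = (x - a) ^ n * (u * w0)" using uw(4) by (simp flip: mult.assoc)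
    also have "\<dots> = (x - a) ^ Suc n * u1" unfolding u1(2) by simp
    finally have "P (Suc n)"
      unfolding P_def using uw w0 u1 by (intro bexI[of _ u1] bexI[of _ "w * w0"]) (auto simp: ev_hom[OF ab] intro: coord_ring_ops)
    then have "Suc n \<le> n" unfolding n_def by (rule Greatest_le_nat[where P = P]) (rule bound)
    then show False by simp
  qed
  with uw show ?thesis by blast
qed

lemma point_ring_valuation:
  assumes ab: "on_curve a b" and K: "a \<in> K" "b \<in> K"
  shows "point_ring a b \<in> valuation_rings K fun_field"
proof (rule valuation_ringsI[where t = x and t' = "1 / (x - a)"])
  have xa: "x - a \<noteq> 0" using x_notin_K K by auto
  have xa_ring: "x - a \<in> coord_ring" by (intro coord_ring_ops coord_ring_closed(4) K)
  have one: "1 \<in> coord_ring" "ev a b 1 = 1" using coord_ring_closed(4)[OF K1] ev_hom(4)[OF ab K1] by auto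
  fix z w assume "z \<in> point_ring a b" "w \<in> point_ring a b"
  then obtain g h g' h' where *: "z = g / h" "w = g' / h'" "g \<in> coord_ring" "h \<in> coord_ring" "ev a b h \<noteq> 0"
    "g' \<in> coord_ring" "h' \<in> coord_ring" "ev a b h' \<noteq> 0" by (auto simp: point_ring_def)
  have nz: "h \<noteq> 0" "h' \<noteq> 0" using * ev_nonzero[OF ab] by auto
  have "z * w = (g * g') / (h * h')" "z + w = (g * h' + g' * h) / (h * h')"
    unfolding *(1,2) using nz by (simp_all add: field_simps)
  moreover have "ev a b (h * h') \<noteq> 0" using * by (simp add: ev_hom[OF ab])
  ultimately show "z + w \<in> point_ring a b" "z * w \<in> point_ring a b"
    using * by (simp_all add: point_ringI coord_ring_ops)
next
  have xa: "x - a \<noteq> 0" using x_notin_K K by auto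
  have xa_ring: "x - a \<in> coord_ring" by (intro coord_ring_ops coord_ring_closed(4) K)
  have one: "1 \<in> coord_ring" "ev a b 1 = 1" using coord_ring_closed(4)[OF K1] ev_hom(4)[OF ab K1] by auto
  show "K \<subseteq> point_ring a b"
    using point_ringI[OF coord_ring_closed(4) one(1), of _ a b] one(2) by auto
  show "x \<in> point_ring a b" using point_ringI[OF coord_ring_closed(5) one(1), of a b] one(2) by simp
  show "point_ring a b \<subseteq> fun_field"
    unfolding point_ring_def using fun_fieldI ev_nonzero[OF ab] by blast
  show "x \<notin> K" by (rule x_notin_K)
  show "1 / (x - a) \<in> fun_field" by (rule fun_fieldI[OF one(1) xa_ring xa])
  show "1 / (x - a) \<notin> point_ring a b"
  proof
    assume "1 / (x - a) \<in> point_ring a b"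
    then obtain g h where gh: "1 / (x - a) = g / h" "g \<in> coord_ring" "h \<in> coord_ring" "ev a b h \<noteq> 0"
      by (auto simp: point_ring_def)
    then have "h = g * (x - a)" using xa ev_nonzero[OF ab gh(4)] by (simp add: frac_eq_eq)
    then have "ev a b h = ev a b g * (a - a)"
      using gh xa_ring K by (simp add: ev_hom[OF ab] coord_ring_closed)
    with gh show False by simp
  qed
  fix z assume "z \<in> fun_field"
  then obtain g h where *: "z = g / h" "g \<in> coord_ring" "h \<in> coord_ring" "h \<noteq> 0" by (auto simp: fun_field_def)
  show "z \<in> point_ring a b \<or> inverse z \<in> point_ring a b"
  proof (cases "g = 0")
    case True
    then show ?thesis using * \<open>K \<subseteq> point_ring a b\<close> K0 by auto
  next
    case False
    obtain n u w where 1: "u \<in> coord_ring" "w \<in> coord_ring" "ev a b u \<noteq> 0" "ev a b w \<noteq> 0" "g * w = (x - a) ^ n * u"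
      using order_at_point[OF ab K *(2) False] by blast
    obtain m u' w' where 2: "u' \<in> coord_ring" "w' \<in> coord_ring" "ev a b u' \<noteq> 0" "ev a b w' \<noteq> 0" "h * w' = (x - a) ^ m * u'"
      using order_at_point[OF ab K *(3,4)] by blast
    have nz: "u \<noteq> 0" "w \<noteq> 0" "u' \<noteq> 0" "w' \<noteq> 0" using 1 2 ev_nonzero[OF ab] by auto
    have g: "g = (x - a) ^ n * u / w" and h: "h = (x - a) ^ m * u' / w'"
      using 1(5) 2(5) nz by (simp_all add: field_simps)
    have ev: "ev a b (u' * w) \<noteq> 0" "ev a b (u * w') \<noteq> 0" using 1 2 by (simp_all add: ev_hom[OF ab])
    show ?thesis
    proof (cases "m \<le> n")
      case True
      then obtain k where k: "n = m + k" using le_Suc_ex by blast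
      have "z = ((x - a) ^ k * (u * w')) / (u' * w)"
        unfolding *(1) g h using nz xa by (simp add: k power_add field_simps)
      then show ?thesis using ev 1 2 xa_ring by (auto intro!: point_ringI coord_ring_ops coord_ring_power)
    next
      case False
      then obtain k where k: "m = n + k" using le_Suc_ex nat_le_linear by blast
      have "inverse z = ((x - a) ^ k * (u' * w)) / (u * w')"
        unfolding *(1) g h using nz xa by (simp add: k power_add field_simps)
      then show ?thesis using ev 1 2 xa_ring by (auto intro!: point_ringI coord_ring_ops coord_ring_power)
    qed
  qed
qed

lemma point_ring_ideal:
  assumes ab: "on_curve a b" and K: "a \<in> K" "b \<in> K" and g: "g \<in> coord_ring" "h \<in> coord_ring" "ev a b h \<noteq> 0"
  shows "g / h \<in> maximal_ideal_of (point_ring a b) \<longleftrightarrow> ev a b g = 0"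
proof
  have h: "h \<noteq> 0" using ev_nonzero[OF ab g(3)] .
  assume "ev a b g = 0"
  have "inverse (g / h) \<notin> point_ring a b" if "g / h \<noteq> 0"
  proof
    assume "inverse (g / h) \<in> point_ring a b"
    then obtain k l where kl: "inverse (g / h) = k / l" "k \<in> coord_ring" "l \<in> coord_ring" "ev a b l \<noteq> 0"
      by (auto simp: point_ring_def)
    then have "h * l = k * g" using that h ev_nonzero[OF ab kl(4)] by (simp add: frac_eq_eq)
    then have "ev a b h * ev a b l = ev a b k * ev a b g" using g kl by (metis ev_hom(3)[OF ab])
    then show False using \<open>ev a b g = 0\<close> kl g by simp
  qed
  then show "g / h \<in> maximal_ideal_of (point_ring a b)"
    using point_ringI[OF g] by (auto simp: maximal_ideal_of_def)
next
  assume m: "g / h \<in> maximal_ideal_of (point_ring a b)"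
  show "ev a b g = 0"
  proof (rule ccontr)
    assume "ev a b g \<noteq> 0"
    then have "inverse (g / h) \<in> point_ring a b" using point_ringI[OF g(2,1)] by simp
    moreover have "g \<noteq> 0" "h \<noteq> 0" using ev_nonzero[OF ab] g \<open>ev a b g \<noteq> 0\<close> by auto
    ultimately show False using m by (simp add: maximal_ideal_of_def)
  qed
qed

lemma point_ring_rational:
  assumes ab: "on_curve a b" and K: "a \<in> K" "b \<in> K"
  shows "point_ring a b \<in> rational_places K fun_field"
  unfolding rational_places_def
proof (intro CollectI conjI point_ring_valuation assms ballI)
  fix z assume "z \<in> point_ring a b"
  then obtain g h where *: "z = g / h" "g \<in> coord_ring" "h \<in> coord_ring" "ev a b h \<noteq> 0"
    by (auto simp: point_ring_def)
  define c where "c = ev a b g / ev a b h"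
  have c: "c \<in> K" unfolding c_def by (intro K_divide ev_in_K ab K *)
  have h: "h \<noteq> 0" using ev_nonzero[OF ab *(4)] .
  have "z - c = (g - c * h) / h" using * h by (simp add: field_simps)
  moreover have "g - c * h \<in> coord_ring" by (intro coord_ring_ops coord_ring_closed(4) c *)
  moreover have "ev a b (g - c * h) = 0"
  proof -
    have "ev a b (g - c * h) = ev a b g - c * ev a b h"
      using * c by (simp add: ev_hom[OF ab] coord_ring_closed)
    with *(4) show ?thesis by (simp add: c_def)
  qed
  ultimately have "z - c \<in> maximal_ideal_of (point_ring a b)"
    using point_ring_ideal[OF ab K _ *(3,4)] by simp
  with c show "\<exists>c\<in>K. z - c \<in> maximal_ideal_of (point_ring a b)" by blast
qed

text \<open>y is integral over K[x], so both coordinates lie in R and have residues a, b in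
  \<open>K\<close>, which satisfy the curve equation. Elements of the coordinate ring are congruent
  to their values at (a, b), so R dominates \<open>point_ring a b\<close> and equals it.\<close>

lemma rational_place_finite:
  assumes Rr: "R \<in> rational_places K fun_field" and xR: "x \<in> R"
  shows "\<exists>a b. (a, b) \<in> points \<and> R = point_ring a b"
proof -
  have Rv: "R \<in> valuation_rings K fun_field" using Rr by (simp add: rational_places_def)
  interpret valuation_place K fun_field R by (rule place[OF Rv])
  have residue: "\<exists>c\<in>K. z - c \<in> mm" if "z \<in> R" for z
    using Rr that unfolding rational_places_def mm_def by blast
  have K_mm: "c = 0" if "c \<in> K" "c \<in> mm" for c
    using that K_inverse[of c] KR by (auto simp: mm_def maximal_ideal_of_def)
  have fR: "poly f z \<in> R" if "z \<in> R" for z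
    unfolding poly_altdef using KR coeff_f that by (intro R_sum R_closed R_power) auto
  have yR: "y \<in> R"
  proof (rule ccontr)
    assume "y \<notin> R"
    \<comment> \<open>If y had a pole, dividing the curve equation by y^q would put 1 into the
      maximal ideal.\<close>
    then have y1: "inverse y \<in> mm"
      using coord_ring_fun_field coord_ring_closed(6) by (blast intro: inverse_mm)
    have "y \<noteq> 0" using \<open>y \<notin> R\<close> R_zero by auto
    obtain r where r: "q = Suc r" using q_ge_2 by (cases q) auto
    have inv_pow: "y ^ n * inverse y ^ n = 1" for n
      using \<open>y \<noteq> 0\<close> by (simp flip: power_mult_distrib)
    have "y * inverse y ^ q = inverse y ^ (q - 1)"
      unfolding r using \<open>y \<noteq> 0\<close> by (simp flip: mult.assoc)
    with inv_pow[of q] have "poly f x * inverse y ^ q = 1 - inverse y ^ (q - 1)"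
      by (simp only: curve_eq [symmetric] left_diff_distrib)
    then have "1 = poly f x * inverse y ^ q + inverse y ^ (q - 1)" by simp
    moreover have "\<dots> \<in> mm" using q_ge_2 by (intro mm_add mm_mult(2) mm_power y1 fR xR) auto
    ultimately show False using one_notin_mm by simp
  qed
  obtain a where a: "a \<in> K" "x - a \<in> mm" using residue[OF xR] by blast
  obtain b where b: "b \<in> K" "y - b \<in> mm" using residue[OF yR] by blast
  have abR: "a \<in> R" "b \<in> R" using a b KR by auto
  have "poly f x - poly f a \<in> mm"
  proof -
    have "poly f x - poly f a = (\<Sum>i\<le>d. Polynomial.coeff f i * (x ^ i - a ^ i))"
      by (simp add: poly_altdef degree_f sum_subtractf right_diff_distrib)
    also have "\<dots> \<in> mm"
      using KR coeff_f by (intro mm_sum mm_mult(2) cong_power a xR abR) auto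
    finally show ?thesis .
  qed
  moreover have "y ^ q - b ^ q \<in> mm" by (intro cong_power b yR abR)
  ultimately have "(poly f x - poly f a) - (y ^ q - b ^ q) + (y - b) \<in> mm"
    by (rule mm_add[OF mm_diff b(2)])
  then have "b ^ q - b - poly f a \<in> mm" by (simp add: curve_eq [symmetric] algebra_simps)
  moreover have "poly f a \<in> K" unfolding poly_altdef by (intro K_sum K_mult K_power coeff_f a)
  ultimately have ab: "on_curve a b"
    using K_mm[of "b ^ q - b - poly f a"] a b by (auto simp: on_curve_def intro: K_diff K_power)
  have ev_cong: "g \<in> R \<and> g - ev a b g \<in> mm" if g: "g \<in> coord_ring" for g
  proof -
    obtain n where "pair_span a b n g (ev a b g)" using coord_ring_span[OF g ab] by blast
    then show ?thesis
    proof (induction rule: pair_span.induct)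
      case zero
      show ?case using zero_mm R_zero by simp
    next
      case (step g v c i j)
      have cR: "c \<in> R" using step.hyps(2) KR by auto
      have "x ^ i * y ^ j - a ^ i * b ^ j \<in> mm"
        by (rule cong_mult[OF cong_power[OF a(2) xR abR(1)] cong_power[OF b(2) yR abR(2)]
              R_power[OF xR] R_power[OF abR(2)]])
      from mm_mult(2)[OF this cR]
      have "c * x ^ i * y ^ j - c * a ^ i * b ^ j \<in> mm" by (simp add: right_diff_distrib mult.assoc)
      then have "g + c * x ^ i * y ^ j - (v + c * a ^ i * b ^ j) \<in> mm"
        using step.IH cong_add by blast
      moreover have "c * x ^ i * y ^ j \<in> R" by (rule R_closed(3)[OF R_closed(3)[OF cR R_power[OF xR]] R_power[OF yR]])
      ultimately show ?case using step.IH R_closed(2) by blast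
    qed
  qed
  have unit_ev: "h \<notin> mm" if "h \<in> coord_ring" "ev a b h \<noteq> 0" for h
  proof
    assume "h \<in> mm"
    then have "h - (h - ev a b h) \<in> mm" using ev_cong[OF that(1)] mm_diff by blast
    then show False using K_mm[of "ev a b h"] ev_in_K[OF ab a(1) b(1) that(1)] that by simp
  qed
  have quot: "g / h \<in> R" "ev a b g = 0 \<Longrightarrow> g / h \<in> mm" if "g \<in> coord_ring" "h \<in> coord_ring" "ev a b h \<noteq> 0" for g h
  proof -
    have "inverse h \<in> R" using unit[of h] unit_ev[of h] ev_cong[of h] that by blast
    then show "g / h \<in> R" using ev_cong[OF that(1)] by (simp add: divide_inverse R_closed)
    assume "ev a b g = 0"
    then have "g \<in> mm" using ev_cong[OF that(1)] by simp
    with \<open>inverse h \<in> R\<close> show "g / h \<in> mm" by (simp add: divide_inverse mm_mult)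
  qed
  have "point_ring a b = R"
  proof (rule valuation_place_eqI)
    show "valuation_place K fun_field (point_ring a b)" "valuation_place K fun_field R"
      by (intro place point_ring_valuation ab a b Rv)+
    show "point_ring a b \<subseteq> R" using quot by (auto simp: point_ring_def)
    show "maximal_ideal_of (point_ring a b) \<subseteq> maximal_ideal_of R"
    proof
      fix z assume z: "z \<in> maximal_ideal_of (point_ring a b)"
      then have "z \<in> point_ring a b" by (simp add: maximal_ideal_of_def)
      then obtain g h where *: "z = g / h" "g \<in> coord_ring" "h \<in> coord_ring" "ev a b h \<noteq> 0"
        by (auto simp: point_ring_def)
      then have "ev a b g = 0" using z point_ring_ideal[OF ab a(1) b(1), of g h] by simp
      then show "z \<in> maximal_ideal_of R" using quot * by (simp add: mm_def)
    qed
  qed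
  then show ?thesis using ab a b by (auto simp: points_def)
qed

text \<open>If x has a pole, the equation gives y^q = unit * x^d, so the valuations of monomials are
  ordered by weight. Hence R dominates \<open>inf_ring\<close>.\<close>

lemma rational_place_infinite:
  assumes R: "R \<in> valuation_rings K fun_field" and xR: "x \<notin> R"
  shows "R = inf_ring"
proof -
  interpret valuation_place K fun_field R by (rule place[OF R])
  have xF: "x \<in> fun_field" "y \<in> fun_field" using coord_ring_fun_field coord_ring_closed by auto
  define t where "t = inverse x"
  have t: "t \<in> mm" unfolding t_def by (rule inverse_mm[OF xF(1) xR])
  have tx: "x ^ n * t ^ n = 1" for n using x_nonzero by (simp add: t_def flip: power_mult_distrib)
  have K_unit: "c \<notin> mm" if "c \<in> K" "c \<noteq> 0" for c
    using that K_inverse[of c] KR by (auto simp: mm_def maximal_ideal_of_def)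
  \<comment> \<open>This is f(x) / x^d, a unit with residue \<open>lc\<close>.\<close>
  define W where "W = poly f x * t ^ d"
  have W: "W \<in> R \<and> W \<notin> mm"
  proof -
    have "(\<Sum>i<d. Polynomial.coeff f i * x ^ i) * t ^ d \<in> mm"
      unfolding sum_distrib_right
    proof (rule mm_sum)
      fix i assume "i \<in> {..<d}"
      then have "d = i + (d - i)" "d - i > 0" by auto
      then have "Polynomial.coeff f i * x ^ i * t ^ d = Polynomial.coeff f i * (x ^ i * t ^ i) * t ^ (d - i)"
        by (metis mult.assoc power_add)
      also have "\<dots> = Polynomial.coeff f i * t ^ (d - i)" by (simp add: tx)
      also have "\<dots> \<in> mm" using KR coeff_f \<open>d - i > 0\<close> by (intro mm_mult(2) mm_power t) auto
      finally show "Polynomial.coeff f i * x ^ i * t ^ d \<in> mm" .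
    qed
    moreover have "W = lc + (\<Sum>i<d. Polynomial.coeff f i * x ^ i) * t ^ d"
      unfolding W_def poly_f using tx[of d] by (simp add: algebra_simps)
    moreover have lcK: "lc \<in> K" using coeff_f by (simp add: lc_def)
    moreover have "lc \<in> R" using lcK KR by blast
    ultimately show ?thesis
      using add_mm_notin[OF K_unit[OF lcK lc_nonzero]] R_closed(2)[OF _ mm_R] by metis
  qed
  have yR: "y \<notin> R"
  proof
    assume "y \<in> R"
    then have "poly f x \<in> R" unfolding curve_eq [symmetric] by (intro R_diff R_power)
    then have "W \<in> mm" unfolding W_def using d_pos by (intro mm_mult(2) mm_power t) auto
    with W show False by simp
  qed
  then have y1: "inverse y \<in> mm" by (intro inverse_mm xF)
  have y0: "y \<noteq> 0" using yR R_zero by auto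
  \<comment> \<open>Chosen so that y^q - y = y^q * U.\<close>
  define U where "U = 1 + - (inverse y ^ (q - 1))"
  have U: "U \<in> R \<and> U \<notin> mm"
  proof -
    have "- (inverse y ^ (q - 1)) \<in> mm" by (intro mm_minus mm_power y1) (use q_ge_2 in simp)
    then show ?thesis
      unfolding U_def using add_mm_notin[OF one_notin_mm] R_closed(2)[OF R_closed(1) mm_R] by blast
  qed
  define Y where "Y = W * inverse U"
  have Y: "Y \<in> R \<and> Y \<notin> mm"
    unfolding Y_def using unit_mult[of W "inverse U"] unit_inverse[of U] unit[of U] U W R_closed(3)
    by blast
  have Y0: "Y \<noteq> 0" using Y unit_nonzero by auto
  have yq: "y ^ q = Y * x ^ d"
  proof -
    obtain r where r: "q = Suc r" using q_ge_2 by (cases q) auto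
    have "y ^ r * inverse y ^ r = 1" using y0 by (simp flip: power_mult_distrib)
    then have "y ^ q * inverse y ^ (q - 1) = y" unfolding r by (simp add: mult.assoc)
    then have "y ^ q * U = poly f x" by (simp add: U_def curve_eq [symmetric] algebra_simps)
    moreover have "W * x ^ d = poly f x" using tx[of d] by (simp add: W_def mult.assoc mult.commute)
    moreover have "U \<noteq> 0" using U unit_nonzero by auto
    ultimately show ?thesis by (simp add: Y_def field_simps)
  qed
  \<comment> \<open>The q-th power of a monomial is a unit times a power of x with exponent its
    weight, so q-th powers of monomials can be compared; \<open>power_mm\<close> then takes the q-th
    root.\<close>
  have ratio: "(x ^ i * y ^ j) / (x ^ i' * y ^ j') \<in> mm" if lt: "q * i + d * j < q * i' + d * j'" for i j i' j'
  proof (rule power_mm[where n = q])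
    show "(x ^ i * y ^ j) / (x ^ i' * y ^ j') \<in> fun_field"
      by (intro fun_fieldI coord_ring_ops coord_ring_power) (use x_nonzero y0 in auto)
    show "q > 0" using q_ge_2 by simp
    obtain r where r: "q * i' + d * j' = q * i + d * j + Suc r" using less_imp_Suc_add[OF lt] by auto
    have pw: "(x ^ k * y ^ l) ^ q = Y ^ l * x ^ (q * k + d * l)" for k l
    proof -
      have "(x ^ k * y ^ l) ^ q = x ^ (q * k) * (y ^ q) ^ l"
        by (simp add: power_mult_distrib mult.commute flip: power_mult)
      then show ?thesis by (simp add: yq power_mult_distrib power_add power_mult mult_ac)
    qed
    have "((x ^ i * y ^ j) / (x ^ i' * y ^ j')) ^ q = Y ^ j * inverse (Y ^ j') * t ^ Suc r"
      unfolding power_divide pw r using x_nonzero Y0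
      by (simp add: power_add t_def field_simps)
    also have "\<dots> \<in> mm"
      using Y by (intro mm_mult(2) mm_power t R_closed unit R_power) (auto dest: unit_power)
    finally show "((x ^ i * y ^ j) / (x ^ i' * y ^ j')) ^ q \<in> mm" .
  qed
  have below_ratio: "g / (x ^ i * y ^ j) \<in> mm" if g: "g \<in> below n" and n: "q * i + d * j = n" for g n i j
  proof -
    obtain v where "pair_span x y n g v" using g by (auto simp: below_def)
    then show ?thesis
    proof (induction rule: pair_span.induct)
      case (step g v c i' j')
      have "c * ((x ^ i' * y ^ j') / (x ^ i * y ^ j)) \<in> mm"
        by (rule mm_mult(2)[OF ratio]) (use step n KR in auto)
      then have "g / (x ^ i * y ^ j) + c * ((x ^ i' * y ^ j') / (x ^ i * y ^ j)) \<in> mm" by (intro mm_add step.IH)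
      then show ?case by (simp add: add_divide_distrib mult.assoc)
    qed (simp add: zero_mm)
  qed
  have main: "g / h \<in> R \<and> (g \<in> below n \<longrightarrow> g / h \<in> mm)"
    if *: "g \<in> below (Suc n)" "h \<in> below (Suc n)" "h \<notin> below n" for g h n
  proof -
    obtain c i j where c: "c \<in> K" "c \<noteq> 0" "q * i + d * j = n" "h - c * (x ^ i * y ^ j) \<in> below n"
      using exact_leading[OF *(2,3)] .
    obtain c' where c': "c' \<in> K" "g - c' * (x ^ i * y ^ j) \<in> below n"
      using below_leading[OF c(3) *(1)] .
    define m where "m = x ^ i * y ^ j"
    have m0: "m \<noteq> 0" using x_nonzero y0 by (simp add: m_def)
    have "h / m = c + (h - c * m) / m" "g / m = c' + (g - c' * m) / m" using m0 by (simp_all add: field_simps)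
    moreover have "(h - c * m) / m \<in> mm" "(g - c' * m) / m \<in> mm"
      unfolding m_def using below_ratio[OF c(4,3)] below_ratio[OF c'(2) c(3)] by auto
    moreover have "c \<in> R" "c' \<in> R" using c c' KR by auto
    ultimately have hm: "h / m \<in> R" "h / m \<notin> mm" and gm: "g / m \<in> R"
      using add_mm_notin[OF K_unit[OF c(1,2)]] R_closed(2)[OF _ mm_R] by metis+
    have eq: "g / h = (g / m) * inverse (h / m)" using m0 by simp
    have inv: "inverse (h / m) \<in> R" by (rule unit[OF hm])
    have "g / h \<in> mm" if "g \<in> below n"
      unfolding eq using below_ratio[OF that c(3)] inv by (intro mm_mult(1)) (simp_all add: m_def)
    moreover have "g / h \<in> R" unfolding eq by (intro R_closed gm inv)
    ultimately show ?thesis by blast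
  qed
  have "inf_ring = R"
  proof (rule valuation_place_eqI)
    show "valuation_place K fun_field inf_ring" "valuation_place K fun_field R"
      by (intro place inf_ring_valuation R)+
    show "inf_ring \<subseteq> R" using main by (auto simp: inf_ring_def)
    show "maximal_ideal_of inf_ring \<subseteq> maximal_ideal_of R"
    proof
      fix z assume z: "z \<in> maximal_ideal_of inf_ring"
      then have "z \<in> inf_ring" by (simp add: maximal_ideal_of_def)
      then obtain g h n where *: "z = g / h" "g \<in> below (Suc n)" "h \<in> below (Suc n)" "h \<notin> below n"
        by (auto simp: inf_ring_def)
      have "g \<in> below n"
      proof (rule ccontr)
        assume gn: "g \<notin> below n"
        then have "h / g \<in> inf_ring" by (rule inf_ringI[OF *(3,2)])
        then have "inverse z \<in> inf_ring" using * by simp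
        moreover have "g \<noteq> 0" using gn below_closed(1) by metis
        moreover have "h \<noteq> 0" using * below_closed(1) by metis
        ultimately show False using z * by (simp add: maximal_ideal_of_def)
      qed
      then have "z \<in> mm" using main * by blast
      then show "z \<in> maximal_ideal_of R" by (simp add: mm_def)
    qed
  qed
  then show ?thesis ..
qed

theorem card_rational_places: "card (rational_places K fun_field) = Suc (card points)"
proof -
  define pr where "pr = (\<lambda>(a, b). point_ring a b)"
  have fin: "finite points"
    by (rule finite_subset[of _ "K \<times> K"]) (auto simp: points_def finite_K)
  have x_point: "x \<in> point_ring a b" if "(a, b) \<in> points" for a b
    using that point_ringI[OF coord_ring_closed(5) coord_ring_closed(4)[OF K1], of a b]
    by (simp add: points_def ev_hom(4) K1)
  have eq: "rational_places K fun_field = insert inf_ring (pr ` points)"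
  proof (intro equalityI subsetI)
    fix R assume R: "R \<in> rational_places K fun_field"
    then have "R \<in> valuation_rings K fun_field" by (simp add: rational_places_def)
    then show "R \<in> insert inf_ring (pr ` points)"
      using rational_place_finite[OF R] rational_place_infinite[of R] by (cases "x \<in> R") (force simp: pr_def)+
  next
    fix R assume "R \<in> insert inf_ring (pr ` points)"
    then show "R \<in> rational_places K fun_field"
      using inf_ring_rational point_ring_rational by (auto simp: pr_def points_def)
  qed
  have "inf_ring \<notin> pr ` points" using x_point x_notin_inf_ring by (auto simp: pr_def)
  moreover have "inj_on pr points"
  proof (rule inj_onI)
    fix P P' assume P: "P \<in> points" "P' \<in> points" and eq: "pr P = pr P'"
    obtain a b a' b' where PP: "P = (a, b)" "P' = (a', b')" by (metis surj_pair)
    have ab: "on_curve a b" "a \<in> K" "b \<in> K" "on_curve a' b'" "a' \<in> K" "b' \<in> K"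
      using P by (auto simp: PP points_def)
    have eq: "point_ring a b = point_ring a' b'" using eq by (simp add: pr_def PP)
    have one: "1 \<in> coord_ring" "ev a b 1 \<noteq> 0" "ev a' b' 1 \<noteq> 0"
      using coord_ring_closed(4)[OF K1] ev_hom(4)[OF _ K1] ab by auto
    have "ev a b g = 0 \<longleftrightarrow> ev a' b' g = 0" if "g \<in> coord_ring" for g
      using point_ring_ideal[OF ab(1-3) that one(1,2)] point_ring_ideal[OF ab(4-6) that one(1,3)] eq by simp
    from this[of "x - a"] this[of "y - b"] have "a' = a" "b' = b"
      using ab by (simp_all add: ev_hom coord_ring_closed)
    then show "P = P'" by (simp add: PP)
  qed
  ultimately show ?thesis using fin by (simp add: eq card_image)
qed

end

subsection \<open>The first slope of a Newton polygon\<close>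

lemma ereal_mult_cancel_pos:
  assumes "t > 0" "ereal t * m = ereal t * m'"
  shows "m = m'"
  using assms by (cases m; cases m') (auto split: if_splits)

text \<open>Two slopes valid near 0 agree at a point common to both intervals; the finite value at 0
  lets them be compared there, also when a slope is infinite.\<close>

lemma first_slope_eqI:
  assumes "\<epsilon> > 0" "\<And>t. 0 < t \<Longrightarrow> t < \<epsilon> \<Longrightarrow> \<phi> t = \<phi> 0 + ereal t * m" "\<phi> 0 = 0"
  shows "first_slope \<phi> = m"
  unfolding first_slope_def
proof (rule the_equality)
  show "\<exists>\<epsilon>>0. \<forall>t. 0 < t \<and> t < \<epsilon> \<longrightarrow> \<phi> t = \<phi> 0 + ereal t * m"
    using assms(1,2) by blast
  fix m' assume "\<exists>\<epsilon>>0. \<forall>t. 0 < t \<and> t < \<epsilon> \<longrightarrow> \<phi> t = \<phi> 0 + ereal t * m'"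
  then obtain \<epsilon>' where \<epsilon>': "\<epsilon>' > 0" "\<And>t. 0 < t \<Longrightarrow> t < \<epsilon>' \<Longrightarrow> \<phi> t = \<phi> 0 + ereal t * m'" by blast
  define t where "t = min \<epsilon> \<epsilon>' / 2"
  have t: "0 < t" "t < \<epsilon>" "t < \<epsilon>'" using assms(1) \<epsilon>'(1) by (auto simp: t_def)
  have "ereal t * m' = ereal t * m" using assms(2)[OF t(1,2)] \<epsilon>'(2)[OF t(1,3)] assms(3) by simp
  then show "m' = m" by (rule ereal_mult_cancel_pos[OF t(1)])
qed

text \<open>Near 0 the lower hull is the line through the origin whose slope \<open>m\<close> is the
  least \<open>y i / real i\<close> over positive indices: all points lie on or above it, and the
  segment to a minimising point lies in the hull.\<close>

lemma first_slope_newton_polygon_ge: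
  fixes c :: "nat \<Rightarrow> rat" and \<tau> s N :: nat
  assumes c0: "c 0 = 1" and pos: "\<tau> > 0" "s > 0"
    and ord: "\<And>n. c n \<noteq> 0 \<Longrightarrow> int s * int n \<le> int \<tau> * rat_ord p (c n)"
  shows "first_slope (newton_polygon p s N c) \<ge> ereal (1 / real \<tau>)"
proof -
  define y where "y i = real_of_int (rat_ord p (c i)) / real s" for i
  define I where "I = {i. i \<le> N \<and> c i \<noteq> 0}"
  have I0: "0 \<in> I" by (simp add: I_def c0)
  have finI: "finite I" by (simp add: I_def)
  have y0: "y 0 = 0" by (simp add: y_def c0 rat_ord_1)
  define pts where "pts = (\<lambda>i. (real i, y i)) ` I"
  have pts: "{(real i, real_of_int (rat_ord p (c i)) / real s) | i. i \<le> N \<and> c i \<noteq> 0} = pts"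
    by (auto simp: pts_def I_def y_def)
  define \<phi> where "\<phi> = newton_polygon p s N c"
  have \<phi>: "\<phi> t = (INF z \<in> {z. (t, z) \<in> convex hull pts}. ereal z)" for t
    by (simp add: \<phi>_def newton_polygon_def pts)
  have pts0: "(0, 0) \<in> pts" using I0 y0 by (auto simp: pts_def intro!: image_eqI[of _ _ 0])
  have y_ge: "y i \<ge> real i / real \<tau>" if "i \<in> I" for i
  proof -
    have "real_of_int (int s * int i) \<le> real_of_int (int \<tau> * rat_ord p (c i))"
      using ord[of i] that unfolding I_def of_int_le_iff by blast
    then show ?thesis using pos by (simp add: y_def field_simps)
  qed
  show ?thesis
  proof (cases "I = {0}")
    \<comment> \<open>A single point: the polygon is infinite to the right of 0, and the slope
      infinity satisfies the bound.\<close>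
    case True
    then have "pts = {(0, 0)}" by (simp add: pts_def y0)
    then have "\<phi> t = (if t = 0 then 0 else \<infinity>)" for t
      by (auto simp: \<phi> top_ereal_def)
    then have "first_slope \<phi> = \<infinity>" by (intro first_slope_eqI[of 1]) auto
    then show ?thesis by (simp add: \<phi>_def)
  next
    case False
    define J where "J = I - {0}"
    have J: "finite J" "J \<noteq> {}" using finI False I0 by (auto simp: J_def)
    define m where "m = Min ((\<lambda>i. y i / real i) ` J)"
    have "m \<in> (\<lambda>i. y i / real i) ` J" unfolding m_def using J by (intro Min_in) auto
    then obtain k where k: "k \<in> J" "m = y k / real k" by auto
    have k0: "k > 0" using k by (simp add: J_def)
    have m_le: "m * real i \<le> y i" if "i \<in> I" for i
    proof (cases "i = 0")
      case True
      then show ?thesis by (simp add: y0)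
    next
      case False
      then have "m \<le> y i / real i" unfolding m_def using J that by (intro Min_le) (auto simp: J_def)
      then show ?thesis using False by (simp add: field_simps)
    qed
    have hull: "convex hull pts \<subseteq> {z. snd z \<ge> m * fst z}"
    proof (rule hull_minimal)
      show "pts \<subseteq> {z. snd z \<ge> m * fst z}" using m_le by (auto simp: pts_def)
      show "convex {z :: real \<times> real. snd z \<ge> m * fst z}"
      proof (rule convexI)
        fix z w :: "real \<times> real" and a b :: real
        assume *: "z \<in> {z. snd z \<ge> m * fst z}" "w \<in> {z. snd z \<ge> m * fst z}" "0 \<le> a" "0 \<le> b" "a + b = 1"
        then have "a * (m * fst z) + b * (m * fst w) \<le> a * snd z + b * snd w"
          by (intro add_mono mult_left_mono) auto
        then show "a *\<^sub>R z + b *\<^sub>R w \<in> {z. snd z \<ge> m * fst z}" by (simp add: algebra_simps)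
      qed
    qed
    have on_line: "(t, m * t) \<in> convex hull pts" if "0 \<le> t" "t \<le> 1" for t
    proof -
      have "(real k, y k) \<in> pts" using k by (auto simp: pts_def J_def)
      then have "(1 - t / real k) *\<^sub>R (0, 0) + (t / real k) *\<^sub>R (real k, y k) \<in> convex hull pts"
        using that k0 pts0 by (intro convexD convex_convex_hull hull_inc) (auto simp: field_simps)
      moreover have "m * t = t * y k / real k" unfolding k(2) by simp
      ultimately show ?thesis using k0 by simp
    qed
    have \<phi>_eq: "\<phi> t = ereal (m * t)" if "0 \<le> t" "t \<le> 1" for t
      unfolding \<phi>
    proof (rule antisym)
      show "(INF z \<in> {z. (t, z) \<in> convex hull pts}. ereal z) \<le> ereal (m * t)"
        by (rule INF_lower) (use on_line[OF that] in simp)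
      show "ereal (m * t) \<le> (INF z \<in> {z. (t, z) \<in> convex hull pts}. ereal z)"
        by (rule INF_greatest) (use hull in auto)
    qed
    \<comment> \<open>The radius 1 works because the segment ends at an index k >= 1.\<close>
    have "first_slope \<phi> = ereal m"
      by (rule first_slope_eqI[of 1]) (simp_all add: \<phi>_eq zero_ereal_def mult.commute)
    moreover have "m \<ge> 1 / real \<tau>"
      unfolding k(2) using y_ge[of k] k(1) k0 pos by (simp add: J_def field_simps)
    ultimately show ?thesis by (simp add: \<phi>_def)
  qed
qed

subsection \<open>The exponential of a logarithmic series\<close>

lemma fps_exp_log_deriv:
  fixes A :: "rat fps"
  assumes "fps_nth A 0 = 0"
  shows "fps_X * fps_deriv (fps_compose (fps_exp 1) A) = (fps_X * fps_deriv A) * fps_compose (fps_exp 1) A"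
  using fps_compose_deriv[OF assms, of "fps_exp 1"] by (simp add: mult_ac)

lemma log_deriv_recursion:
  fixes L G :: "rat fps"
  assumes "fps_X * fps_deriv L = G * L" "fps_nth G 0 = 0"
  shows "of_nat n * fps_nth L n = (\<Sum>i\<in>{1..n}. fps_nth G i * fps_nth L (n - i))"
proof -
  have "of_nat n * fps_nth L n = fps_nth (fps_X * fps_deriv L) n"
    by (cases n) (simp_all)
  also have "\<dots> = (\<Sum>i=0..n. fps_nth G i * fps_nth L (n - i))"
    unfolding assms(1) by (simp add: fps_mult_nth)
  also have "\<dots> = (\<Sum>i\<in>{1..n}. fps_nth G i * fps_nth L (n - i))"
    by (subst sum.atLeast_Suc_atMost) (simp_all add: assms(2))
  finally show ?thesis .
qed

context as_sums
begin

text \<open>\<open>coef\<close> and the coefficients of the exponential satisfy the same recursion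
  with the same initial value, so the vanishing shown with complex weights carries over to the
  rational series. The series is a polynomial P, and the divisibility of \<open>S i\<close> enters
  as the bound on its logarithmic derivative G.\<close>

theorem fps_ge_exp_sums:
  fixes A :: "rat fps"
  assumes A: "\<And>i. fps_nth A i = (if i = 0 then 0 else of_int (S i) / of_nat i)"
    and r: "r \<ge> 1" "d < p ^ r"
  shows "gauss_val.fps_ge p ((p - 1) * r) s 0 (fps_compose (fps_exp 1) A)"
proof -
  interpret gauss_val p "(p - 1) * r" s by unfold_locales (rule prime_p)
  define L where "L = fps_compose (fps_exp 1) A"
  define G where "G = fps_X * fps_deriv A"
  have G: "fps_nth G i = (if i = 0 then 0 else of_int (S i))" for i
    by (cases i) (simp_all add: G_def A)
  have A0: "fps_nth A 0 = 0" by (simp add: A)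
  have ode: "fps_X * fps_deriv L = G * L" unfolding L_def G_def by (rule fps_exp_log_deriv[OF A0])
  have G0: "fps_nth G 0 = 0" by (simp add: G)
  note rec = log_deriv_recursion[OF ode G0]
  have L0: "fps_nth L 0 = 1" by (simp add: L_def)
  have coef: "of_rat (fps_nth L n) = coef n" for n
  proof (induction n rule: less_induct)
    case (less n)
    show ?case
    proof (cases "n = 0")
      case False
      have "of_nat n * of_rat (fps_nth L n) = (of_rat (of_nat n * fps_nth L n) :: complex)"
        by (simp add: of_rat_mult)
      also have "\<dots> = (\<Sum>i\<in>{1..n}. of_rat (fps_nth G i) * of_rat (fps_nth L (n - i)))"
        unfolding rec by (simp add: of_rat_sum of_rat_mult)
      also have "\<dots> = (\<Sum>i\<in>{1..n}. of_int (S i) * coef (n - i))"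
        by (intro sum.cong refl) (simp add: G less)
      also have "\<dots> = of_nat n * coef n" by (rule coef_recursion [symmetric])
      finally show ?thesis using False by simp
    qed (simp add: L0 coef_0)
  qed
  define N where "N = card B * (d - 1)"
  have vanish: "fps_nth L n = 0" if "n > N" for n
  proof -
    have "(of_rat (fps_nth L n) :: complex) = 0" unfolding coef using that by (intro coef_eq_0) (simp add: N_def)
    then show ?thesis by simp
  qed
  define P where "P = (\<Sum>n\<le>N. Polynomial.monom (fps_nth L n) n)"
  have P: "fps_of_poly P = L"
  proof (rule fps_ext)
    fix n show "fps_nth (fps_of_poly P) n = fps_nth L n"
      using vanish[of n] by (cases "n \<le> N") (auto simp: P_def Polynomial.coeff_sum)
  qed
  have "0 \<le> int ((p - 1) * r) * rat_ord p (fps_nth G i) - int s * int i" if nz: "fps_nth G i \<noteq> 0" for i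
  proof -
    from nz have i: "i > 0" and Si: "S i \<noteq> 0" by (auto simp: G split: if_splits)
    define m where "m = multiplicity (int p) (S i)"
    have ord: "rat_ord p (fps_nth G i) = int m"
      using rat_ord_fract[OF prime_p Si, of 1] i by (simp add: G m_def)
    have coeffs: "Polynomial.coeff f n \<in> fixed_field (p ^ (s * i))" for n
      using fixed_field_power[OF coeff_f, of n i] by (simp add: power_mult)
    \<comment> \<open>Otherwise \<open>affine_points_divisibility\<close> with exponent m + 1 would
      give one factor p more than \<open>S i\<close> has.\<close>
    have "s * i \<le> (p - 1) * r * m"
    proof (rule ccontr)
      assume "\<not> s * i \<le> (p - 1) * r * m"
      then have "(p - 1) * r * Suc m < s * i + (p - 1) * r" by simp
      then have "int p ^ Suc m dvd S i"
        unfolding S_def using s_pos i u_pos r coeffs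
        by (intro affine_points_divisibility[where L = r]) (auto simp: degree_f)
      then have "Suc m \<le> m" unfolding m_def
        using Si p_gt_1 by (intro multiplicity_geI) auto
      then show False by simp
    qed
    then have "int (s * i) \<le> int ((p - 1) * r * m)" by (simp only: of_nat_le_iff)
    then show ?thesis
      unfolding ord by simp
  qed
  then have "fps_ge 0 G" unfolding fps_ge_def term_ge_def by blast
  moreover have "Polynomial.coeff P 0 = 1" using arg_cong[OF P, of "\<lambda>A. fps_nth A 0"] L0 by simp
  ultimately have "fps_ge 0 (fps_of_poly P)" using ode by (intro fps_ge_of_log_deriv[where G = G]) (simp_all add: P)
  then show ?thesis by (simp add: P L_def)
qed

end

subsection \<open>The ambient field\<close>

lemma finite_field_power_CARD: "(c :: 'a::{field,finite}) ^ CARD('a) = c"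
proof (cases "c = 0")
  case True
  then show ?thesis by (simp add: power_0_left)
next
  case False
  have "bij_betw (\<lambda>y. c * y) (UNIV - {0}) (UNIV - {0})"
    by (rule bij_betw_byWitness[where f' = "\<lambda>y. inverse c * y"]) (use False in \<open>auto simp flip: mult.assoc\<close>)
  then have "(\<Prod>y\<in>UNIV - {0}. y) = (\<Prod>y\<in>UNIV - {0}. c * y)" by (rule prod.reindex_bij_betw [symmetric])
  also have "\<dots> = c ^ (CARD('a) - 1) * (\<Prod>y\<in>UNIV - {0}. y)"
    by (simp add: prod.distrib card_Diff_singleton)
  finally have "c ^ (CARD('a) - 1) = 1" by simp
  moreover have "CARD('a) = Suc (CARD('a) - 1)" using finite_UNIV_card_ge_0[where ?'a = 'a] by simp
  ultimately show ?thesis by (metis mult.right_neutral power_Suc)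
qed

lemma of_poly_add: "of_poly (g + h) = of_poly g + of_poly h"
  by (simp add: of_poly_def flip: to_ac_add)

lemma of_poly_mult: "of_poly (g * h) = of_poly g * of_poly h"
  by (simp add: of_poly_def flip: to_ac_mult)

lemma of_poly_eq_iff: "of_poly g = of_poly h \<longleftrightarrow> g = h"
  by (simp add: of_poly_def eq_fract)

lemma of_poly_0: "of_poly 0 = 0" and of_poly_1: "of_poly 1 = 1"
  by (simp_all add: of_poly_def flip: Zero_fract_def One_fract_def)

lemma of_poly_power: "of_poly (g ^ n) = of_poly g ^ n"
  by (induction n) (simp_all add: of_poly_1 of_poly_mult)

definition const :: "'a::field \<Rightarrow> 'a ambient" where
  "const c = of_poly [:c:]"

lemma const_0: "const 0 = 0"
  by (simp add: const_def of_poly_0)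

lemma const_eq_0_iff: "const c = 0 \<longleftrightarrow> c = 0"
  using of_poly_eq_iff[of "[:c:]" 0] by (simp add: const_def of_poly_0)

lemma const_power: "const (c ^ n) = const c ^ n"
  by (simp add: const_def flip: of_poly_power poly_const_pow)

lemma of_poly_eq_poly: "of_poly g = poly (map_poly const g) coord_x"
proof (induction g rule: pCons_induct)
  case 0
  show ?case by (simp add: of_poly_0)
next
  case (pCons a g)
  have "of_poly (pCons a g) = of_poly ([:a:] + [:0, 1:] * g)" by simp
  also have "\<dots> = const a + coord_x * of_poly g"
    by (simp only: of_poly_add of_poly_mult const_def coord_x_def)
  also have "\<dots> = poly (map_poly const (pCons a g)) coord_x"
    using pCons by (simp add: map_poly_pCons const_0)
  finally show ?case .
qed

lemma coeff_map_const: "Polynomial.coeff (map_poly const g) n = const (Polynomial.coeff g n)"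
  by (simp add: coeff_map_poly const_0)

lemma degree_map_const: "Polynomial.degree (map_poly const g) = Polynomial.degree g"
  by (rule degree_map_poly) (simp add: const_eq_0_iff)

lemma coord_x_power_inj:
  assumes "(coord_x :: 'a::field ambient) ^ m = coord_x ^ n"
  shows "m = n"
proof -
  have "[:0, 1 :: 'a:] ^ m = [:0, 1:] ^ n"
    using assms by (simp only: coord_x_def of_poly_eq_iff flip: of_poly_power)
  then have "Polynomial.degree ([:0, 1 :: 'a:] ^ m) = Polynomial.degree ([:0, 1 :: 'a:] ^ n)" by simp
  then show ?thesis by (simp add: degree_power_eq)
qed

section \<open>Algebraicity of the ambient field over the rational functions\<close>

lemma common_denominator:
  fixes P :: "'a::field poly fract poly"
  shows "\<exists>D\<noteq>0. \<forall>j\<le>n. \<exists>N. Polynomial.coeff P j * Fraction_Field.Fract D 1 = Fraction_Field.Fract N 1"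
proof (induction n)
  case 0
  obtain a b where ab: "Polynomial.coeff P 0 = Fraction_Field.Fract a b" "b \<noteq> 0" by (cases "Polynomial.coeff P 0")
  then have "Polynomial.coeff P 0 * Fraction_Field.Fract b 1 = Fraction_Field.Fract a 1" by (simp add: eq_fract)
  then show ?case using ab by auto
next
  case (Suc n)
  then obtain D where D: "D \<noteq> 0" "\<And>j. j \<le> n \<Longrightarrow> \<exists>N. Polynomial.coeff P j * Fraction_Field.Fract D 1 = Fraction_Field.Fract N 1"
    by blast
  obtain a b where ab: "Polynomial.coeff P (Suc n) = Fraction_Field.Fract a b" "b \<noteq> 0"
    by (cases "Polynomial.coeff P (Suc n)")
  have "\<exists>N. Polynomial.coeff P j * Fraction_Field.Fract (D * b) 1 = Fraction_Field.Fract N 1" if "j \<le> Suc n" for j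
  proof (cases "j = Suc n")
    case True
    have "Polynomial.coeff P j * Fraction_Field.Fract (D * b) 1 = Fraction_Field.Fract (a * D) 1"
      using ab D True by (simp add: eq_fract)
    then show ?thesis by blast
  next
    case False
    then obtain N where N: "Polynomial.coeff P j * Fraction_Field.Fract D 1 = Fraction_Field.Fract N 1"
      using D(2)[of j] \<open>j \<le> Suc n\<close> by auto
    have "Polynomial.coeff P j * Fraction_Field.Fract (D * b) 1 =
        (Polynomial.coeff P j * Fraction_Field.Fract D 1) * Fraction_Field.Fract b 1" by (simp add: mult.assoc)
    also have "\<dots> = Fraction_Field.Fract (N * b) 1" unfolding N by simp
    finally show ?thesis by blast
  qed
  then show ?case using D ab by (intro exI[of _ "D * b"]) auto
qed

text \<open>Dividing an annihilating polynomial of g by the largest power of the variable leaves a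
  nonzero constant term and still annihilates the nonzero g; clearing denominators makes the
  coefficients polynomials. The constant term is then a multiple of g, as \<open>norm_exists\<close>
  asks.\<close>

lemma ambient_algebraic:
  fixes g :: "'a::field ambient"
  assumes "g \<noteq> 0"
  shows "\<exists>n N. N 0 \<noteq> 0 \<and> (\<Sum>j\<le>n. of_poly (N j) * g ^ j) = 0"
proof -
  obtain P :: "'a poly fract poly" where P: "P \<noteq> 0" "poly (map_poly to_ac P) g = 0"
    using alg_closure_algebraic[of g] by blast
  obtain R where R: "P = [:- 0, 1:] ^ Polynomial.order 0 P * R" "\<not> [:- 0, 1:] dvd R"
    using order_decomp[OF P(1), of 0] by blast
  define k where "k = Polynomial.order 0 P"
  have R0: "Polynomial.coeff R 0 \<noteq> 0" using R(2) poly_eq_0_iff_dvd[of R 0] by (simp add: poly_0_coeff_0)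
  have "P = Polynomial.monom 1 k * R" using R(1) by (simp add: monom_altdef k_def)
  then have "map_poly to_ac P = Polynomial.monom 1 k * map_poly to_ac R"
    by (intro poly_eqI) (simp add: coeff_map_poly coeff_monom_mult)
  then have "poly (map_poly to_ac R) g = 0" using P(2) assms by (simp add: poly_monom)
  then have sum0: "(\<Sum>j\<le>Polynomial.degree R. to_ac (Polynomial.coeff R j) * g ^ j) = 0"
    by (simp add: poly_altdef coeff_map_poly degree_map_poly)
  obtain D N where D: "D \<noteq> 0"
    and N: "\<And>j. j \<le> Polynomial.degree R \<Longrightarrow> Polynomial.coeff R j * Fraction_Field.Fract D 1 = Fraction_Field.Fract (N j) 1"
    using common_denominator[of "Polynomial.degree R" R] by metis
  have "(\<Sum>j\<le>Polynomial.degree R. of_poly (N j) * g ^ j) =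
      to_ac (Fraction_Field.Fract D 1) * (\<Sum>j\<le>Polynomial.degree R. to_ac (Polynomial.coeff R j) * g ^ j)"
    unfolding sum_distrib_left
    by (intro sum.cong refl) (simp add: of_poly_def N [symmetric] mult_ac)
  then have "(\<Sum>j\<le>Polynomial.degree R. of_poly (N j) * g ^ j) = 0" by (simp add: sum0)
  moreover have "N 0 \<noteq> 0"
  proof
    assume "N 0 = 0"
    then have "Polynomial.coeff R 0 * Fraction_Field.Fract D 1 = 0" using N[of 0] by (simp add: Zero_fract_def)
    moreover have "Fraction_Field.Fract D 1 \<noteq> 0" using D by (simp add: Zero_fract_def eq_fract)
    ultimately show False using R0 by simp
  qed
  ultimately show ?thesis by blast
qed

lemma CHAR_ambient: "CHAR('a::field ambient) = CHAR('a)"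
proof -
  have "CHAR('a poly fract) = CHAR('a poly)"
  proof (rule CHAR_eqI)
    show "of_nat CHAR('a poly) = (0 :: 'a poly fract)" unfolding of_nat_fract Zero_fract_def of_nat_CHAR ..
    show "CHAR('a poly) dvd n" if "of_nat n = (0 :: 'a poly fract)" for n
      using that by (simp add: of_nat_fract Zero_fract_def eq_fract of_nat_eq_0_iff_char_dvd)
  qed
  then show ?thesis by simp
qed

lemma CHAR_finite_field:
  assumes "Factorial_Ring.prime p" "CARD('a::{field,finite}) = p ^ s"
  shows "CHAR('a) = p"
proof -
  have "CHAR('a) dvd p ^ s" using CHAR_dvd_CARD[where ?'a = 'a] assms(2) by simp
  moreover have "CHAR('a) > 0" by (rule finite_imp_CHAR_pos) simp
  then have "Factorial_Ring.prime CHAR('a)" by (rule prime_CHAR_semidom)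
  ultimately show ?thesis using assms(1) by (metis prime_dvd_power primes_dvd_imp_eq)
qed

lemma generate_field_of_type:
  fixes H :: "'b::field set"
  shows "h \<in> H \<Longrightarrow> h \<in> generate_field ring_of_type_algebra H"
    and "1 \<in> generate_field ring_of_type_algebra H"
    and "z \<in> generate_field ring_of_type_algebra H \<Longrightarrow> w \<in> generate_field ring_of_type_algebra H \<Longrightarrow>
      z + w \<in> generate_field ring_of_type_algebra H"
    and "z \<in> generate_field ring_of_type_algebra H \<Longrightarrow> w \<in> generate_field ring_of_type_algebra H \<Longrightarrow>
      z * w \<in> generate_field ring_of_type_algebra H"
    and "z \<in> generate_field ring_of_type_algebra H \<Longrightarrow> z \<noteq> 0 \<Longrightarrow>
      inverse z \<in> generate_field ring_of_type_algebra H"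
  using generate_field.incl[of h H ring_of_type_algebra] generate_field.one[of ring_of_type_algebra H]
    generate_field.eng_add[of z ring_of_type_algebra H w] generate_field.eng_mult[of z ring_of_type_algebra H w]
    generate_field.m_inv[of z ring_of_type_algebra H]
  by (simp_all add: ring_of_type_algebra_ops ring_of_type_algebra_inv)

lemma (in as_curve) generate_field_eq: "generate_field ring_of_type_algebra (K \<union> {x, y}) = fun_field"
proof (intro equalityI subsetI)
  fix z assume "z \<in> generate_field ring_of_type_algebra (K \<union> {x, y})"
  then show "z \<in> fun_field"
  proof (induction rule: generate_field.induct)
    case one
    show ?case using coord_ring_fun_field coord_ring_closed(4)[OF K1] by (auto simp: ring_of_type_algebra_ops)
  next
    case (incl h)
    then show ?case using coord_ring_fun_field coord_ring_closed(4-6) by blast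
  next
    case (m_inv h)
    then show ?case by (simp add: ring_of_type_algebra_ops ring_of_type_algebra_inv fun_field_closed)
  qed (simp_all add: ring_of_type_algebra_ops ring_of_type_algebra_minus fun_field_closed)
next
  define E where "E = generate_field ring_of_type_algebra (K \<union> {x, y})"
  have incl: "c \<in> K \<Longrightarrow> c \<in> E" "x \<in> E" "y \<in> E" for c
    unfolding E_def by (intro generate_field_of_type(1), simp)+
  have E_mult: "z * w \<in> E" if "z \<in> E" "w \<in> E" for z w
    using generate_field_of_type(4) that unfolding E_def .
  have E_power: "z ^ n \<in> E" if "z \<in> E" for z n
    using that E_mult incl(1)[OF K1] by (induction n) auto
  have "g \<in> E" if g: "g \<in> coord_ring" for g
  proof -
    obtain n v where "pair_span x y n g v" using g by (auto simp: coord_ring_def below_def)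
    then show ?thesis
    proof (induction rule: pair_span.induct)
      case zero
      show ?case by (rule incl(1)[OF K0])
    next
      case (step g v c i j)
      have "c * x ^ i * y ^ j \<in> E" by (intro E_mult E_power incl step)
      then show ?case using generate_field_of_type(3) step.IH unfolding E_def by blast
    qed
  qed
  moreover have "inverse h \<in> E" if "h \<in> E" "h \<noteq> 0" for h
    using generate_field_of_type(5) that unfolding E_def by blast
  ultimately have "g / h \<in> E" if "g \<in> coord_ring" "h \<in> coord_ring" "h \<noteq> 0" for g h
    using that E_mult by (simp add: divide_inverse)
  then show "z \<in> E" if "z \<in> fun_field" for z
    using that by (auto simp: fun_field_def)
qed

section \<open>The given curve over all extensions of its constant field\<close>

context
  fixes p s u :: nat and f :: "'a::{field,finite} poly"
  assumes p: "Factorial_Ring.prime p" and s: "s \<ge> 1" and card_a: "CARD('a) = p ^ s" and u: "u \<ge> 1"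
    and d: "Polynomial.degree f \<ge> 1" and coprime_d: "coprime (Polynomial.degree f) p"
begin

interpretation as_sums p "TYPE('a ambient)" s u "Polynomial.degree f" "map_poly const f"
proof unfold_locales
  show "Factorial_Ring.prime p" by (rule p)
  show "CHAR('a ambient) = p" unfolding CHAR_ambient by (rule CHAR_finite_field[OF p card_a])
  show "\<not> p dvd Polynomial.degree f"
    using coprime_d p by (metis coprime_absorb_right not_prime_unit)
  show "Polynomial.coeff (map_poly const f) n \<in> fixed_field (p ^ s)" for n
    unfolding coeff_map_const fixed_field_def card_a [symmetric] mem_Collect_eq
    by (simp only: finite_field_power_CARD flip: const_power)
qed (use s u d in \<open>simp_all add: degree_map_const\<close>)

lemma const_ext_eq: "(const_ext i :: 'a ambient set) = fixed_field (p ^ (s * i))"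
  by (simp add: const_ext_def fixed_field_def card_a power_mult)

text \<open>The summand 1 is the place at infinity; all other places of degree one are affine
  points, which \<open>S i\<close> counts up to the main term.\<close>

lemma card_curve_points:
  assumes i: "i \<ge> 1"
  shows "int (card (curve_points (p ^ u) f i)) = S i + int (CARD('a) ^ i) + 1"
proof -
  have e: "s * i > 0" using s i by simp
  define x where "x = (coord_x :: 'a ambient)"
  define y where "y = coord_y (p ^ u) f"
  define K where "K = (fixed_field (p ^ (s * i)) :: 'a ambient set)"
  have pu: "p ^ u \<ge> 2" using p_gt_1 u by (metis One_nat_def Suc_1 Suc_leI less_le_trans one_less_power zero_less_one)
  have constK: "const c \<in> K" for c
  proof -
    have "const c \<in> fixed_field (p ^ s)"
      unfolding fixed_field_def card_a [symmetric] mem_Collect_eq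
      by (simp only: finite_field_power_CARD flip: const_power)
    from fixed_field_power[OF this, of i] show ?thesis by (simp add: K_def power_mult)
  qed
  interpret C: as_curve K x y "p ^ u" "Polynomial.degree f" "map_poly const f"
  proof unfold_locales
    show "finite K" unfolding K_def by (rule card_fixed_field(1)[OF e])
    have "of_nat p = (0 :: 'a ambient)" using of_nat_CHAR[where ?'a = "'a ambient"] unfolding CHAR_p .
    then show "of_nat (p ^ u) = (0 :: 'a ambient)" using u unfolding of_nat_power by simp
    show "coprime (p ^ u) (Polynomial.degree f)" using coprime_d by (simp add: coprime_commute)
    show "y ^ (p ^ u) - y = poly (map_poly const f) x"
      using coord_y_equation[OF pu, of f] by (simp add: y_def x_def of_poly_eq_poly)
    show "m = n" if "x ^ m = x ^ n" for m n using that unfolding x_def by (rule coord_x_power_inj)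
    show "Polynomial.coeff (map_poly const f) n \<in> K" for n by (simp add: coeff_map_const constK)
  qed (use pu d in \<open>auto simp: K_def degree_map_const intro: fixed_field_closed\<close>)
  have of_poly_ring: "of_poly h \<in> C.coord_ring" for h
    unfolding of_poly_eq_poly poly_altdef x_def [symmetric]
    by (intro C.coord_ring_sum C.coord_ring_ops C.coord_ring_power C.coord_ring_closed(4))
       (simp add: coeff_map_const constK)
  interpret C: algebraic_as_curve K x y "p ^ u" "Polynomial.degree f" "map_poly const f"
  proof unfold_locales
    fix g assume g: "g \<in> C.coord_ring" "g \<noteq> 0"
    obtain n N where N: "N 0 \<noteq> 0" "(\<Sum>j\<le>n. of_poly (N j) * g ^ j) = 0"
      using ambient_algebraic[OF g(2)] by blast
    \<comment> \<open>Solving the annihilating equation for its constant term gives g * z = N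
      0.\<close>
    define z where "z = - 1 * (\<Sum>j<n. of_poly (N (Suc j)) * g ^ j)"
    have "(\<Sum>j\<le>n. of_poly (N j) * g ^ j) = of_poly (N 0) + g * (\<Sum>j<n. of_poly (N (Suc j)) * g ^ j)"
      by (simp add: sum.atMost_shift sum_distrib_left mult_ac)
    then have "- of_poly (N 0) = g * (\<Sum>j<n. of_poly (N (Suc j)) * g ^ j)" using N(2) by (intro minus_unique) simp
    then have "g * z = of_poly (N 0)" unfolding z_def mult_minus1 mult_minus_right by (simp flip: minus_equation_iff)
    moreover have "z \<in> C.coord_ring" unfolding z_def
      by (intro C.coord_ring_ops(3) C.coord_ring_closed(4)[OF C.K_minus[OF C.K1]] C.coord_ring_sum
          of_poly_ring C.coord_ring_power g)
    moreover have "map_poly const (N 0) \<noteq> 0" using N(1) by (simp add: map_poly_eq_0_iff const_0 const_eq_0_iff)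
    ultimately show "\<exists>G z. G \<noteq> 0 \<and> (\<forall>n. Polynomial.coeff G n \<in> K) \<and> z \<in> C.coord_ring \<and> g * z = poly G x"
      by (intro exI[of _ "map_poly const (N 0)"] exI[of _ z])
         (simp add: coeff_map_const constK x_def of_poly_eq_poly)
  qed
  have "curve_points (p ^ u) f i = rational_places K C.fun_field"
    using C.generate_field_eq by (simp add: curve_points_def curve_field_def const_ext_eq K_def x_def y_def)
  then have "card (curve_points (p ^ u) f i) = Suc (card C.points)" by (simp add: C.card_rational_places)
  also have "C.points = affine_points (s * i) u (map_poly const f)"
    unfolding C.points_def affine_points_def C.on_curve_def unfolding K_def by auto
  finally show ?thesis by (simp add: S_def card_a power_mult)
qed

lemma L_series_ord:
  assumes r: "r \<ge> 1" "Polynomial.degree f < p ^ r" and nz: "fps_nth (L_series (p ^ u) f) n \<noteq> 0"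
  shows "int s * int n \<le> int ((p - 1) * r) * rat_ord p (fps_nth (L_series (p ^ u) f) n)"
proof -
  interpret gauss_val p "(p - 1) * r" s by unfold_locales (rule p)
  have "fps_ge 0 (L_series (p ^ u) f)"
    unfolding L_series_def
  proof (rule fps_ge_exp_sums[OF _ r])
    fix i
    show "fps_nth (Abs_fps (\<lambda>i. if i = 0 then 0
          else (of_nat (card (curve_points (p ^ u) f i)) - of_nat (CARD('a) ^ i) - 1) / of_nat i)) i =
        (if i = 0 then 0 else (of_int (S i) :: rat) / of_nat i)"
    proof (cases "i = 0")
      case False
      have "(of_int (int (card (curve_points (p ^ u) f i))) :: rat) = of_int (S i + int (CARD('a) ^ i) + 1)"
        using card_curve_points[of i] False by simp
      then have "(of_nat (card (curve_points (p ^ u) f i)) :: rat) = of_int (S i) + of_nat (CARD('a) ^ i) + 1"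
        by simp
      then show ?thesis using False by simp
    qed simp
  qed
  then have "0 \<le> int ((p - 1) * r) * rat_ord p (fps_nth (L_series (p ^ u) f) n) - int s * int n"
    using nz unfolding fps_ge_def term_ge_def by blast
  then show ?thesis by linarith
qed

end

theorem corollary1:
  fixes p s u d :: nat and f :: "'a::{field,finite} poly" and \<tau> :: real
  assumes "Factorial_Ring.prime p"
    and "s \<ge> 1" and "CARD('a) = p ^ s"
    and "u \<ge> 1"
    and "Polynomial.degree f = d" and "d \<ge> 2" and "gcd d p = 1"
    and "\<tau> = (real p - 1) * real_of_int \<lceil>log (real p) (real d)\<rceil>"
  shows "NP1 p s (p ^ u) f \<ge> ereal (1 / \<tau>)"
proof -
  \<comment> \<open>The conversion by \<open>nat\<close> loses nothing, since the logarithm is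
    positive for d >= 2.\<close>
  define r where "r = nat \<lceil>log (real p) (real d)\<rceil>"
  have p1: "p > 1" using assms(1) prime_gt_1_nat by blast
  have "log (real p) (real d) > 0" using p1 assms(6) by simp
  then have r: "r \<ge> 1" "real_of_int \<lceil>log (real p) (real d)\<rceil> = real r" by (simp_all add: r_def) linarith
  have "log (real p) (real d) \<le> real r" using r(2) by (metis le_of_int_ceiling)
  then have "real d \<le> real p powr real r" using p1 assms(6) by (simp add: log_le_iff)
  then have "d \<le> p ^ r" using p1 by (simp add: powr_realpow flip: of_nat_power of_nat_le_iff)
  \<comment> \<open>A number prime to p is no positive power of p, so the ceiling yields a strict
    inequality and every exponent up to d has at most r digits in base p.\<close>
  moreover have "d \<noteq> p ^ r" using assms(7) r(1) p1 by (cases r) (auto simp: gcd_mult_left)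
  ultimately have dr: "d < p ^ r" by simp
  have \<tau>: "\<tau> = real ((p - 1) * r)" using assms(8) r(2) p1 by (simp add: of_nat_diff)
  have "coprime (Polynomial.degree f) p" using assms(5,7) by (simp add: coprime_iff_gcd_eq_1)
  have ord: "int s * int n \<le> int ((p - 1) * r) * rat_ord p (fps_nth (L_series (p ^ u) f) n)"
    if "fps_nth (L_series (p ^ u) f) n \<noteq> 0" for n
    by (rule L_series_ord[OF assms(1-4)]) (use assms(5,6) r dr that \<open>coprime _ p\<close> in auto)
  have "fps_nth (L_series (p ^ u) f) 0 = 1" by (simp add: L_series_def)
  then show ?thesis
    unfolding NP1_def NP_def \<tau> using p1 r(1) assms(2)
    by (intro first_slope_newton_polygon_ge ord) auto
qed

end
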